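(* Let $L$ be a cycle in a $2$-connected graph $G$, and let $T_1, T_2, \ldots, T_k$ be $L$-bridges of $G$ that are pairwise vertex-disjoint and induce a tree in the overlap graph $O_G(L)$, with each $T_i$ being a tree whose leaves are exactly the attachments of $T_i$. Then there exists a collection $\mathcal{C}$ of cycles in $G$ such that each edge of $L$ lies in exactly two cycles of $\mathcal{C}$, each edge of $G$ not in $L$ lies in at least four cycles of $\mathcal{C}$, and for each cycle $C\in\mathcal{C}$, $L\triangle C$ is a cycle.
   Context: For a subgraph $H$ of a graph $G$, an $H$-bridge of $G$ is either (i) an edge in $E(G)\setminus E(H)$ with both endpoints in $V(H)$, or (ii) a subgraph consisting of a component $D$ of $G-V(H)$ together with all edges between $V(D)$ and $V(H)$. The attachments of an $H$-bridge $B$ are the vertices in $V(H)\cap V(B)$. For a cycle $L$, two $L$-bridges $B_1,B_2$ overlap if $L$ cannot be partitioned into two subpaths $L_1,L_2$ such that the attachments of $B_i$ lie entirely on $L_i$ for $i=1,2$. The overlap graph $O_G(L)$ has the $L$-bridges as vertices, two being adjacent iff they overlap; "$T_1,\dots,T_k$ induce a tree in $O_G(L)$" means the subgraph of $O_G(L)$ induced by these vertices is a tree. For subgraphs $H_1,H_2$ of $G$, $H_1\triangle H_2$ is the subgraph induced by the edge set $E(H_1)\triangle E(H_2)$.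
   Formalization: "Each edge of G not in L lies in at least four cycles" is proved when T_1,…,T_k are all the L-bridges of G (otherwise it can fail: a 6-cycle with two non-crossing chords, k=1); for a selection of bridges it is proved for the edges of the T_i. Cycles in the collection may repeat. *)

theory Defs
  imports "HOL-Library.Multiset"
begin

datatype 'a graph = Graph (verts: "'a set") (edges: "'a set set")

definition simple_graph :: "'a graph \<Rightarrow> bool" where
  "simple_graph G \<longleftrightarrow> finite (verts G) \<and> (\<forall>e \<in> edges G. e \<subseteq> verts G \<and> card e = 2)"

definition subgraph :: "'a graph \<Rightarrow> 'a graph \<Rightarrow> bool" where
  "subgraph H G \<longleftrightarrow> simple_graph H \<and> verts H \<subseteq> verts G \<and> edges H \<subseteq> edges G"

definition induced_subgraph :: "'a graph \<Rightarrow> 'a set \<Rightarrow> 'a graph" where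
  "induced_subgraph G X = Graph (verts G \<inter> X) {e \<in> edges G. e \<subseteq> X}"

definition delete_verts :: "'a graph \<Rightarrow> 'a set \<Rightarrow> 'a graph" where
  "delete_verts G X = induced_subgraph G (verts G - X)"

text \<open>The null graph does not count as connected; in particular a tree has at least one vertex.\<close>

definition connected_graph :: "'a graph \<Rightarrow> bool" where
  "connected_graph G \<longleftrightarrow> verts G \<noteq> {} \<and>
     (\<forall>u \<in> verts G. \<forall>v \<in> verts G. (u, v) \<in> {(x, y). {x, y} \<in> edges G}\<^sup>*)"

definition two_connected :: "'a graph \<Rightarrow> bool" where
  "two_connected G \<longleftrightarrow> card (verts G) > 2 \<and> connected_graph G \<and>
     (\<forall>v \<in> verts G. connected_graph (delete_verts G {v}))"

definition component :: "'a graph \<Rightarrow> 'a graph \<Rightarrow> bool" where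
  "component D G \<longleftrightarrow> subgraph D G \<and> connected_graph D \<and>
     (\<forall>D'. subgraph D' G \<and> connected_graph D' \<and> subgraph D D' \<longrightarrow> D' = D)"

definition path_graph :: "'a graph \<Rightarrow> bool" where
  "path_graph P \<longleftrightarrow> (\<exists>xs. xs \<noteq> [] \<and> distinct xs \<and> verts P = set xs \<and>
     edges P = {{xs ! i, xs ! Suc i} | i. Suc i < length xs})"

definition cycle_graph :: "'a graph \<Rightarrow> bool" where
  "cycle_graph C \<longleftrightarrow> (\<exists>xs. length xs \<ge> 3 \<and> distinct xs \<and> verts C = set xs \<and>
     edges C = {{xs ! i, xs ! (Suc i mod length xs)} | i. i < length xs})"

definition tree_graph :: "'a graph \<Rightarrow> bool" where
  "tree_graph T \<longleftrightarrow> simple_graph T \<and> connected_graph T \<and>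
     \<not> (\<exists>C. subgraph C T \<and> cycle_graph C)"

definition leaves :: "'a graph \<Rightarrow> 'a set" where
  "leaves T = {v \<in> verts T. card {e \<in> edges T. v \<in> e} = 1}"

definition bridge_of_component :: "'a graph \<Rightarrow> 'a graph \<Rightarrow> 'a graph \<Rightarrow> 'a graph" where
  "bridge_of_component G H D =
     (let F = {e \<in> edges G. e \<inter> verts D \<noteq> {} \<and> e \<inter> verts H \<noteq> {}}
      in Graph (verts D \<union> \<Union>F) (edges D \<union> F))"

definition bridges :: "'a graph \<Rightarrow> 'a graph \<Rightarrow> 'a graph set" where
  "bridges G H =
     {Graph e {e} | e. e \<in> edges G - edges H \<and> e \<subseteq> verts H} \<union>
     {bridge_of_component G H D | D. component D (delete_verts G (verts H))}"

definition attachments :: "'a graph \<Rightarrow> 'a graph \<Rightarrow> 'a set" where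
  "attachments H B = verts H \<inter> verts B"

text \<open>A partition of a cycle into two subpaths is a partition of its edges: the two paths
  share their two end vertices.  For bridges with disjoint attachment sets of size at least
  two this gives the same relation as partitioning the vertices.\<close>

definition overlap :: "'a graph \<Rightarrow> 'a graph \<Rightarrow> 'a graph \<Rightarrow> bool" where
  "overlap L B1 B2 \<longleftrightarrow> \<not> (\<exists>L1 L2. path_graph L1 \<and> path_graph L2 \<and>
     verts L1 \<union> verts L2 = verts L \<and> edges L1 \<union> edges L2 = edges L \<and>
     edges L1 \<inter> edges L2 = {} \<and>
     attachments L B1 \<subseteq> verts L1 \<and> attachments L B2 \<subseteq> verts L2)"

definition overlap_graph :: "'a graph \<Rightarrow> 'a graph \<Rightarrow> 'a graph graph" where
  "overlap_graph G L = Graph (bridges G L)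
     {{B1, B2} | B1 B2. B1 \<in> bridges G L \<and> B2 \<in> bridges G L \<and> B1 \<noteq> B2 \<and> overlap L B1 B2}"

definition sym_diff_graph :: "'a graph \<Rightarrow> 'a graph \<Rightarrow> 'a graph" where
  "sym_diff_graph H1 H2 =
     (let F = (edges H1 - edges H2) \<union> (edges H2 - edges H1) in Graph (\<Union>F) F)"

text \<open>A collection of cycles is a multiset, since cycles may have to be repeated: if
  \<open>G\<close> consists of \<open>L\<close> and a single chord, only two cycles of \<open>G\<close> contain that chord.\<close>

definition cover_count :: "'a graph multiset \<Rightarrow> 'a set \<Rightarrow> nat" where
  "cover_count \<C> e = size {#C \<in># \<C>. e \<in> edges C#}"

end

theory Submission imports Defs begin

text \<open>A cycle that meets every tree \<open>T i\<close> in at most one path is determined by its set \<open>E\<close> of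
  edges on \<open>L\<close>, because each path joins the two boundary vertices of \<open>E\<close> on its tree; the
  symmetric difference with \<open>L\<close> corresponds to the complement of \<open>E\<close>.  So the theorem becomes a
  statement about the attachment sets on a cyclically ordered set.  If moreover no \<open>E\<close> passes through an
  attachment along \<open>L\<close>, then double covering of \<open>L\<close> makes every attachment an end of
  four paths, and the edges of the trees are covered four times provided that, for every attachment set
  \<open>q\<close>, the multigraph on \<open>q\<close> formed by the pairs of ends is 4-edge-connected.

  Such a family is found by induction along the overlap tree.  Two cyclically consecutive attachments
  \<open>b', b\<close> of the same tree with at least three attachments can be merged: the family for the
  smaller set is changed by rerouting to \<open>b\<close> the paths that continue from \<open>b'\<close> along the segment
  \<open>K\<close> between them, and \<open>K\<close> is added twice.  Otherwise every segment between consecutive vertices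
  of a leaf \<open>B\<close> of the overlap tree meets its neighbour \<open>s\<close>; then the members of the family without
  \<open>B\<close> that run through a vertex of \<open>B\<close> are cut there and recombined.\<close>

section \<open>Parity of cardinalities\<close>

text \<open>Counting the members through a tree edge is no invariant for the induction, because the
  count depends on the shape of the tree; asking for four separated pairs at every cut of
  \<open>q\<close> forgets the shape. The constant is a degree: two members use the edge before an
  attachment and two others the edge after it.

  When a leaf \<open>B\<close> of the overlap tree is added, each \<open>b \<in> B\<close> lies
  inside exactly two members, and cutting them at \<open>b\<close> gives two halves on either side.
  Halves in consecutive gaps that start on the same side are joined, so that no new member uses both
  edges at a vertex of \<open>B\<close>. Each pair of consecutive vertices of \<open>B\<close> then
  receives two members: a doubled cycle, crossed at least \<open>2 * 2 = 4\<close> times by every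
  cut. The parts of \<open>s\<close> in the gaps are joined in the same pattern. The leaf property
  matters for irreducibility: every other attachment set lies inside one gap, and the parity
  condition on \<open>s\<close> follows from the remaining ones. The complement is needed beyond the
  last claim of the theorem: its irreducibility keeps a member from running through two vertices of
  \<open>B\<close>.\<close>

lemma even_card_sym_diff:
  assumes "finite A" "finite B"
  shows "even (card ((A - B) \<union> (B - A))) \<longleftrightarrow> (even (card A) \<longleftrightarrow> even (card B))"
proof -
  have "card A = card (A \<inter> B) + card (A - B)" "card B = card (B \<inter> A) + card (B - A)"
    using assms by (simp_all only: card_Int_Diff)
  moreover have "card ((A - B) \<union> (B - A)) = card (A - B) + card (B - A)"
    using assms by (intro card_Un_disjoint) auto
  ultimately show ?thesis by (simp add: Int_commute) presburger
qed

lemma even_card_disjoint_Un: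
  assumes "finite A" "finite B" "A \<inter> B = {}"
  shows "even (card (A \<union> B)) \<longleftrightarrow> (even (card A) \<longleftrightarrow> even (card B))"
  using assms by (simp add: card_Un_disjoint)

lemma even_card_Union:
  assumes "finite Q" "\<And>q. q \<in> Q \<Longrightarrow> finite q" "pairwise disjnt Q" "\<And>q. q \<in> Q \<Longrightarrow> even (card q)"
  shows "even (card (\<Union>Q))"
proof -
  have "card (\<Union>Q) = sum card Q"
    using assms by (intro card_Union_disjoint) auto
  then show ?thesis using assms(4) by (simp add: dvd_sum)
qed

section \<open>Edge sets of a cycle\<close>

text \<open>An edge of the cycle is represented by its tail, so that \<open>E \<subseteq> V\<close> stands for the
  edges \<open>{v, nx v}\<close> with \<open>v \<in> E\<close>, and \<open>bd E\<close> is the set of vertices of odd degree.\<close>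

locale cyclic =
  fixes V :: "'a set" and nx pv :: "'a \<Rightarrow> 'a"
  assumes finV: "finite V"
    and nx_pv [simp]: "nx (pv v) = v"
    and pv_nx [simp]: "pv (nx v) = v"
    and nx_in [simp]: "nx v \<in> V \<longleftrightarrow> v \<in> V"
    and one_orbit: "\<lbrakk>Z \<subseteq> V; Z \<noteq> {}; \<And>v. v \<in> Z \<Longrightarrow> nx v \<in> Z\<rbrakk> \<Longrightarrow> Z = V"
begin

lemma pv_in [simp]: "pv v \<in> V \<longleftrightarrow> v \<in> V"
  by (metis nx_in nx_pv)

lemma nx_eq [simp]: "nx u = nx v \<longleftrightarrow> u = v"
  by (metis pv_nx)

lemma pv_eq [simp]: "pv u = pv v \<longleftrightarrow> u = v"
  by (metis nx_pv)

definition bd :: "'a set \<Rightarrow> 'a set" where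
  "bd E = {v. (v \<in> E) \<noteq> (pv v \<in> E)}"

lemma in_bd: "v \<in> bd E \<longleftrightarrow> (v \<in> E) \<noteq> (pv v \<in> E)"
  by (simp add: bd_def)

lemma bd_subset: "E \<subseteq> V \<Longrightarrow> bd E \<subseteq> V"
  unfolding bd_def using pv_in by blast

lemma finite_bd: "E \<subseteq> V \<Longrightarrow> finite (bd E)"
  using finite_subset[OF bd_subset finV] .

lemma bd_empty [simp]: "bd {} = {}"
  by (simp add: bd_def)

lemma bd_Compl: "E \<subseteq> V \<Longrightarrow> bd (V - E) = bd E"
  by (auto simp: bd_def)

lemma bd_Un: "A \<inter> B = {} \<Longrightarrow> bd (A \<union> B) = (bd A - bd B) \<union> (bd B - bd A)"
  by (auto simp: bd_def)

text \<open>\<open>bd E\<close> is the symmetric difference of \<open>E\<close> and its image under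
  \<open>nx\<close>, a set of the same size.\<close>

lemma even_bd:
  assumes "E \<subseteq> V" shows "even (card (bd E))"
proof -
  have fin: "finite E" using assms finV finite_subset by blast
  have "v \<in> nx ` E \<longleftrightarrow> pv v \<in> E" for v
    by (metis image_eqI nx_pv image_iff pv_nx)
  then have "bd E = (E - nx ` E) \<union> (nx ` E - E)"
    by (auto simp: bd_def)
  moreover have "card (nx ` E) = card E" by (simp add: card_image inj_on_def)
  ultimately show ?thesis using even_card_sym_diff[of E "nx ` E"] fin by simp
qed

lemma bd_eq_empty:
  assumes "E \<subseteq> V" "bd E = {}" shows "E = {} \<or> E = V"
  using one_orbit[OF assms(1)] assms(2) by (force simp: bd_def)

lemma bd_eq:
  assumes "A \<subseteq> V" "B \<subseteq> V" "bd A = bd B" shows "A = B \<or> A = V - B"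
proof -
  have "bd ((A - B) \<union> (B - A)) = {}" using assms(3) by (auto simp: bd_def)
  then have "(A - B) \<union> (B - A) = {} \<or> (A - B) \<union> (B - A) = V"
    using assms by (intro bd_eq_empty) auto
  then show ?thesis using assms(1,2) by blast
qed

text \<open>The edge sets with at most two boundary vertices are the segments of the cycle.\<close>

lemma segment_atom:
  assumes R: "R \<subseteq> V" "bd R \<subseteq> {a, c}" and Z: "Z \<subseteq> R" "bd Z \<subseteq> bd R"
  shows "Z = {} \<or> Z = R"
proof -
  have "even (card (bd Z))" "even (card (bd R))" using R Z by (auto intro!: even_bd)
  \<comment> \<open>An even subset of a set with at most two elements is empty or
    everything.\<close>
  have "bd Z = {} \<or> bd Z = bd R"
  proof (rule ccontr)
    assume n: "\<not> ?thesis"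
    then have "bd Z \<subset> bd R" "bd Z \<noteq> {}" using Z by auto
    moreover have "finite (bd R)" using R(2) finite_subset by blast
    ultimately have "0 < card (bd Z)" "card (bd Z) < card (bd R)"
      by (auto simp: psubset_card_mono card_gt_0_iff intro: finite_subset)
    moreover have "card (bd R) \<le> 2"
      using card_mono[OF _ R(2)] card_insert_le_m1[of 2 "{c}" a] by simp
    ultimately have "card (bd Z) = 1" by linarith
    then show False using \<open>even (card (bd Z))\<close> by simp
  qed
  then show ?thesis
  proof
    assume "bd Z = {}"
    then have "Z = {} \<or> Z = V" using R Z by (intro bd_eq_empty) auto
    then show ?thesis using R Z by auto
  next
    assume "bd Z = bd R"
    then have "Z = R \<or> Z = V - R" using R Z by (intro bd_eq) auto
    then show ?thesis using Z by auto
  qed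
qed

section \<open>Gaps: the segments into which a vertex set cuts the cycle\<close>

inductive_set gap :: "'a set \<Rightarrow> 'a \<Rightarrow> 'a set" for X b where
  start: "b \<in> gap X b"
| step: "\<lbrakk>v \<in> gap X b; nx v \<notin> X\<rbrakk> \<Longrightarrow> nx v \<in> gap X b"

lemma gap_subset: "b \<in> V \<Longrightarrow> gap X b \<subseteq> V"
proof
  fix v assume "v \<in> gap X b" "b \<in> V"
  then show "v \<in> V" by induction auto
qed

lemma gap_pv: "v \<in> gap X b \<Longrightarrow> v = b \<or> v \<notin> X \<and> pv v \<in> gap X b"
  by (erule gap.cases) auto

lemma gap_Int: "b \<in> X \<Longrightarrow> gap X b \<inter> X = {b}"
  using gap_pv gap.start by blast

text \<open>Membership in \<open>S\<close> changes only at a vertex of \<open>bd S\<close>, and a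
  gap passes no vertex of \<open>X\<close> after its first one.\<close>

lemma gap_region:
  assumes "bd S \<subseteq> X" shows "gap X b \<subseteq> S \<or> gap X b \<inter> S = {}"
proof -
  have "v \<in> S \<longleftrightarrow> b \<in> S" if "v \<in> gap X b" for v
    using that
  proof induction
    case (step v)
    then have "nx v \<notin> bd S" using assms by auto
    with step show ?case by (simp add: in_bd)
  qed auto
  then show ?thesis by blast
qed

lemma gap_disjoint:
  assumes "v \<in> gap X b" "v \<in> gap X c" "b \<in> X" "c \<in> X" shows "b = c"
  using assms
proof (induction rule: gap.induct)
  case start then show ?case using gap_pv by blast
next
  case (step v) then show ?case using gap_pv[of "nx v" X c] by auto
qed

lemma gap_cover:
  assumes "X \<subseteq> V" "X \<noteq> {}" "v \<in> V" shows "\<exists>b\<in>X. v \<in> gap X b"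
proof -
  let ?Z = "\<Union>b\<in>X. gap X b"
  have "?Z = V"
  proof (rule one_orbit)
    show "?Z \<subseteq> V" using gap_subset assms by blast
    show "?Z \<noteq> {}" using assms gap.start by blast
    show "nx v \<in> ?Z" if "v \<in> ?Z" for v
      using that gap.start[of "nx v" X] gap.step[of v X] by blast
  qed
  then show ?thesis using assms by blast
qed

text \<open>Shifting the gap by \<open>nx\<close> preserves its size, but loses \<open>b\<close> and
  gains the vertices of \<open>X\<close> that are reached; so exactly one vertex of \<open>X\<close>
  is reached. For \<open>X = {b}\<close> it is \<open>b\<close> again.\<close>

lemma ex_next:
  assumes "X \<subseteq> V" "b \<in> X" shows "\<exists>!c. c \<in> X \<and> pv c \<in> gap X b"
proof -
  let ?G = "gap X b"
  have fin: "finite ?G" using gap_subset[of b X] assms finV finite_subset by blast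
  have "nx ` ?G - X = ?G - {b}"
    using gap_pv[of _ X b] gap.step[of _ X b] assms(2)
    by (auto simp: image_iff) (metis nx_pv)
  moreover have "card (nx ` ?G) = card ?G" by (simp add: card_image inj_on_def)
  moreover have "card (nx ` ?G) = card (nx ` ?G - X) + card (nx ` ?G \<inter> X)"
    using card_Int_Diff[of "nx ` ?G" X] fin by simp
  moreover have "card ?G = Suc (card (?G - {b}))"
    using fin gap.start by (metis card_Suc_Diff1)
  ultimately have "card (nx ` ?G \<inter> X) = 1" by simp
  then obtain c where c: "nx ` ?G \<inter> X = {c}" by (auto simp: card_1_singleton_iff)
  have "d \<in> nx ` ?G \<longleftrightarrow> pv d \<in> ?G" for d
    by (metis image_eqI nx_pv image_iff pv_nx)
  then have "d \<in> X \<and> pv d \<in> ?G \<longleftrightarrow> d = c" for d using c by (auto simp: set_eq_iff)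
  then show ?thesis by auto
qed

text \<open>The cyclic successor within \<open>X\<close>. A gap consists of tails, so it ends just
  before the successor \<open>c\<close>, at \<open>pv c\<close>.\<close>

definition nxt :: "'a set \<Rightarrow> 'a \<Rightarrow> 'a" where
  "nxt X b = (if b \<in> X then THE c. c \<in> X \<and> pv c \<in> gap X b else b)"

lemma nxt:
  assumes "X \<subseteq> V" "b \<in> X" shows "nxt X b \<in> X" "pv (nxt X b) \<in> gap X b"
  using theI'[OF ex_next[OF assms]] assms(2) by (auto simp: nxt_def)

lemma nxt_unique:
  assumes "X \<subseteq> V" "b \<in> X" "c \<in> X" "pv c \<in> gap X b" shows "c = nxt X b"
  using ex_next[OF assms(1,2)] nxt[OF assms(1,2)] assms by blast

lemma nxt_neq:
  assumes "X \<subseteq> V" "b \<in> X" "c \<in> X" "c \<noteq> b" shows "nxt X b \<noteq> b"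
proof
  assume eq: "nxt X b = b"
  have "gap X b = V"
  proof (rule one_orbit)
    show "gap X b \<subseteq> V" using assms gap_subset by blast
    show "gap X b \<noteq> {}" using gap.start by blast
    fix v assume v: "v \<in> gap X b"
    show "nx v \<in> gap X b"
    proof (cases "nx v \<in> X")
      case True
      then have "nx v = b" using nxt_unique[OF assms(1,2) True] v eq by simp
      then show ?thesis using gap.start by simp
    qed (use v gap.step in blast)
  qed
  then have "c \<in> gap X b \<inter> X" using assms by auto
  then show False using gap_Int[OF assms(2)] assms(4) by auto
qed

lemma bd_gap:
  assumes "X \<subseteq> V" "b \<in> X" "c \<in> X" "c \<noteq> b" shows "bd (gap X b) = {b, nxt X b}"
proof -
  note n = nxt[OF assms(1,2)] and ne = nxt_neq[OF assms]
  have G: "gap X b \<inter> X = {b}" using gap_Int[OF assms(2)] .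
  have "pv b \<notin> gap X b"
    using nxt_unique[OF assms(1,2,2)] ne by auto
  moreover have "nxt X b \<notin> gap X b" using G n ne by auto
  moreover have "b \<in> gap X b" by (rule gap.start)
  moreover have "v \<in> gap X b \<longleftrightarrow> pv v \<in> gap X b" if "v \<noteq> b" "v \<noteq> nxt X b" for v
    using gap_pv[of v X b] gap.step[of "pv v" X b] nxt_unique[OF assms(1,2), of v] that by auto
  ultimately show ?thesis using n unfolding set_eq_iff in_bd by blast
qed

lemma inj_nxt:
  assumes "X \<subseteq> V" "nxt X b = nxt X c" "b \<in> X" "c \<in> X" shows "b = c"
  using nxt[OF assms(1,3)] nxt[OF assms(1,4)] gap_disjoint assms by metis

text \<open>The gaps that start in \<open>Z\<close> are together closed under \<open>nx\<close> and
  hence cover \<open>V\<close>; a vertex of \<open>X\<close> outside \<open>Z\<close> would lie both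
  in its own gap and in one of these.\<close>

lemma nxt_orbit:
  assumes "X \<subseteq> V" "Z \<subseteq> X" "Z \<noteq> {}" "\<And>b. b \<in> Z \<Longrightarrow> nxt X b \<in> Z" shows "Z = X"
proof -
  let ?W = "\<Union>b\<in>Z. gap X b"
  have "?W = V"
  proof (rule one_orbit)
    show "?W \<subseteq> V" using gap_subset assms by blast
    show "?W \<noteq> {}" using assms(3) gap.start by auto
    fix v assume "v \<in> ?W"
    then obtain b where b: "b \<in> Z" "v \<in> gap X b" by auto
    show "nx v \<in> ?W"
    proof (cases "nx v \<in> X")
      case True
      then have "nx v = nxt X b" using nxt_unique[of X b "nx v"] b assms by auto
      then show ?thesis using assms(4)[OF b(1)] gap.start by auto
    qed (use b gap.step in blast)
  qed
  then have "X \<subseteq> Z"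
    using gap_disjoint[OF gap.start] assms(1,2) by blast
  then show ?thesis using assms by auto
qed

end

section \<open>Families of edge sets\<close>

abbreviation cnt :: "('b \<Rightarrow> bool) \<Rightarrow> 'b multiset \<Rightarrow> nat" where
  "cnt P F \<equiv> size (filter_mset P F)"

lemma cnt_image: "cnt P (image_mset f F) = cnt (\<lambda>x. P (f x)) F"
  by (induction F) auto

lemma cnt_mono2: "(\<And>x. x \<in># F \<Longrightarrow> P x \<Longrightarrow> Q x \<or> R x) \<Longrightarrow> cnt P F \<le> cnt Q F + cnt R F"
  by (induction F) auto

lemma cnt_cong: "(\<And>x. x \<in># F \<Longrightarrow> P x \<longleftrightarrow> Q x) \<Longrightarrow> cnt P F = cnt Q F"
  by (induction F) auto

lemma cnt_xor:
  "(\<And>x. x \<in># F \<Longrightarrow> P x \<longleftrightarrow> Q x \<noteq> R x) \<Longrightarrow> (\<And>x. x \<in># F \<Longrightarrow> \<not> (Q x \<and> R x)) \<Longrightarrow>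
    cnt P F = cnt Q F + cnt R F"
  by (induction F) auto

lemma cnt_0: "(\<And>x. x \<in># F \<Longrightarrow> \<not> P x) \<Longrightarrow> cnt P F = 0"
  by (induction F) auto

context cyclic
begin

text \<open>Let \<open>QQ\<close> be the family of the attachment sets of pairwise disjoint trees.  An edge set
  \<open>E \<subseteq> V\<close> together with, in each tree, the path between the boundary vertices of \<open>E\<close> on this
  tree is a graph with all degrees even.  \<open>closed QQ E Z\<close> says that \<open>Z\<close> is the trace of a
  subgraph with all degrees even, so that \<open>irr\<close> expresses minimality, i.e. being a cycle.
  The last condition in \<open>good\<close> makes every attachment \<open>v\<close> a boundary vertex of
  all sets \<open>E\<close> that contain one of the two edges at \<open>v\<close>.\<close>

definition closed :: "'a set set \<Rightarrow> 'a set \<Rightarrow> 'a set \<Rightarrow> bool" where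
  "closed QQ E Z \<longleftrightarrow> Z \<subseteq> E \<and> bd Z \<subseteq> bd E \<and> (\<forall>q\<in>QQ. even (card (bd Z \<inter> q)))"

definition irr :: "'a set set \<Rightarrow> 'a set \<Rightarrow> bool" where
  "irr QQ E \<longleftrightarrow> (\<forall>Z. closed QQ E Z \<longrightarrow> Z = {} \<or> Z = E)"

definition good :: "'a set set \<Rightarrow> 'a set \<Rightarrow> bool" where
  "good QQ E \<longleftrightarrow> E \<subseteq> V \<and> E \<noteq> {} \<and> bd E \<subseteq> \<Union>QQ \<and> (\<forall>q\<in>QQ. card (bd E \<inter> q) \<in> {0, 2}) \<and>
     irr QQ E \<and> irr QQ (V - E) \<and> (\<forall>v\<in>\<Union>QQ. v \<in> E \<longrightarrow> pv v \<notin> E)"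

definition fam :: "'a set set \<Rightarrow> 'a set multiset \<Rightarrow> bool" where
  "fam QQ F \<longleftrightarrow> (\<forall>E\<in>#F. good QQ E) \<and> (\<forall>v\<in>V. cnt (\<lambda>E. v \<in> E) F = 2) \<and>
     (\<forall>q\<in>QQ. \<forall>X. X \<subseteq> q \<and> X \<noteq> {} \<and> X \<noteq> q \<longrightarrow> 4 \<le> cnt (\<lambda>E. odd (card (bd E \<inter> X))) F)"

text \<open>A segment with both ends on one tree needs a single tree path to be closed up, and
  irreducibility on both sides is \<open>segment_atom\<close>.\<close>

lemma good_segment:
  assumes "E \<subseteq> V" "bd E = {a, c}" "a \<noteq> c" "{a, c} \<subseteq> q" "q \<inter> \<Union>QQ = {}"
    and "\<And>v. v \<in> q \<union> \<Union>QQ \<Longrightarrow> v \<in> E \<Longrightarrow> pv v \<notin> E"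
  shows "good (insert q QQ) E"
proof -
  have "irr (insert q QQ) E'" if "E' \<subseteq> V" "bd E' = {a, c}" for E'
    using segment_atom[of E' a c] that unfolding irr_def closed_def by auto
  moreover have "{a, c} \<inter> p = {}" if "p \<in> QQ" for p using that assms by blast
  moreover have "{a, c} \<inter> q = {a, c}" using assms by auto
  moreover have "E \<noteq> {}" using assms by auto
  ultimately show ?thesis
    using assms bd_Compl[of E] unfolding good_def by auto
qed

text \<open>Both arcs between \<open>a\<close> and \<open>c\<close>, each taken twice: every edge is
  covered twice, and all four members join \<open>a\<close> to \<open>c\<close>.\<close>

lemma fam_pair:
  assumes "q \<subseteq> V" "card q = 2" shows "\<exists>F. fam {q} F"
proof -
  obtain a c where q: "q = {a, c}" "a \<noteq> c" using assms(2) by (auto simp: card_2_iff)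
  define K where "K = gap q a"
  have "nxt q a = c"
    using nxt(1)[of q a] nxt_neq[of q a c] q assms by auto
  then have bK: "bd K = {a, c}" using bd_gap[of q a c] q assms by (simp add: K_def)
  have K: "K \<subseteq> V" using gap_subset assms q K_def by auto
  have bdE: "bd E = q" "E \<subseteq> V" if "E \<in># {#K, K, V - K, V - K#}" for E
    using that bK K q bd_Compl[OF K] by auto
  have "good {q} E" if "E \<in># {#K, K, V - K, V - K#}" for E
    using bdE[OF that] q by (intro good_segment[of E a c]) (auto simp: in_bd)
  moreover have "odd (card (bd E \<inter> X))" if "E \<in># {#K, K, V - K, V - K#}" "X \<subseteq> q" "X \<noteq> {}" "X \<noteq> q" for E X
  proof -
    have "X = {a} \<or> X = {c}" using that q by auto
    then show ?thesis using bdE[OF that(1)] q by auto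
  qed
  then have "cnt (\<lambda>E. odd (card (bd E \<inter> X))) {#K, K, V - K, V - K#} = 4"
    if "X \<subseteq> q" "X \<noteq> {}" "X \<noteq> q" for X
    using that by simp
  ultimately have "fam {q} {#K, K, V - K, V - K#}"
    unfolding fam_def by auto
  then show ?thesis ..
qed

section \<open>Merging two consecutive attachments of one set\<close>

lemma card_swap: "\<lbrakk>finite A; b \<in> A; b' \<notin> A\<rbrakk> \<Longrightarrow> card (insert b' (A - {b})) = card A"
  by (metis card.insert card_Suc_Diff1 finite_Diff DiffD1)

text \<open>Inside \<open>K\<close> only its start \<open>b'\<close> can be a boundary vertex of
  \<open>E\<close>, so \<open>E\<close> contains \<open>K\<close> or avoids it. Removing
  \<open>K\<close> moves an end from \<open>b'\<close> to \<open>b\<close>. A closed subset of the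
  new set, or of its complement, becomes a closed subset of the old one when \<open>K\<close> is
  added to it, or removed from it, as needed.\<close>

lemma split_attachment_good:
  assumes K: "K \<subseteq> V" "bd K = {b', b}" "b' \<in> K" "b \<notin> K"
    and q: "b \<in> q" "b' \<in> q" "K \<inter> (q \<union> \<Union>QQ) = {b'}" "q \<inter> \<Union>QQ = {}" "q \<union> \<Union>QQ \<subseteq> V"
    and E: "good (insert (q - {b}) QQ) E"
  shows "good (insert q QQ) (E - K)" and "K \<subseteq> E \<or> K \<inter> E = {}"
proof -
  have ne: "b \<noteq> b'" using K by auto
  have pb: "pv b \<in> K" "pv b' \<notin> K" using K(2-4) in_bd[of b K] in_bd[of b' K] by auto
  have EV: "E \<subseteq> V" "E \<noteq> {}" and bE: "bd E \<subseteq> (q - {b}) \<union> \<Union>QQ" and irrE: "irr (insert (q - {b}) QQ) E"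
    and irrC: "irr (insert (q - {b}) QQ) (V - E)"
    and np: "\<And>v. v \<in> (q - {b}) \<union> \<Union>QQ \<Longrightarrow> v \<in> E \<Longrightarrow> pv v \<notin> E"
    and c2: "card (bd E \<inter> (q - {b})) \<in> {0, 2}" "\<And>p. p \<in> QQ \<Longrightarrow> card (bd E \<inter> p) \<in> {0, 2}"
    using E unfolding good_def by auto
  have bnot: "b \<notin> \<Union>QQ" "b' \<notin> \<Union>QQ" "b \<notin> bd E" using q bE by auto
  have KE: "v \<notin> bd E" if "v \<in> K" "v \<noteq> b'" for v using that q bE by blast
  have "bd (E \<inter> K) \<subseteq> bd K"
    using KE K(2) unfolding subset_eq in_bd by (metis IntE IntI in_bd insertCI)
  then show alt: "K \<subseteq> E \<or> K \<inter> E = {}"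
    using segment_atom[OF K(1), of b' b "E \<inter> K"] K(2) by auto
  have fin: "finite (bd Z)" if "Z \<subseteq> V" for Z using that finite_bd by blast
  have mem: "b' \<in> q - {b}" using ne q by auto
  from alt show "good (insert q QQ) (E - K)"
  proof
    assume dis: "K \<inter> E = {}"
    have bE': "b \<notin> E" using bnot pb dis by (auto simp: in_bd)
    have "irr (insert q QQ) E'" if "irr (insert (q - {b}) QQ) E'" "bd E' = bd E" for E'
      unfolding irr_def
    proof (intro allI impI)
      fix Z assume Z: "closed (insert q QQ) E' Z"
      then have "bd Z \<inter> (q - {b}) = bd Z \<inter> q" using bnot that(2) unfolding closed_def by auto
      then have "closed (insert (q - {b}) QQ) E' Z" using Z unfolding closed_def by auto
      then show "Z = {} \<or> Z = E'" using that(1) unfolding irr_def by auto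
    qed
    then have "irr (insert q QQ) E" "irr (insert q QQ) (V - E)"
      using irrE irrC bd_Compl[OF EV(1)] by auto
    moreover have "E - K = E" using dis by auto
    moreover have "bd E \<inter> q = bd E \<inter> (q - {b})" using bnot by auto
    moreover have "v \<in> E \<longrightarrow> pv v \<notin> E" if "v \<in> q \<union> \<Union>QQ" for v
      using np[of v] that bE' by (cases "v = b") auto
    ultimately show ?thesis using EV bE c2 unfolding good_def by auto
  next
    assume KsubE: "K \<subseteq> E"
    then have bE': "b \<in> E" "b' \<in> E" "pv b' \<notin> E" using bnot pb K np[OF UnI1, OF mem] by (auto simp: in_bd)
    have "(E - K) \<inter> K = {}" by auto
    then have "bd E = (bd (E - K) - bd K) \<union> (bd K - bd (E - K))"
      using bd_Un[of "E - K" K] KsubE by (simp add: Un_absorb2)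
    moreover have "b \<in> bd (E - K)" "b' \<notin> bd (E - K)" using bE' K pb by (auto simp: in_bd)
    ultimately have bE'': "bd (E - K) = insert b (bd E - {b'})" using K(2) ne bnot by auto
    have b'E: "b' \<in> bd E" using bE' by (simp add: in_bd)
    have swap: "card (insert b' (bd Z \<inter> q - {b})) = card (bd Z \<inter> q)" if "Z \<subseteq> V" "b \<in> bd Z" "b' \<notin> bd Z" for Z
      using that fin q by (intro card_swap) auto
    have "bd E \<inter> (q - {b}) = insert b' (bd (E - K) \<inter> q - {b})"
      using bE'' b'E bnot mem by auto
    then have c1: "card (bd (E - K) \<inter> q) = card (bd E \<inter> (q - {b}))"
      using swap[OF subset_trans[OF Diff_subset EV(1)], of K] bE'' ne by simp
    have c3: "bd (E - K) \<inter> p = bd E \<inter> p" if "p \<in> QQ" for p using bE'' bnot that by auto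
    have i1: "irr (insert q QQ) (E - K)" unfolding irr_def
    proof (intro allI impI)
      fix Z assume Z: "closed (insert q QQ) (E - K) Z"
      then have Z': "Z \<subseteq> E - K" "bd Z \<subseteq> bd (E - K)" unfolding closed_def by auto
      have ZV: "Z \<subseteq> V" using Z' EV by blast
      have b'Z: "b' \<notin> bd Z" using Z' bE'' ne by auto
      show "Z = {} \<or> Z = E - K"
      proof (cases "b \<in> Z")
        case True
        then have bZ: "b \<in> bd Z" using Z' pb by (auto simp: in_bd)
        have bU: "bd (Z \<union> K) = insert b' (bd Z - {b})"
          using bd_Un[of Z K] Z' K(2) bZ b'Z ne by auto
        moreover have "bd (Z \<union> K) \<inter> (q - {b}) = insert b' (bd Z \<inter> q - {b})"
          unfolding bU using mem by auto
        moreover have "bd (Z \<union> K) \<inter> p = bd Z \<inter> p" if "p \<in> QQ" for p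
          unfolding bU using bnot that by auto
        ultimately have "closed (insert (q - {b}) QQ) E (Z \<union> K)"
          using Z Z' KsubE swap[OF ZV bZ b'Z] b'E bE'' EV unfolding closed_def by auto
        then have "Z \<union> K = {} \<or> Z \<union> K = E" using irrE unfolding irr_def by blast
        then show ?thesis using K Z' by auto
      next
        case False
        then have bZ: "b \<notin> bd Z" using Z' pb by (auto simp: in_bd)
        then have "bd Z \<inter> (q - {b}) = bd Z \<inter> q" by auto
        then have "closed (insert (q - {b}) QQ) E Z"
          using Z Z' bE'' bZ unfolding closed_def by auto
        then have "Z = {} \<or> Z = E" using irrE unfolding irr_def by blast
        then show ?thesis using K Z' KsubE by auto
      qed
    qed
    have i2: "irr (insert q QQ) (V - (E - K))" unfolding irr_def
    proof (intro allI impI)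
      fix Z assume Z: "closed (insert q QQ) (V - (E - K)) Z"
      have bC: "bd (V - (E - K)) = bd (E - K)" using EV by (intro bd_Compl) auto
      then have Z': "Z \<subseteq> (V - E) \<union> K" "Z \<subseteq> V" "bd Z \<subseteq> bd (E - K)" using Z unfolding closed_def by auto
      \<comment> \<open>In the new complement \<open>b'\<close> is an inner vertex, so
        \<open>Z\<close> uses both edges at \<open>b'\<close> or neither; this ties the part of
        \<open>Z\<close> in \<open>K\<close> to the part in \<open>V - E\<close>.\<close>
      have "b' \<notin> bd (E - K)" unfolding bE'' using ne by simp
      then have "b' \<notin> bd Z" using Z'(3) by blast
      then have b'Z: "b' \<in> Z \<longleftrightarrow> pv b' \<in> Z" "b' \<notin> bd Z" by (auto simp: in_bd)
      have KZ: "v \<notin> bd Z" if "v \<in> K" for v using that KE Z' bE'' K by auto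
      have "bd (Z \<inter> K) \<subseteq> bd K"
        using KZ K(2) unfolding subset_eq in_bd by (metis IntE IntI in_bd insertCI)
      then consider "Z \<inter> K = {}" | "K \<subseteq> Z"
        using segment_atom[OF K(1), of b' b "Z \<inter> K"] K(2) by auto
      then show "Z = {} \<or> Z = V - (E - K)"
      proof cases
        case 1
        then have "b \<notin> Z" "pv b \<notin> Z" using Z' bE' K pb by auto
        then have bZ: "b \<notin> bd Z" by (auto simp: in_bd)
        then have "bd Z \<inter> (q - {b}) = bd Z \<inter> q" by auto
        then have "closed (insert (q - {b}) QQ) (V - E) Z"
          using Z Z' 1 bE'' bZ bd_Compl[OF EV(1)] unfolding closed_def by auto
        then have "Z = {} \<or> Z = V - E" using irrC unfolding irr_def by blast
        moreover have "pv b' \<in> V - E" using bE' K by auto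
        ultimately show ?thesis using b'Z 1 K by auto
      next
        case 2
        have bZ: "b \<in> bd Z" using Z' bE' K pb 2 by (auto simp: in_bd)
        have b'D: "b' \<in> bd (Z - K)" using b'Z pb 2 K by (auto simp: in_bd)
        have "(Z - K) \<inter> K = {}" by auto
        then have "bd Z = (bd (Z - K) - bd K) \<union> (bd K - bd (Z - K))"
          using bd_Un[of "Z - K" K] 2 by (simp add: Un_absorb2)
        then have bD: "bd (Z - K) = insert b' (bd Z - {b})" using K(2) bZ b'D b'Z ne by auto
        moreover have "bd (Z - K) \<inter> (q - {b}) = insert b' (bd Z \<inter> q - {b})"
          unfolding bD using mem by auto
        moreover have "bd (Z - K) \<inter> p = bd Z \<inter> p" if "p \<in> QQ" for p
          unfolding bD using bnot that by auto
        ultimately have "closed (insert (q - {b}) QQ) (V - E) (Z - K)"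
          using Z Z' swap[OF Z'(2) bZ b'Z(2)] bZ b'Z b'E bE'' EV bd_Compl[OF EV(1)] unfolding closed_def by auto
        then have "Z - K = {} \<or> Z - K = V - E" using irrC unfolding irr_def by blast
        moreover have "pv b' \<in> Z - K" using b'Z 2 K pb by auto
        ultimately show ?thesis using 2 K EV by auto
      qed
    qed
    have "E - K \<noteq> {}" using bE' K by auto
    moreover have "bd (E - K) \<subseteq> q \<union> \<Union>QQ" using bE'' bE q by auto
    moreover have "v \<in> E - K \<longrightarrow> pv v \<notin> E - K" if "v \<in> q \<union> \<Union>QQ" for v
      using np[of v] that pb by (cases "v = b") auto
    ultimately show ?thesis
      using EV c1 c2 c3 i1 i2 unfolding good_def by auto
  qed
qed

text \<open>The two copies of \<open>K\<close> restore the double cover and also pay for the cuts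
  that separate \<open>b\<close> from \<open>b'\<close>: both copies cross such a cut, and only the
  two members containing \<open>b'\<close> are rerouted, so at least two of the four old crossings
  survive. A cut with \<open>b\<close> and \<open>b'\<close> on one side is a cut of
  \<open>q - {b}\<close>.\<close>

lemma split_attachment:
  assumes K: "K \<subseteq> V" "bd K = {b', b}" "b' \<in> K" "b \<notin> K"
    and q: "b \<in> q" "b' \<in> q" "K \<inter> (q \<union> \<Union>QQ) = {b'}" "q \<inter> \<Union>QQ = {}" "q \<union> \<Union>QQ \<subseteq> V"
    and F: "fam (insert (q - {b}) QQ) F"
  shows "fam (insert q QQ) (image_mset (\<lambda>E. E - K) F + {#K, K#})"
proof -
  let ?F = "image_mset (\<lambda>E. E - K) F + {#K, K#}"
  have ne: "b \<noteq> b'" using K by auto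
  have pb: "pv b \<in> K" "pv b' \<notin> K" using K(2-4) in_bd[of b K] in_bd[of b' K] by auto
  have goodF: "good (insert (q - {b}) QQ) E" if "E \<in># F" for E using F that unfolding fam_def by auto
  have two: "cnt (\<lambda>E. v \<in> E) F = 2" if "v \<in> V" for v using F that unfolding fam_def by auto
  note g = split_attachment_good[OF K q goodF]
  have gK: "good (insert q QQ) K"
    using K q ne pb by (intro good_segment[of K b' b]) auto
  have bdE: "bd (E - K) = (if b' \<in> E then insert b (bd E - {b'}) else bd E)" "b \<notin> bd E"
     "b' \<in> E \<Longrightarrow> b' \<in> bd E" "b' \<in> E \<Longrightarrow> pv b' \<notin> E" if E: "E \<in># F" for E
  proof -
    have np: "b' \<in> E \<Longrightarrow> pv b' \<notin> E" and bE: "bd E \<subseteq> (q - {b}) \<union> \<Union>QQ"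
      using goodF[OF E] q ne unfolding good_def by auto
    show "b' \<in> E \<Longrightarrow> pv b' \<notin> E" by (rule np)
    show *: "b' \<in> E \<Longrightarrow> b' \<in> bd E" using np by (auto simp: in_bd)
    show bn: "b \<notin> bd E" using bE q by auto
    show "bd (E - K) = (if b' \<in> E then insert b (bd E - {b'}) else bd E)"
    proof (cases "b' \<in> E")
      case True
      then have "K \<subseteq> E" using g(2)[OF E] K by auto
      moreover have "(E - K) \<inter> K = {}" by auto
      ultimately have "bd E = (bd (E - K) - bd K) \<union> (bd K - bd (E - K))"
        using bd_Un[of "E - K" K] by (simp add: Un_absorb2)
      moreover have "b' \<notin> bd (E - K)" using np True K by (auto simp: in_bd)
      ultimately show ?thesis using K(2) ne bn True by auto
    next
      case False
      then have "E - K = E" using g(2)[OF E] K by auto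
      then show ?thesis using False by simp
    qed
  qed
  have goodEV: "E \<subseteq> V" if "E \<in># F" for E using goodF[OF that] unfolding good_def by auto
  have count: "cnt (\<lambda>E. v \<in> E) ?F = 2" if "v \<in> V" for v
    using two[OF that] by (cases "v \<in> K") (auto simp: cnt_image)
  have cutq: "4 \<le> cnt (\<lambda>E. odd (card (bd E \<inter> X))) ?F" if X: "X \<subseteq> q" "X \<noteq> q" "b \<in> X" for X
  proof (cases "b' \<in> X")
    case True
    have "odd (card (bd (E - K) \<inter> X)) \<longleftrightarrow> odd (card (bd E \<inter> (X - {b})))" if E: "E \<in># F" for E
    proof (cases "b' \<in> E")
      case b'E: True
      have "bd (E - K) \<inter> X = insert b ((bd E \<inter> (X - {b})) - {b'})"
        using bdE[OF E] b'E X by auto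
      moreover have "card \<dots> = card (bd E \<inter> (X - {b}))"
        using bdE(3)[OF E b'E] True ne finite_bd[OF goodEV[OF E]] by (intro card_swap) auto
      ultimately show ?thesis by simp
    next
      case False
      then have "bd (E - K) \<inter> X = bd E \<inter> (X - {b})" using bdE[OF E] by auto
      then show ?thesis by simp
    qed
    then have "cnt (\<lambda>E. odd (card (bd (E - K) \<inter> X))) F = cnt (\<lambda>E. odd (card (bd E \<inter> (X - {b})))) F"
      by (rule cnt_cong)
    moreover have "4 \<le> cnt (\<lambda>E. odd (card (bd E \<inter> (X - {b})))) F"
    proof -
      have "X - {b} \<subseteq> q - {b} \<and> X - {b} \<noteq> {} \<and> X - {b} \<noteq> q - {b}" using X True ne q by auto
      then show ?thesis using F unfolding fam_def by simp
    qed
    ultimately show ?thesis by (simp add: cnt_image)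
  next
    case False
    have "{b', b} \<inter> X = {b}" using X False by auto
    then have KK: "odd (card (bd K \<inter> X))" using K by simp
    have b'2: "cnt (\<lambda>E. b' \<in> E) F = 2" using two K by auto
    have "2 \<le> cnt (\<lambda>E. odd (card (bd (E - K) \<inter> X))) F"
    \<comment> \<open>For \<open>X = {b}\<close> there is no old cut to compare with, since
      \<open>X - {b}\<close> is empty; here the two rerouted members themselves end at
      \<open>b\<close>.\<close>
    proof (cases "X = {b}")
      case True
      have "bd (E - K) \<inter> {b} = (if b' \<in> E then {b} else {})" if "E \<in># F" for E
        using bdE[OF that] by auto
      then have "cnt (\<lambda>E. odd (card (bd (E - K) \<inter> X))) F = cnt (\<lambda>E. b' \<in> E) F"
        using True by (intro cnt_cong) auto
      then show ?thesis using b'2 by simp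
    next
      case X1: False
      have "odd (card (bd (E - K) \<inter> X)) \<or> b' \<in> E" if "E \<in># F" "odd (card (bd E \<inter> (X - {b})))" for E
      proof (cases "b' \<in> E")
        case False
        then have "bd (E - K) \<inter> X = bd E \<inter> (X - {b})" using bdE[OF that(1)] by auto
        then show ?thesis using that by simp
      qed simp
      then have "cnt (\<lambda>E. odd (card (bd E \<inter> (X - {b})))) F
          \<le> cnt (\<lambda>E. odd (card (bd (E - K) \<inter> X))) F + cnt (\<lambda>E. b' \<in> E) F"
        by (rule cnt_mono2)
      moreover have "X - {b} \<subseteq> q - {b} \<and> X - {b} \<noteq> {} \<and> X - {b} \<noteq> q - {b}"
        using X X1 False ne q by auto
      then have "4 \<le> cnt (\<lambda>E. odd (card (bd E \<inter> (X - {b})))) F" using F unfolding fam_def by simp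
      ultimately show ?thesis using b'2 by linarith
    qed
    then show ?thesis using KK by (simp add: cnt_image)
  qed
  have gF: "good (insert q QQ) E" if "E \<in># ?F" for E
    using that g(1) gK by auto
  have cut: "4 \<le> cnt (\<lambda>E. odd (card (bd E \<inter> X))) ?F"
    if p: "p \<in> insert q QQ" and X: "X \<subseteq> p" "X \<noteq> {}" "X \<noteq> p" for p X
  proof (cases "p = q")
    case True
    show ?thesis
    proof (cases "b \<in> X")
      case False
      \<comment> \<open>Every member has an even number of ends on \<open>q\<close>, so
        \<open>X\<close> and \<open>q - X\<close> define the same cut, and the side containing
        \<open>b\<close> may be chosen.\<close>
      have "odd (card (bd E \<inter> X)) \<longleftrightarrow> odd (card (bd E \<inter> (q - X)))" if "E \<in># ?F" for E
      proof -
        have "E \<subseteq> V" "card (bd E \<inter> q) \<in> {0, 2}" using gF[OF that] unfolding good_def by auto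
        then have "even (card (bd E \<inter> q))" "finite (bd E)" by (auto intro: finite_bd)
        moreover have "bd E \<inter> q = (bd E \<inter> X) \<union> (bd E \<inter> (q - X))" using X True by auto
        ultimately show ?thesis using even_card_disjoint_Un[of "bd E \<inter> X" "bd E \<inter> (q - X)"] by auto
      qed
      then have "cnt (\<lambda>E. odd (card (bd E \<inter> X))) ?F = cnt (\<lambda>E. odd (card (bd E \<inter> (q - X)))) ?F"
        by (rule cnt_cong)
      moreover have "4 \<le> cnt (\<lambda>E. odd (card (bd E \<inter> (q - X)))) ?F"
        using False X True q by (intro cutq) auto
      ultimately show ?thesis by linarith
    qed (use cutq X True in auto)
  next
    case False
    then have pQ: "p \<in> QQ" using p by auto
    have "b \<notin> X" "b' \<notin> X" using X pQ q by blast+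
    then have "bd (E - K) \<inter> X = bd E \<inter> X" if "E \<in># F" for E
      using bdE[OF that] by auto
    then have "cnt (\<lambda>E. odd (card (bd (E - K) \<inter> X))) F = cnt (\<lambda>E. odd (card (bd E \<inter> X))) F"
      by (intro cnt_cong) auto
    moreover have "4 \<le> cnt (\<lambda>E. odd (card (bd E \<inter> X))) F"
      using F X pQ unfolding fam_def by auto
    ultimately show ?thesis by (simp add: cnt_image)
  qed
  show ?thesis using gF count cut unfolding fam_def by blast
qed

end

section \<open>Adding a set that crosses exactly one other set\<close>

text \<open>\<open>sep\<close> is the leaf condition: no set other than \<open>s\<close> is split by
  a region with ends in \<open>B\<close>. \<open>meets\<close> is what holds once the gaps of
  \<open>B\<close> without a vertex of \<open>s\<close> have been merged away.\<close>

locale crossing_leaf = cyclic +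
  fixes QQ :: "'a set set" and s B :: "'a set"
  assumes QQ_V: "\<Union>QQ \<subseteq> V" and B_V: "B \<subseteq> V" and s_in: "s \<in> QQ"
    and QQ_disj: "pairwise disjnt QQ" and B_disj: "B \<inter> \<Union>QQ = {}"
    and sep: "\<lbrakk>q \<in> QQ; q \<noteq> s; S \<subseteq> V; bd S \<subseteq> B\<rbrakk> \<Longrightarrow> q \<subseteq> S \<or> q \<inter> S = {}"
    and meets: "b \<in> B \<Longrightarrow> s \<inter> gap B b \<noteq> {}"
    and B_two: "\<exists>b\<in>B. \<exists>c\<in>B. b \<noteq> c"
begin

abbreviation g where "g \<equiv> gap B"
abbreviation n where "n \<equiv> nxt B"

lemma ex_other: "b \<in> B \<Longrightarrow> \<exists>c\<in>B. c \<noteq> b"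
  using B_two by metis

lemma g_V: "b \<in> B \<Longrightarrow> g b \<subseteq> V"
  using gap_subset B_V by blast

lemma n_in: "b \<in> B \<Longrightarrow> n b \<in> B" and n_g: "b \<in> B \<Longrightarrow> pv (n b) \<in> g b"
  using nxt B_V by auto

lemma n_neq: "b \<in> B \<Longrightarrow> n b \<noteq> b"
  using ex_other nxt_neq[OF B_V] by blast

lemma bd_g: "b \<in> B \<Longrightarrow> bd (g b) = {b, n b}"
  using ex_other bd_gap[OF B_V] by blast

lemma g_mem:
  assumes "b \<in> B" shows "b \<in> g b" "pv b \<notin> g b" "n b \<notin> g b" "pv (n b) \<in> g b"
    "v \<notin> B \<Longrightarrow> v \<in> g b \<longleftrightarrow> pv v \<in> g b"
proof -
  show 1: "b \<in> g b" by (rule gap.start)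
  show 2: "pv (n b) \<in> g b" using n_g assms by simp
  show "pv b \<notin> g b" "n b \<notin> g b" using bd_g[OF assms] 1 2 in_bd[of b "g b"] in_bd[of "n b" "g b"] by auto
  show "v \<in> g b \<longleftrightarrow> pv v \<in> g b" if "v \<notin> B"
  proof -
    have "v \<notin> bd (g b)" using that bd_g[OF assms] assms n_in by auto
    then show ?thesis by (simp add: in_bd)
  qed
qed

lemma B_g: "b \<in> B \<Longrightarrow> c \<in> B \<Longrightarrow> c \<in> g b \<longleftrightarrow> c = b"
  using gap_Int[of b B] gap.start by auto

lemma pv_g: "b \<in> B \<Longrightarrow> c \<in> B \<Longrightarrow> pv c \<in> g b \<longleftrightarrow> c = n b"
  using nxt_unique[OF B_V] n_g by metis

lemma g_disj: "b \<in> B \<Longrightarrow> c \<in> B \<Longrightarrow> b \<noteq> c \<Longrightarrow> g b \<inter> g c = {}"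
  using gap_disjoint by blast

lemma g_cover: "v \<in> V \<Longrightarrow> \<exists>b\<in>B. v \<in> g b"
  using gap_cover[OF B_V] B_two by blast

text \<open>Cutting out a gap keeps the boundary inside it and makes each end of the gap a boundary
  vertex exactly when the gap edge next to it belongs to \<open>W\<close>. No other vertex of
  \<open>B\<close> touches the gap.\<close>

lemma bd_Int_g:
  assumes "b \<in> B"
  shows "v \<in> bd (W \<inter> g b) \<longleftrightarrow>
    v = b \<and> b \<in> W \<or> v = n b \<and> pv (n b) \<in> W \<or> v \<notin> B \<and> v \<in> g b \<and> v \<in> bd W"
proof (cases "v \<in> B")
  case True
  then show ?thesis
    using g_mem[OF assms] B_g[OF assms True] pv_g[OF assms True] n_neq[OF assms] by (auto simp: in_bd)
next
  case False
  then show ?thesis using g_mem(5)[OF assms False] assms n_in[OF assms] by (auto simp: in_bd)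
qed

lemma finite_QQ: "finite QQ"
proof -
  have "QQ \<subseteq> Pow V" using QQ_V by auto
  then show ?thesis using finV finite_subset by blast
qed

text \<open>\<open>A\<close> is divided among \<open>B\<close>, \<open>s\<close> and the other sets;
  the total and the other parts are even. For \<open>A = bd Z\<close> the total is even by
  \<open>even_bd\<close>, so the parity on \<open>s\<close> is a consequence of the remaining
  parities.\<close>

lemma parity_sum:
  assumes A: "A \<subseteq> \<Union>QQ \<union> B" "even (card A)"
    and ev: "\<And>q. q \<in> QQ \<Longrightarrow> q \<noteq> s \<Longrightarrow> even (card (A \<inter> q))"
  shows "even (card (A \<inter> B)) \<longleftrightarrow> even (card (A \<inter> s))"
proof -
  have fin: "finite A" using A QQ_V B_V finV finite_subset by (metis Un_least)
  let ?U = "\<Union>((\<lambda>q. A \<inter> q) ` (QQ - {s}))"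
  have "even (card ?U)"
  proof (rule even_card_Union)
    show "finite ((\<lambda>q. A \<inter> q) ` (QQ - {s}))" using finite_QQ by auto
    show "pairwise disjnt ((\<lambda>q. A \<inter> q) ` (QQ - {s}))"
      using QQ_disj by (auto simp: pairwise_def disjnt_def)
  qed (use fin ev in auto)
  moreover have "A = (A \<inter> B) \<union> ((A \<inter> s) \<union> ?U)" using A s_in by auto
  moreover have "(A \<inter> s) \<inter> ?U = {}" using QQ_disj s_in by (auto simp: pairwise_def disjnt_def)
  moreover have "(A \<inter> B) \<inter> ((A \<inter> s) \<union> ?U) = {}" using B_disj s_in by auto
  moreover have "finite ?U" using fin finite_QQ by auto
  ultimately show ?thesis
    using even_card_disjoint_Un[of "A \<inter> B" "(A \<inter> s) \<union> ?U"] even_card_disjoint_Un[of "A \<inter> s" ?U] fin A(2)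
    by auto
qed

text \<open>A region is cut off at vertices of \<open>B\<close>, where \<open>E\<close> has no
  boundary. So the two boundaries do not interfere, and \<open>E\<close> either runs through a
  vertex of \<open>B\<close> or avoids it.\<close>

lemma bd_Int_region:
  assumes "bd E \<subseteq> \<Union>QQ" "bd S \<subseteq> B"
  shows "bd (E \<inter> S) = (bd S \<inter> E) \<union> (bd E \<inter> S)" "v \<in> B \<Longrightarrow> v \<in> E \<longleftrightarrow> pv v \<in> E"
proof -
  have "v \<notin> bd E \<or> v \<notin> bd S" for v using assms B_disj by blast
  then show "bd (E \<inter> S) = (bd S \<inter> E) \<union> (bd E \<inter> S)" unfolding set_eq_iff Int_iff Un_iff in_bd by blast
  show "v \<in> B \<Longrightarrow> v \<in> E \<longleftrightarrow> pv v \<in> E" using assms B_disj in_bd[of v E] by blast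
qed

text \<open>A half of an irreducible set, cut off by a region with exactly one end in \<open>E\<close>, is itself
  irreducible: complete \<open>Z\<close> by the other half if \<open>Z\<close> reaches that end.  The parity
  condition on \<open>s\<close> comes for free from the handshake lemma.\<close>

lemma half_irr:
  assumes E: "E \<subseteq> V" "irr QQ E" "bd E \<subseteq> \<Union>QQ" "\<And>q. q \<in> QQ \<Longrightarrow> even (card (bd E \<inter> q))"
    and R: "R \<subseteq> V" "bd R = {p, r}" "p \<in> B" "r \<in> B" "p \<in> E" "r \<notin> E"
    and Z: "Z \<subseteq> E \<inter> R" "bd Z \<subseteq> insert p (bd E \<inter> R)"
    and ev: "\<And>q. q \<in> QQ \<Longrightarrow> q \<noteq> s \<Longrightarrow> even (card (bd Z \<inter> q))"
  shows "Z = (if p \<in> bd Z then E \<inter> R else {})"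
proof -
  have bdR: "bd R \<subseteq> B" using R by auto
  have ZV: "Z \<subseteq> V" using Z E by auto
  have pE: "p \<in> E" "pv p \<in> E" "p \<notin> bd E" using bd_Int_region(2)[OF E(3) bdR, of p] R by (auto simp: in_bd)
  have pR: "(p \<in> R) \<noteq> (pv p \<in> R)" using R in_bd[of p R] by auto
  show ?thesis
  proof (cases "p \<in> bd Z")
    case False
    then have bdZ: "bd Z \<subseteq> bd E" using Z by auto
    then have "bd Z \<inter> B = {}" using E B_disj by blast
    then have "even (card (bd Z \<inter> s))"
      using parity_sum[OF subset_trans[OF bdZ le_supI1[OF E(3)]] even_bd[OF ZV] ev] by simp
    then have "even (card (bd Z \<inter> q))" if "q \<in> QQ" for q
      using ev that by (cases "q = s") auto
    then have "closed QQ E Z" unfolding closed_def using Z bdZ by auto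
    then have "Z = {} \<or> Z = E" using E(2) unfolding irr_def by auto
    then show ?thesis using False Z pE pR by auto
  next
    case True
    let ?Y = "E - R"
    have "bd (V - R) \<subseteq> B" using bdR bd_Compl[OF R(1)] by simp
    from bd_Int_region(1)[OF E(3) this] have "bd (E \<inter> (V - R)) = (bd R \<inter> E) \<union> (bd E \<inter> (V - R))"
      using bd_Compl[OF R(1)] by simp
    moreover have "E \<inter> (V - R) = ?Y" "bd E \<inter> (V - R) = bd E - R" using E bd_subset[OF E(1)] by auto
    moreover have "bd R \<inter> E = {p}" using R by auto
    ultimately have bdY: "bd ?Y = insert p (bd E - R)" by simp
    have "Z \<inter> ?Y = {}" using Z by auto
    from bd_Un[OF this] have bdU: "bd (Z \<union> ?Y) = (bd Z - {p}) \<union> (bd E - R)"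
      using bdY True Z pE by auto
    have UV: "Z \<union> ?Y \<subseteq> V" "Z \<union> ?Y \<subseteq> E" using Z E by auto
    have bdE: "bd (Z \<union> ?Y) \<subseteq> bd E" using bdU Z by auto
    \<comment> \<open>By \<open>sep\<close> the set \<open>q\<close> lies on one side of
      \<open>R\<close>, so its parity is inherited from \<open>Z\<close> alone or from
      \<open>E\<close> alone.\<close>
    have evU: "even (card (bd (Z \<union> ?Y) \<inter> q))" if q: "q \<in> QQ" "q \<noteq> s" for q
    proof -
      have "p \<notin> q" using R B_disj q by auto
      consider "q \<subseteq> R" | "q \<inter> R = {}" using sep[OF q R(1) bdR] by auto
      then show ?thesis
      proof cases
        case 1
        then have "bd (Z \<union> ?Y) \<inter> q = bd Z \<inter> q" using bdU \<open>p \<notin> q\<close> by auto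
        then show ?thesis using ev q by simp
      next
        case 2
        then have "bd (Z \<union> ?Y) \<inter> q = bd E \<inter> q" using bdU Z \<open>p \<notin> q\<close> by auto
        then show ?thesis using E(4) q by simp
      qed
    qed
    have "bd (Z \<union> ?Y) \<inter> B = {}" using bdE E B_disj by blast
    then have "even (card (bd (Z \<union> ?Y) \<inter> s))"
      using parity_sum[OF subset_trans[OF bdE le_supI1[OF E(3)]] even_bd[OF UV(1)] evU] by simp
    then have "even (card (bd (Z \<union> ?Y) \<inter> q))" if "q \<in> QQ" for q
      using evU that by (cases "q = s") auto
    then have "closed QQ E (Z \<union> ?Y)" unfolding closed_def using UV bdE by auto
    then have "Z \<union> ?Y = {} \<or> Z \<union> ?Y = E" using E(2) unfolding irr_def by auto
    then show ?thesis using True Z pE by auto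
  qed
qed

lemma goodD:
  assumes "good QQ E"
  shows "E \<subseteq> V" "bd E \<subseteq> \<Union>QQ" "irr QQ E" "\<And>q. q \<in> QQ \<Longrightarrow> even (card (bd E \<inter> q))"
    "V - E \<subseteq> V" "bd (V - E) \<subseteq> \<Union>QQ" "irr QQ (V - E)" "\<And>q. q \<in> QQ \<Longrightarrow> even (card (bd (V - E) \<inter> q))"
    "b \<in> B \<Longrightarrow> b \<in> E \<longleftrightarrow> pv b \<in> E"
proof -
  show 1: "E \<subseteq> V" "bd E \<subseteq> \<Union>QQ" "irr QQ E" "irr QQ (V - E)" "V - E \<subseteq> V"
    using assms unfolding good_def by auto
  show "even (card (bd E \<inter> q))" if "q \<in> QQ" for q
    using assms that unfolding good_def by fastforce
  then show "\<And>q. q \<in> QQ \<Longrightarrow> even (card (bd (V - E) \<inter> q))" "bd (V - E) \<subseteq> \<Union>QQ"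
    using 1 bd_Compl by auto
  show "b \<in> B \<Longrightarrow> b \<in> E \<longleftrightarrow> pv b \<in> E" using bd_Int_region(2)[OF 1(2), of "{}"] by auto
qed

text \<open>A member leaves the region either at an end of the region or through the tree of
  \<open>s\<close>; the other sets lie on one side and contribute evenly.\<close>

lemma odd_region:
  assumes E: "E \<subseteq> V" "bd E \<subseteq> \<Union>QQ" "\<And>q. q \<in> QQ \<Longrightarrow> even (card (bd E \<inter> q))"
    and S: "S \<subseteq> V" "bd S \<subseteq> B"
  shows "even (card (bd E \<inter> S \<inter> s)) \<longleftrightarrow> even (card (bd S \<inter> E))"
    and "q \<in> QQ \<Longrightarrow> q \<noteq> s \<Longrightarrow> even (card (bd E \<inter> S \<inter> q))"
proof -
  note b = bd_Int_region(1)[OF E(2) S(2)]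
  have ev: "even (card (bd E \<inter> S \<inter> q))" if q: "q \<in> QQ" "q \<noteq> s" for q
  proof -
    have "bd E \<inter> S \<inter> q = bd E \<inter> q \<or> bd E \<inter> S \<inter> q = {}" using sep[OF q S] by auto
    then show ?thesis using E(3)[OF q(1)] by auto
  qed
  then show "q \<in> QQ \<Longrightarrow> q \<noteq> s \<Longrightarrow> even (card (bd E \<inter> S \<inter> q))" .
  have q: "bd (E \<inter> S) \<inter> q = bd E \<inter> S \<inter> q" if "q \<in> QQ" for q
    using b S that B_disj by blast
  have "bd (E \<inter> S) \<inter> B = bd S \<inter> E" using b S E B_disj by blast
  moreover have "even (card (bd (E \<inter> S) \<inter> B)) \<longleftrightarrow> even (card (bd (E \<inter> S) \<inter> s))"
  proof (rule parity_sum)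
    show "bd (E \<inter> S) \<subseteq> \<Union>QQ \<union> B" using b E S by auto
    show "even (card (bd (E \<inter> S)))" using E by (intro even_bd) auto
  qed (use ev q in auto)
  ultimately show "even (card (bd E \<inter> S \<inter> s)) \<longleftrightarrow> even (card (bd S \<inter> E))" using q s_in by simp
qed

text \<open>When \<open>E\<close> avoids the ends of \<open>S\<close>, the part
  \<open>E \<inter> S\<close> has no new boundary vertices and even parity on every set, hence is
  closed.\<close>

lemma region_free:
  assumes E: "E \<subseteq> V" "bd E \<subseteq> \<Union>QQ" "irr QQ E" "\<And>q. q \<in> QQ \<Longrightarrow> even (card (bd E \<inter> q))"
    and S: "S \<subseteq> V" "bd S \<subseteq> B" "bd S \<inter> E = {}"
  shows "E \<inter> S = {} \<or> E \<subseteq> S"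
proof -
  have b: "bd (E \<inter> S) = bd E \<inter> S" using bd_Int_region(1)[OF E(2) S(2)] S by auto
  have "even (card (bd E \<inter> S \<inter> q))" if "q \<in> QQ" for q
    using odd_region[OF E(1,2,4) S(1,2)] S(3) that by (cases "q = s") auto
  then have "closed QQ E (E \<inter> S)" unfolding closed_def using b by auto
  then show ?thesis using E(3) unfolding irr_def by auto
qed

text \<open>At the vertex of \<open>s\<close> found here a good set contains at most one of the two
  edges, so its complement has an edge in the region.\<close>

lemma meets_region:
  assumes "S \<subseteq> V" "bd S \<subseteq> B" "b \<in> B" "b \<in> S" shows "\<exists>v\<in>s. v \<in> S \<and> pv v \<in> S"
proof -
  have "g b \<subseteq> S" using gap_region[OF assms(2), of b] g_mem(1)[OF assms(3)] assms(4) by blast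
  moreover obtain v where "v \<in> s" "v \<in> g b" using meets[OF assms(3)] by auto
  moreover have "pv v \<in> g b" using g_mem(5)[OF assms(3)] B_disj s_in calculation by blast
  ultimately show ?thesis by auto
qed

text \<open>If \<open>E\<close> ran through \<open>b\<close> and \<open>c\<close>, its complement
  would avoid both, and by \<open>region_free\<close> it would lie in one of the two arcs between
  them. But each arc contains a vertex of \<open>s\<close> together with both its edges, one of
  which \<open>E\<close> misses.\<close>

lemma good_one:
  assumes E: "good QQ E" and "b \<in> B" "c \<in> B" "b \<in> E" "c \<in> E" shows "b = c"
proof (rule ccontr)
  assume ne: "b \<noteq> c"
  let ?S = "gap {b, c} b"
  have bV: "b \<in> V" "{b, c} \<subseteq> V" using assms B_V by auto
  have S: "?S \<subseteq> V" using gap_subset bV by blast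
  have nb: "nxt {b, c} b = c"
    using nxt(1)[OF bV(2), of b] nxt_neq[OF bV(2), of b c] ne by auto
  then have bS: "bd ?S = {b, c}" using bd_gap[OF bV(2), of b c] ne by auto
  have bC: "bd (V - ?S) = {b, c}" using bd_Compl[OF S] bS by simp
  have mem: "b \<in> ?S" "c \<in> V - ?S"
    using gap.start[of b "{b, c}"] gap_Int[of b "{b, c}"] ne bV by auto
  have free: "(V - E) \<inter> S = {} \<or> V - E \<subseteq> S" if "S \<subseteq> V" "bd S = {b, c}" for S
    using goodD[OF E] that assms by (intro region_free) auto
  have ne: "(V - E) \<inter> S \<noteq> {}" if S: "S \<subseteq> V" "bd S = {b, c}" and m: "d \<in> {b, c}" "d \<in> S" for S d
  proof -
    obtain v where v: "v \<in> s" "v \<in> S" "pv v \<in> S"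
      using meets_region[of S d] S m assms by auto
    then have "v \<notin> E \<or> pv v \<notin> E" using E s_in unfolding good_def by auto
    then show ?thesis using v S by auto
  qed
  have "(V - E) \<inter> ?S \<noteq> {}" "(V - E) \<inter> (V - ?S) \<noteq> {}"
    using ne[OF S bS _ mem(1)] ne[OF _ bC _ mem(2)] by auto
  then show False using free[OF S bS] by auto
qed

end

section \<open>Gluing halves of two members in consecutive gaps\<close>

context crossing_leaf
begin

text \<open>\<open>r\<close> and \<open>r'\<close> are the ends of the two gaps opposite to
  \<open>p\<close> and \<open>p'\<close>. The alternatives in \<open>ends\<close> put
  \<open>p\<close> and \<open>p'\<close> both at the far ends or both at the near ends of their
  gaps; with mixed ends both halves could arrive at \<open>c\<close>, and the glued set would run
  through it. If \<open>B\<close> has two elements, then \<open>d = b\<close>.\<close>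

context
  fixes b c d p r p' r' E E' E1
  assumes b: "b \<in> B" and c: "c = n b" and d: "d = n c"
    and E: "good QQ E" and E': "good QQ E'"
    and ends: "p = c \<and> r = b \<and> p' = d \<and> r' = c \<or> p = b \<and> r = c \<and> p' = c \<and> r' = d"
    and p: "p \<in> E" and p': "p' \<in> E'"
    and E1: "E1 = (E \<inter> g b) \<union> (E' \<inter> g c)"
begin

lemma glue_B: "c \<in> B" "d \<in> B" "b \<noteq> c" "c \<noteq> d" "p \<in> B" "p' \<in> B" "r \<in> B" "r' \<in> B" "p \<noteq> p'"
  "r \<notin> E" "r' \<notin> E'" "bd (g b) = {p, r}" "bd (g c) = {p', r'}" "g b \<inter> g c = {}" "g b \<subseteq> V" "g c \<subseteq> V"
proof -
  show B: "c \<in> B" "d \<in> B" "b \<noteq> c" "c \<noteq> d" using b c d n_in n_neq by metis+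
  then show B': "p \<in> B" "p' \<in> B" "r \<in> B" "r' \<in> B" "p \<noteq> p'" using ends b by auto
  have "p \<noteq> r" "p' \<noteq> r'" using ends B by auto
  then show "r \<notin> E" "r' \<notin> E'" using good_one[OF E] good_one[OF E'] p p' B' by metis+
  show "bd (g b) = {p, r}" "bd (g c) = {p', r'}" using bd_g b B c d ends by auto
  show "g b \<inter> g c = {}" using g_disj b B by simp
  show "g b \<subseteq> V" "g c \<subseteq> V" using g_V b B by auto
qed

lemma glue_mem:
  assumes "v \<in> B"
  shows "v \<in> E1 \<longleftrightarrow> v = p \<and> p = b \<or> v = p' \<and> p' = c"
    and "pv v \<in> E1 \<longleftrightarrow> v = p \<and> p = c \<or> v = p' \<and> p' = d"
proof -
  have "v \<in> E1 \<longleftrightarrow> v = b \<and> b \<in> E \<or> v = c \<and> c \<in> E'"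
    using B_g[of b v] B_g[of c v] b glue_B(1) assms E1 by auto
  then show "v \<in> E1 \<longleftrightarrow> v = p \<and> p = b \<or> v = p' \<and> p' = c"
    using ends p p' glue_B by metis
  have "pv v \<in> E1 \<longleftrightarrow> v = c \<and> c \<in> E \<or> v = d \<and> d \<in> E'"
    using pv_g[of b v] pv_g[of c v] b glue_B(1) assms E1 goodD(9)[OF E assms] goodD(9)[OF E' assms] c d by auto
  then show "pv v \<in> E1 \<longleftrightarrow> v = p \<and> p = c \<or> v = p' \<and> p' = d"
    using ends p p' glue_B by metis
qed

lemma bd_glue_B: "bd E1 \<inter> B = {p, p'}"
  using glue_mem glue_B ends by (auto simp: in_bd)

lemma bd_glue_off:
  assumes "v \<notin> B" shows "v \<in> bd E1 \<longleftrightarrow> v \<in> g b \<and> v \<in> bd E \<or> v \<in> g c \<and> v \<in> bd E'"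
  using g_mem(5)[OF b assms] g_mem(5)[OF glue_B(1) assms] glue_B(14) E1 by (auto simp: in_bd)

lemma bd_glue: "bd E1 = insert p (insert p' ((bd E \<inter> g b) \<union> (bd E' \<inter> g c)))"
proof -
  have "bd E \<inter> B = {}" "bd E' \<inter> B = {}" using goodD(2)[OF E] goodD(2)[OF E'] B_disj by auto
  then show ?thesis using bd_glue_B bd_glue_off by blast
qed

text \<open>Exactly one end of the gap lies in the member, so the number is odd by
  \<open>odd_region\<close>, and a good set has at most two ends on \<open>s\<close>. The vertex
  counted is where the half leaves its gap through the tree of \<open>s\<close>.\<close>

lemma glue_odd_s: "card (bd E \<inter> g b \<inter> s) = 1" "card (bd E' \<inter> g c \<inter> s) = 1"
proof -
  have fin: "finite (bd E)" "finite (bd E')" using goodD(1)[OF E] goodD(1)[OF E'] finite_bd by auto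
  have "bd (g b) \<inter> E = {p}" "bd (g c) \<inter> E' = {p'}" using glue_B p p' by auto
  then have "odd (card (bd E \<inter> g b \<inter> s))" "odd (card (bd E' \<inter> g c \<inter> s))"
    using odd_region(1)[OF goodD(1,2,4)[OF E], of "g b"] odd_region(1)[OF goodD(1,2,4)[OF E'], of "g c"] glue_B
    by auto
  moreover have "card (bd E \<inter> g b \<inter> s) \<le> card (bd E \<inter> s)" "card (bd E' \<inter> g c \<inter> s) \<le> card (bd E' \<inter> s)"
    using fin by (auto intro!: card_mono)
  moreover have "card (bd E \<inter> s) \<le> 2" "card (bd E' \<inter> s) \<le> 2" using E E' s_in unfolding good_def by auto
  moreover have "m = 1" if "odd m" "m \<le> k" "k \<le> 2" for m k :: nat
  proof -
    have "m = 0 \<or> m = 1 \<or> m = 2" using that by linarith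
    then show ?thesis using that by auto
  qed
  ultimately show "card (bd E \<inter> g b \<inter> s) = 1" "card (bd E' \<inter> g c \<inter> s) = 1" by blast+
qed

text \<open>Four instances of \<open>half_irr\<close>. For the complements \<open>r\<close> and
  \<open>r'\<close> take over the role of \<open>p\<close> and \<open>p'\<close>, since the
  complement runs through exactly the other end of the gap.\<close>

lemma glue_halves:
  assumes Z: "bd Z \<subseteq> bd E1" "\<And>q. q \<in> QQ \<Longrightarrow> even (card (bd Z \<inter> q))"
  shows "Z \<subseteq> E1 \<Longrightarrow> Z \<inter> g b = (if p \<in> bd (Z \<inter> g b) then E \<inter> g b else {})"
    and "Z \<subseteq> E1 \<Longrightarrow> Z \<inter> g c = (if p' \<in> bd (Z \<inter> g c) then E' \<inter> g c else {})"
    and "Z \<subseteq> V - E1 \<Longrightarrow> Z \<inter> g b = (if r \<in> bd (Z \<inter> g b) then (V - E) \<inter> g b else {})"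
    and "Z \<subseteq> V - E1 \<Longrightarrow> Z \<inter> g c = (if r' \<in> bd (Z \<inter> g c) then (V - E') \<inter> g c else {})"
proof -
  have bV: "bd (g b) \<subseteq> B" "bd (g c) \<subseteq> B" using glue_B by auto
  have ev: "even (card (bd (Z \<inter> g x) \<inter> q))" if q: "q \<in> QQ" "q \<noteq> s" and x: "x \<in> B" for q x
  proof -
    have "q \<inter> B = {}" using q B_disj by auto
    then have "v \<in> q \<Longrightarrow> v \<in> bd (Z \<inter> g x) \<longleftrightarrow> v \<in> bd Z \<inter> g x" for v
      using bd_Int_g[OF x, of v Z] n_in[OF x] x by auto
    then have e: "bd (Z \<inter> g x) \<inter> q = bd Z \<inter> q \<inter> g x" by auto
    have "bd (g x) \<subseteq> B" using bd_g x n_in by auto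
    then have "q \<subseteq> g x \<or> q \<inter> g x = {}" using sep[OF q g_V[OF x]] by auto
    then have "bd Z \<inter> q \<inter> g x = bd Z \<inter> q \<or> bd Z \<inter> q \<inter> g x = {}" by auto
    then show ?thesis using e Z(2)[OF q(1)] by auto
  qed
  have offb: "v \<in> bd (Z \<inter> g b) \<Longrightarrow> v \<in> {p, r} \<or> v \<notin> B \<and> v \<in> bd E \<inter> g b" for v
    using bd_Int_g[OF b, of v Z] Z(1) bd_glue_off[of v] glue_B(14) ends c by auto
  have offc: "v \<in> bd (Z \<inter> g c) \<Longrightarrow> v \<in> {p', r'} \<or> v \<notin> B \<and> v \<in> bd E' \<inter> g c" for v
    using bd_Int_g[OF glue_B(1), of v Z] Z(1) bd_glue_off[of v] glue_B(14) ends d by auto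
  have pvb: "x \<in> E \<longleftrightarrow> pv x \<in> E" "x \<in> E' \<longleftrightarrow> pv x \<in> E'" if "x \<in> B" for x
    using goodD(9)[OF E that] goodD(9)[OF E' that] .
  have notb: "x \<notin> bd W" if "x \<notin> W" "pv x \<notin> W" for x W using that by (simp add: in_bd)
  show "Z \<inter> g b = (if p \<in> bd (Z \<inter> g b) then E \<inter> g b else {})" if ZE: "Z \<subseteq> E1"
  proof (rule half_irr[OF goodD(1,3,2,4)[OF E] glue_B(15,12,5,7) p glue_B(10)])
    show "Z \<inter> g b \<subseteq> E \<inter> g b" using ZE E1 glue_B(14) by blast
    then have "r \<notin> bd (Z \<inter> g b)" using glue_B(7,10) pvb[of r] by (intro notb) auto
    then show "bd (Z \<inter> g b) \<subseteq> insert p (bd E \<inter> g b)" using offb by blast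
  qed (use ev b in auto)
  show "Z \<inter> g c = (if p' \<in> bd (Z \<inter> g c) then E' \<inter> g c else {})" if ZE: "Z \<subseteq> E1"
  proof (rule half_irr[OF goodD(1,3,2,4)[OF E'] glue_B(16,13,6,8) p' glue_B(11)])
    show "Z \<inter> g c \<subseteq> E' \<inter> g c" using ZE E1 glue_B(14) by blast
    then have "r' \<notin> bd (Z \<inter> g c)" using glue_B(8,11) pvb[of r'] by (intro notb) auto
    then show "bd (Z \<inter> g c) \<subseteq> insert p' (bd E' \<inter> g c)" using offc by blast
  qed (use ev glue_B in auto)
  have V: "r \<in> V - E" "r' \<in> V - E'" "p \<notin> V - E" "p' \<notin> V - E'" using glue_B B_V p p' by auto
  have comm: "bd (g b) = {r, p}" "bd (g c) = {r', p'}" using glue_B by auto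
  show "Z \<inter> g b = (if r \<in> bd (Z \<inter> g b) then (V - E) \<inter> g b else {})" if ZE: "Z \<subseteq> V - E1"
  proof (rule half_irr[OF goodD(5,7,6,8)[OF E] glue_B(15) comm(1) glue_B(7,5) V(1,3)])
    show "Z \<inter> g b \<subseteq> (V - E) \<inter> g b" using ZE E1 glue_B(14) by blast
    then have "p \<notin> bd (Z \<inter> g b)" using p glue_B(5) pvb[of p] by (intro notb) auto
    then show "bd (Z \<inter> g b) \<subseteq> insert r (bd (V - E) \<inter> g b)"
      using offb bd_Compl[OF goodD(1)[OF E]] by blast
  qed (use ev b in auto)
  show "Z \<inter> g c = (if r' \<in> bd (Z \<inter> g c) then (V - E') \<inter> g c else {})" if ZE: "Z \<subseteq> V - E1"
  proof (rule half_irr[OF goodD(5,7,6,8)[OF E'] glue_B(16) comm(2) glue_B(8,6) V(2,4)])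
    show "Z \<inter> g c \<subseteq> (V - E') \<inter> g c" using ZE E1 glue_B(14) by blast
    then have "p' \<notin> bd (Z \<inter> g c)" using p' glue_B(6) pvb[of p'] by (intro notb) auto
    then show "bd (Z \<inter> g c) \<subseteq> insert r' (bd (V - E') \<inter> g c)"
      using offc bd_Compl[OF goodD(1)[OF E']] by blast
  qed (use ev glue_B in auto)
qed

lemma glue_end:
  "p \<in> bd (Z \<inter> g b) \<longleftrightarrow> (if p = b then b \<in> Z else pv c \<in> Z)"
  "p' \<in> bd (Z \<inter> g c) \<longleftrightarrow> (if p = b then c \<in> Z else pv d \<in> Z)"
  "r \<in> bd (Z \<inter> g b) \<longleftrightarrow> (if p = b then pv c \<in> Z else b \<in> Z)"
  "r' \<in> bd (Z \<inter> g c) \<longleftrightarrow> (if p = b then pv d \<in> Z else c \<in> Z)"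
  using bd_Int_g[OF b, of _ Z] bd_Int_g[OF glue_B(1), of _ Z] ends glue_B(1-4) b c d by auto

text \<open>The parity on the new set \<open>B\<close> enters here: \<open>p\<close> and
  \<open>p'\<close> are joined by the new tree path, which \<open>Z\<close> uses entirely or not at
  all.\<close>

lemma glue_ends_parity:
  assumes "Z \<subseteq> V" "bd Z \<subseteq> bd E1" "even (card (bd Z \<inter> B))"
  shows "p \<in> bd Z \<longleftrightarrow> p' \<in> bd Z"
proof -
  have "bd Z \<inter> B \<subseteq> {p, p'}" "p \<in> B" "p' \<in> B" using assms(2) bd_glue_B glue_B(5,6) by auto
  then have "p \<in> bd Z \<and> p' \<notin> bd Z \<Longrightarrow> bd Z \<inter> B = {p}" "p' \<in> bd Z \<and> p \<notin> bd Z \<Longrightarrow> bd Z \<inter> B = {p'}"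
    by auto
  then show ?thesis using assms(3) by (metis card_1_singleton_iff One_nat_def odd_one)
qed

text \<open>Each half is taken entirely or not at all, and the path in the tree of \<open>B\<close>
  couples the two choices.\<close>

lemma glue_irr: "irr (insert B QQ) E1"
  unfolding irr_def
proof (intro allI impI)
  fix Z assume "closed (insert B QQ) E1 Z"
  then have Z: "Z \<subseteq> E1" "bd Z \<subseteq> bd E1" "\<And>q. q \<in> QQ \<Longrightarrow> even (card (bd Z \<inter> q))" "even (card (bd Z \<inter> B))"
    unfolding closed_def by auto
  have ZV: "Z \<subseteq> V" using Z E1 glue_B by auto
  note h = glue_halves(1,2)[OF Z(2,3) Z(1)]
  have "p \<in> bd Z \<longleftrightarrow> p' \<in> bd Z" using glue_ends_parity[OF ZV Z(2,4)] .
  moreover have "p \<in> bd Z \<longleftrightarrow> p \<in> bd (Z \<inter> g b)" "p' \<in> bd Z \<longleftrightarrow> p' \<in> bd (Z \<inter> g c)"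
    using glue_mem[OF glue_B(5)] glue_mem[OF glue_B(6)] Z(1) ends glue_B(1-4)
    unfolding glue_end by (auto simp: in_bd)
  moreover have "Z = (Z \<inter> g b) \<union> (Z \<inter> g c)" using Z(1) E1 by auto
  ultimately show "Z = {} \<or> Z = E1" using h E1 by (cases "p \<in> bd Z") auto
qed

text \<open>The complement has three pieces: the complementary halves in the two gaps and the
  remaining segment \<open>W\<close>. Each is taken entirely or not at all; the path between
  \<open>p\<close> and \<open>p'\<close>, and the end of \<open>W\<close> that is not a boundary
  vertex of \<open>E1\<close>, force equal choices.\<close>

lemma glue_irr_compl: "irr (insert B QQ) (V - E1)"
  unfolding irr_def
proof (intro allI impI)
  fix Z assume "closed (insert B QQ) (V - E1) Z"
  moreover have "E1 \<subseteq> V" using E1 glue_B by auto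
  ultimately have Z: "Z \<subseteq> V - E1" "bd Z \<subseteq> bd E1" "\<And>q. q \<in> QQ \<Longrightarrow> even (card (bd Z \<inter> q))" "even (card (bd Z \<inter> B))"
    unfolding closed_def using bd_Compl by auto
  have ZV: "Z \<subseteq> V" using Z by auto
  note h = glue_halves(3,4)[OF Z(2,3) Z(1)]
  have par: "p \<in> bd Z \<longleftrightarrow> p' \<in> bd Z" using glue_ends_parity[OF ZV Z(2,4)] .
  have bgs: "bd (g b) = {b, c}" "bd (g c) = {c, d}" using bd_g[OF b] bd_g[OF glue_B(1)] c d by auto
  define W where "W = V - (g b \<union> g c)"
  have W: "W \<subseteq> V" by (auto simp: W_def)
  have "bd W = bd (g b \<union> g c)" unfolding W_def using glue_B by (intro bd_Compl) auto
  also have "\<dots> \<subseteq> {b, d}" unfolding bd_Un[OF glue_B(14)] bgs by auto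
  finally have bdW: "bd W \<subseteq> {b, d}" .
  have WB: "x \<in> W \<longleftrightarrow> x \<noteq> b \<and> x \<noteq> c" "pv x \<in> W \<longleftrightarrow> x \<noteq> c \<and> x \<noteq> d" if "x \<in> B" for x
    using B_g[OF b that] B_g[OF glue_B(1) that] pv_g[OF b that] pv_g[OF glue_B(1) that] that B_V c d
    by (auto simp: W_def)
  have "bd (Z \<inter> W) \<subseteq> bd W"
  proof
    fix v assume v: "v \<in> bd (Z \<inter> W)"
    show "v \<in> bd W"
    proof (rule ccontr)
      assume "v \<notin> bd W"
      then have m: "v \<in> W" "pv v \<in> W" "v \<in> bd Z" using v by (auto simp: in_bd)
      then have "v \<in> {p, p'}" using Z(2) bd_glue by (auto simp: W_def)
      then show False using m WB ends glue_B by auto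
    qed
  qed
  then have ZW: "Z \<inter> W = {} \<or> Z \<inter> W = W" using segment_atom[OF W bdW, of "Z \<inter> W"] by auto
  have nbd: "b \<in> Z \<longleftrightarrow> pv b \<in> Z" if "b \<noteq> d" "p \<noteq> b"
  proof -
    have "b \<notin> bd E1" using that bd_glue_B b ends glue_B by auto
    then show ?thesis using Z(2) by (auto simp: in_bd)
  qed
  have nbd': "d \<in> Z \<longleftrightarrow> pv d \<in> Z" if "b \<noteq> d" "p = b"
  proof -
    have "d \<notin> bd E1" using that bd_glue_B ends glue_B by auto
    then show ?thesis using Z(2) by (auto simp: in_bd)
  qed
  have Wbd: "pv b \<in> W" "d \<in> W" if "b \<noteq> d" using WB b glue_B that by auto
  \<comment> \<open>For \<open>b = d\<close> the two gaps make up the whole cycle, and the two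
    halves are compared directly.\<close>
  have Wbd': "W = {}" if "b = d"
  proof -
    have "bd (g b \<union> g c) = {}" unfolding bd_Un[OF glue_B(14)] bgs using that by auto
    moreover have "g b \<union> g c \<subseteq> V" "b \<in> g b" using glue_B(15,16) gap.start by auto
    ultimately show ?thesis using bd_eq_empty[of "g b \<union> g c"] by (auto simp: W_def)
  qed
  have all: "(r \<in> bd (Z \<inter> g b)) = (r' \<in> bd (Z \<inter> g c)) \<and> (W = {} \<or> (r \<in> bd (Z \<inter> g b) \<longleftrightarrow> Z \<inter> W = W))"
  proof (cases "p = b")
    case True
    have "b \<in> bd Z \<longleftrightarrow> pv b \<in> Z" "c \<in> bd Z \<longleftrightarrow> pv c \<in> Z"
      using glue_mem[OF b] glue_mem[OF glue_B(1)] ends True glue_B(1-4) Z(1) by (auto simp: in_bd)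
    then have "pv b \<in> Z \<longleftrightarrow> pv c \<in> Z" using par True ends glue_B by auto
    then show ?thesis using glue_end(3,4)[of Z] True nbd' Wbd Wbd' ZW by (cases "b = d") auto
  next
    case False
    then have pc: "p = c" "p' = d" using ends by auto
    have "c \<in> bd Z \<longleftrightarrow> c \<in> Z" "d \<in> bd Z \<longleftrightarrow> d \<in> Z"
      using glue_mem(2)[OF glue_B(1)] glue_mem(2)[OF glue_B(2)] pc Z(1) by (auto simp: in_bd)
    then have "c \<in> Z \<longleftrightarrow> d \<in> Z" using par pc by auto
    then show ?thesis using glue_end(3,4)[of Z] False nbd Wbd Wbd' ZW by (cases "b = d") auto
  qed
  have split: "Z = (Z \<inter> g b) \<union> (Z \<inter> g c) \<union> (Z \<inter> W)" using ZV by (auto simp: W_def)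
  have "V - E1 = ((V - E) \<inter> g b) \<union> ((V - E') \<inter> g c) \<union> W"
    using E1 glue_B(14-16) by (auto simp: W_def)
  then show "Z = {} \<or> Z = V - E1" using split h all ZW by (cases "r \<in> bd (Z \<inter> g b)") auto
qed

lemma glue_good: "good (insert B QQ) E1"
  unfolding good_def
proof (intro conjI ballI impI)
  show "E1 \<subseteq> V" using E1 glue_B by auto
  show "E1 \<noteq> {}" using bd_glue_B by auto
  show "bd E1 \<subseteq> \<Union>(insert B QQ)" using bd_glue glue_B goodD(2)[OF E] goodD(2)[OF E'] by auto
  show "irr (insert B QQ) E1" "irr (insert B QQ) (V - E1)" by (rule glue_irr glue_irr_compl)+
  show "card (bd E1 \<inter> q) \<in> {0, 2}" if q: "q \<in> insert B QQ" for q
  proof (cases "q = B")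
    case True
    then show ?thesis using bd_glue_B glue_B(9) by simp
  next
    case False
    then have qQ: "q \<in> QQ" using q by auto
    then have "q \<inter> B = {}" using B_disj by auto
    then have e: "bd E1 \<inter> q = (bd E \<inter> g b \<inter> q) \<union> (bd E' \<inter> g c \<inter> q)" using bd_glue glue_B(5,6) by auto
    show ?thesis
    proof (cases "q = s")
      case True
      have "finite (bd E)" "finite (bd E')" using goodD(1)[OF E] goodD(1)[OF E'] finite_bd by auto
      moreover have "(bd E \<inter> g b \<inter> s) \<inter> (bd E' \<inter> g c \<inter> s) = {}" using glue_B(14) by blast
      ultimately have "card (bd E1 \<inter> s) = 2"
        using e True glue_odd_s glue_B(14) card_Un_disjoint[of "bd E \<inter> g b \<inter> s" "bd E' \<inter> g c \<inter> s"] by auto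
      then show ?thesis using True by simp
    next
      case F: False
      have bV: "bd (g b) \<subseteq> B" "bd (g c) \<subseteq> B" using glue_B by auto
      have c2: "card (bd E \<inter> q) \<in> {0, 2}" "card (bd E' \<inter> q) \<in> {0, 2}" using E E' qQ unfolding good_def by auto
      consider "q \<subseteq> g b" | "q \<subseteq> g c" | "q \<inter> g b = {}" "q \<inter> g c = {}"
        using sep[OF qQ F glue_B(15) bV(1)] sep[OF qQ F glue_B(16) bV(2)] by blast
      then have "bd E1 \<inter> q = bd E \<inter> q \<or> bd E1 \<inter> q = bd E' \<inter> q \<or> bd E1 \<inter> q = {}"
        by cases (use e glue_B(14) in blast)+
      then show ?thesis using c2 by auto
    qed
  qed
  show "pv v \<notin> E1" if v: "v \<in> \<Union>(insert B QQ)" "v \<in> E1" for v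
  proof (cases "v \<in> B")
    case True
    then show ?thesis using glue_mem[OF True] v ends glue_B(1-4) by auto
  next
    case False
    then have vQ: "v \<in> \<Union>QQ" using v by auto
    then have "v \<in> E \<Longrightarrow> pv v \<notin> E" "v \<in> E' \<Longrightarrow> pv v \<notin> E'" using E E' unfolding good_def by auto
    then show ?thesis
      using v(2) E1 g_mem(5)[OF b False] g_mem(5)[OF glue_B(1) False] glue_B(14) by auto
  qed
qed

end

end

section \<open>Cuts\<close>

lemma cnt_sum: "cnt P (\<Sum>b\<in>B. f b) = (\<Sum>b\<in>B. cnt P (f b))"
  by (induction B rule: infinite_finite_induct) auto

lemma filter_mset_disjoint:
  assumes "finite B" "\<And>x b c. x \<in># F \<Longrightarrow> b \<in> B \<Longrightarrow> c \<in> B \<Longrightarrow> P b x \<Longrightarrow> P c x \<Longrightarrow> b = c"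
  shows "filter_mset (\<lambda>x. \<exists>b\<in>B. P b x) F = (\<Sum>b\<in>B. filter_mset (P b) F)"
  using assms
proof (induction B)
  case (insert b B)
  have "filter_mset (\<lambda>x. \<exists>c\<in>insert b B. P c x) F = filter_mset (P b) F + filter_mset (\<lambda>x. \<exists>c\<in>B. P c x) F"
    using insert.prems insert.hyps(2) by (induction F) auto
  then show ?case using insert by simp
qed simp

lemma sum_two:
  fixes f :: "'b \<Rightarrow> nat"
  assumes "finite B" "x \<in> B" "y \<in> B" "x \<noteq> y" "\<And>z. z \<in> B \<Longrightarrow> z \<noteq> x \<Longrightarrow> z \<noteq> y \<Longrightarrow> f z = 0"
  shows "sum f B = f x + f y"
proof -
  have "sum f B = sum f {x, y}" using assms by (intro sum.mono_neutral_right) auto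
  then show ?thesis using assms(4) by simp
qed

lemma odd_card_pair:
  "x \<noteq> y \<Longrightarrow> odd (card ({x, y} \<inter> X)) \<longleftrightarrow> (x \<in> X) \<noteq> (y \<in> X)"
  by (cases "x \<in> X"; cases "y \<in> X") auto

text \<open>\<open>d\<close> is the cut function of a multigraph in which a member with two ends is
  an edge and a member without ends contributes nothing. Both inequalities hold edge by
  edge.\<close>

lemma cut_submodular:
  assumes "\<And>E. E \<in># M \<Longrightarrow> card (f E) \<in> {0, 2}" "\<And>E. E \<in># M \<Longrightarrow> finite (f E)"
  defines "d \<equiv> \<lambda>X. cnt (\<lambda>E. odd (card (f E \<inter> X))) M"
  shows "d (X \<inter> S) + d (X \<union> S) \<le> d X + d S" "d (X - S) + d (S - X) \<le> d X + d S"
proof -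
  have "d (X \<inter> S) + d (X \<union> S) \<le> d X + d S \<and> d (X - S) + d (S - X) \<le> d X + d S"
    unfolding d_def using assms(1,2)
  proof (induction M)
    case (add E M)
    have E: "card (f E) \<in> {0, 2}" "finite (f E)" using add.prems by auto
    let ?o = "\<lambda>X. of_bool (odd (card (f E \<inter> X))) :: nat"
    have o: "?o (X \<inter> S) + ?o (X \<union> S) \<le> ?o X + ?o S \<and> ?o (X - S) + ?o (S - X) \<le> ?o X + ?o S"
    proof (cases "card (f E) = 0")
      case False
      then obtain x y where xy: "f E = {x, y}" "x \<noteq> y" using E by (auto simp: card_2_iff)
      show ?thesis unfolding xy(1) odd_card_pair[OF xy(2)] by auto
    qed (use E in auto)
    have add_o: "cnt (\<lambda>E. odd (card (f E \<inter> X))) (add_mset E M) = ?o X + cnt (\<lambda>E. odd (card (f E \<inter> X))) M" for X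
      by simp
    show ?case unfolding add_o using o add.IH[OF add.prems] by (auto simp del: of_bool_odd_eq_mod_2)
  qed simp
  then show "d (X \<inter> S) + d (X \<union> S) \<le> d X + d S" "d (X - S) + d (S - X) \<le> d X + d S" by auto
qed

text \<open>A set that splits a region \<open>R b\<close> is uncrossed with it: as the cut of the region is
  exactly 4 and the cut of the part inside the region is at least 4, submodularity allows
  adding the region to the set, or removing it, without increasing the cut.\<close>

lemma cut_regions:
  fixes R :: "'b \<Rightarrow> 'c set"
  assumes M: "\<And>E. E \<in># M \<Longrightarrow> card (f E) \<in> {0, 2}" "\<And>E. E \<in># M \<Longrightarrow> finite (f E)"
  defines "d \<equiv> \<lambda>X. cnt (\<lambda>E. odd (card (f E \<inter> X))) M"
  assumes B: "finite B" "\<exists>b\<in>B. \<exists>c\<in>B. b \<noteq> c"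
    and disj: "\<And>b c. b \<in> B \<Longrightarrow> c \<in> B \<Longrightarrow> b \<noteq> c \<Longrightarrow> R b \<inter> R c = {}"
    and ne: "\<And>b. b \<in> B \<Longrightarrow> R b \<noteq> {}"
    and four: "\<And>b. b \<in> B \<Longrightarrow> d (R b) = 4"
    and inner: "\<And>b X. b \<in> B \<Longrightarrow> X \<subseteq> R b \<Longrightarrow> X \<noteq> {} \<Longrightarrow> 4 \<le> d X"
    and outer: "\<And>Y. Y \<subseteq> B \<Longrightarrow> Y \<noteq> {} \<Longrightarrow> Y \<noteq> B \<Longrightarrow> 4 \<le> d (\<Union>b\<in>Y. R b)"
    and X: "X \<subseteq> (\<Union>b\<in>B. R b)" "X \<noteq> {}" "X \<noteq> (\<Union>b\<in>B. R b)"
  shows "4 \<le> d X"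
  using X
proof (induction "card {b \<in> B. X \<inter> R b \<noteq> {} \<and> \<not> R b \<subseteq> X}" arbitrary: X rule: less_induct)
  case less
  let ?D = "\<lambda>X. {b \<in> B. X \<inter> R b \<noteq> {} \<and> \<not> R b \<subseteq> X}"
  have sub: "d (X \<inter> S) + d (X \<union> S) \<le> d X + d S" "d (X - S) + d (S - X) \<le> d X + d S" for X S
    unfolding d_def using cut_submodular[of M f X S] M by auto
  have smaller: "card (?D X') < card (?D X)" if "?D X' \<subseteq> ?D X - {b}" "b \<in> ?D X" for X' b
  proof -
    have "finite (?D X)" using B by auto
    moreover have "?D X' \<subset> ?D X" using that by blast
    ultimately show ?thesis by (rule psubset_card_mono)
  qed
  show ?case
  proof (cases "?D X = {}")
    case True
    let ?Y = "{b \<in> B. X \<inter> R b \<noteq> {}}"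
    have "R b \<subseteq> X" if "b \<in> ?Y" for b using True that by auto
    then have eq: "X = (\<Union>b\<in>?Y. R b)" using less.prems(1) by fastforce
    have "?Y \<noteq> {}" "?Y \<noteq> B" using less.prems eq by auto
    then show ?thesis using outer[of ?Y] eq by simp
  next
    case False
    then obtain b where b: "b \<in> B" "X \<inter> R b \<noteq> {}" "\<not> R b \<subseteq> X" by auto
    obtain c where c: "c \<in> B" "c \<noteq> b" using B(2) by metis
    have other: "R e \<inter> R b = {}" if "e \<in> B" "e \<noteq> b" for e using disj that b by auto
    show ?thesis
    \<comment> \<open>Adding the region must not exhaust the ground set. If it does, the region is
      removed instead; something remains, because another region is then contained in
      \<open>X\<close>.\<close>
    proof (cases "X \<union> R b = (\<Union>b\<in>B. R b)")
      case False
      have "?D (X \<union> R b) \<subseteq> ?D X - {b}" using other by blast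
      then have "4 \<le> d (X \<union> R b)"
        using less.hyps[OF smaller, of "X \<union> R b" b] less.prems b False by auto
      moreover have "4 \<le> d (X \<inter> R b)" using inner[of b "X \<inter> R b"] b by auto
      ultimately show ?thesis using sub(1)[of X "R b"] four[OF b(1)] by linarith
    next
      case True
      have "?D (X - R b) \<subseteq> ?D X - {b}" using other by blast
      moreover have "X - R b \<noteq> {}" using True ne[OF c(1)] other[OF c] c by blast
      moreover have "X - R b \<noteq> (\<Union>b\<in>B. R b)" using ne b by blast
      ultimately have "4 \<le> d (X - R b)"
        using less.hyps[OF smaller, of "X - R b" b] less.prems b by auto
      moreover have "4 \<le> d (R b - X)" using inner[of b "R b - X"] b by auto
      ultimately show ?thesis using sub(2)[of X "R b"] four[OF b(1)] by linarith
    qed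
  qed
qed

section \<open>The recombined family\<close>

context crossing_leaf
begin

lemma finite_B: "finite B"
  using B_V finV finite_subset by blast

lemma bij_n: "bij_betw n B B"
  using inj_nxt[OF B_V] n_in endo_inj_surj[OF finite_B, of n] by (auto simp: bij_betw_def inj_on_def)

text \<open>\<open>nxt B\<close> permutes \<open>B\<close> in a single cycle, along which a proper
  nonempty subset is left at least once and entered at least once.\<close>

lemma two_sides:
  assumes "Y \<subseteq> B" "Y \<noteq> {}" "Y \<noteq> B"
  shows "2 \<le> (\<Sum>b\<in>B. of_bool ((b \<in> Y) \<noteq> (n b \<in> Y)) :: nat)"
proof -
  obtain a where a: "a \<in> Y" "n a \<notin> Y" using nxt_orbit[OF B_V, of Y] assms by blast
  obtain c where c: "c \<in> B - Y" "n c \<in> Y"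
    using nxt_orbit[OF B_V, of "B - Y"] assms n_in by blast
  have "(\<Sum>b\<in>{a, c}. of_bool ((b \<in> Y) \<noteq> (n b \<in> Y)) :: nat) \<le> (\<Sum>b\<in>B. of_bool ((b \<in> Y) \<noteq> (n b \<in> Y)))"
    using finite_B a c assms by (intro sum_mono2) auto
  moreover have "a \<noteq> c" using a c by auto
  ultimately show ?thesis using a c by auto
qed

text \<open>Every vertex \<open>b \<in> B\<close> lies inside exactly two members \<open>e1 b\<close> and \<open>e2 b\<close>, each of
  which leaves the two gaps at \<open>b\<close> through \<open>s\<close>.  These members are cut at \<open>b\<close>, and the
  halves are glued again at the other end: \<open>st b\<close> and \<open>dst b\<close> join halves in consecutive
  gaps along the tree of \<open>s\<close> and close up along the tree of \<open>B\<close>.\<close>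

theorem extend_leaf:
  assumes F: "fam QQ F" shows "\<exists>F'. fam (insert B QQ) F'"
proof -
  have goodF: "good QQ E" if "E \<in># F" for E using F that unfolding fam_def by auto
  have "\<exists>x y. filter_mset (\<lambda>E. b \<in> E) F = {#x, y#}" if "b \<in> B" for b
  proof -
    have "cnt (\<lambda>E. b \<in> E) F = 2" using F that B_V unfolding fam_def by auto
    then obtain x N where "filter_mset (\<lambda>E. b \<in> E) F = add_mset x N"
      using size_eq_Suc_imp_eq_union[of _ 1] by (metis numeral_2_eq_2 One_nat_def)
    moreover from this have "size N = 1" using \<open>cnt _ F = 2\<close> by simp
    ultimately show ?thesis using size_1_singleton_mset by blast
  qed
  then obtain e1 e2 where e12: "\<And>b. b \<in> B \<Longrightarrow> filter_mset (\<lambda>E. b \<in> E) F = {#e1 b, e2 b#}" by metis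
  have e: "good QQ (e1 b)" "good QQ (e2 b)" "b \<in> e1 b" "b \<in> e2 b" if "b \<in> B" for b
  proof -
    have "e1 b \<in># filter_mset (\<lambda>E. b \<in> E) F" "e2 b \<in># filter_mset (\<lambda>E. b \<in> E) F" using e12[OF that] by auto
    then show "good QQ (e1 b)" "good QQ (e2 b)" "b \<in> e1 b" "b \<in> e2 b" using goodF by auto
  qed
  define F0 where "F0 = filter_mset (\<lambda>E. E \<inter> B = {}) F"
  \<comment> \<open>\<open>st\<close> joins the halves that precede a vertex of \<open>B\<close>,
    and \<open>dst\<close> those that follow it. Over all \<open>b \<in> B\<close>, each of the four
    halves at a vertex of \<open>B\<close> is used exactly once: those of \<open>e1\<close> in the
    first gap of a pair, those of \<open>e2\<close> in the second.\<close>
  define st where "st b = (e1 (n b) \<inter> g b) \<union> (e2 (n (n b)) \<inter> g (n b))" for b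
  define dst where "dst b = (e1 b \<inter> g b) \<union> (e2 (n b) \<inter> g (n b))" for b
  define F' where "F' = F0 + (\<Sum>b\<in>B. {#st b, dst b#})"
  have "F = F0 + filter_mset (\<lambda>E. \<exists>b\<in>B. b \<in> E) F"
  proof -
    have "filter_mset (\<lambda>E. \<not> E \<inter> B = {}) F = filter_mset (\<lambda>E. \<exists>b\<in>B. b \<in> E) F"
      by (intro filter_mset_cong) auto
    then show ?thesis unfolding F0_def using multiset_partition[of F "\<lambda>E. E \<inter> B = {}"] by simp
  qed
  also have "filter_mset (\<lambda>E. \<exists>b\<in>B. b \<in> E) F = (\<Sum>b\<in>B. filter_mset (\<lambda>E. b \<in> E) F)"
    using finite_B good_one[OF goodF] by (intro filter_mset_disjoint) auto
  finally have Feq: "F = F0 + (\<Sum>b\<in>B. {#e1 b, e2 b#})" using e12 by (simp cong: sum.cong)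
  \<comment> \<open>\<open>E\<close> avoids both ends of \<open>g c\<close>, so
    \<open>region_free\<close> puts it inside or outside this gap, and \<open>b\<close> is
    outside.\<close>
  have efar: "E \<inter> g c = {}" if E: "good QQ E" "b \<in> E" and bc: "b \<in> B" "c \<in> B" "b \<noteq> c" "b \<noteq> n c" for E b c
  proof -
    have "c \<notin> E" "n c \<notin> E" using good_one[OF E(1)] bc E n_in by metis+
    then have "E \<inter> g c = {} \<or> E \<subseteq> g c"
      using goodD(1-4)[OF E(1)] bd_g[OF bc(2)] g_V bc n_in by (intro region_free) auto
    then show ?thesis using B_g[OF bc(2,1)] bc E by auto
  qed
  \<comment> \<open>In \<open>g c\<close> only the members through \<open>c\<close> and
    \<open>n c\<close> change, and their four traces there reappear in \<open>st c\<close>,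
    \<open>dst c\<close>, \<open>st a\<close> and \<open>dst a\<close>, where
    \<open>n a = c\<close>. So everything decided within one gap keeps its count, in particular the
    double cover and the cuts inside a gap.\<close>
  have local: "cnt P F' = cnt P F" if c: "c \<in> B" and P: "\<And>E. P E \<longleftrightarrow> P (E \<inter> g c)" "\<not> P {}" for P c
  proof -
    obtain a where a: "a \<in> B" "n a = c" using bij_n c unfolding bij_betw_def by (metis imageE)
    have ac: "a \<noteq> c" "n c \<noteq> c" using n_neq[OF a(1)] a(2) n_neq[OF c] by metis+
    have Pe: "\<not> P (e1 b)" "\<not> P (e2 b)" if "b \<in> B" "b \<noteq> c" "b \<noteq> n c" for b
      using efar[OF e(1,3) _ c] efar[OF e(2,4) _ c] that P by metis+
    have dis: "g b \<inter> g c = {}" if "b \<in> B" "b \<noteq> c" for b using g_disj that c by auto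
    have "(\<Sum>b\<in>B. cnt P {#e1 b, e2 b#}) = cnt P {#e1 c, e2 c#} + cnt P {#e1 (n c), e2 (n c)#}"
      using Pe by (intro sum_two[OF finite_B c n_in[OF c]]) (use ac in auto)
    moreover have "(\<Sum>b\<in>B. cnt P {#st b, dst b#}) = cnt P {#st c, dst c#} + cnt P {#st a, dst a#}"
    proof (rule sum_two[OF finite_B c a(1) ac(1)[symmetric]])
      fix b assume b: "b \<in> B" "b \<noteq> c" "b \<noteq> a"
      then have "n b \<noteq> c" using inj_nxt[OF B_V] a by metis
      then have "st b \<inter> g c = {}" "dst b \<inter> g c = {}"
        using dis[of b] dis[of "n b"] b n_in by (auto simp: st_def dst_def)
      then show "cnt P {#st b, dst b#} = 0" using P by (metis (no_types) cnt_0 set_mset_add_mset_insert set_mset_empty insertE empty_iff)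
    qed
    moreover have "st c \<inter> g c = e1 (n c) \<inter> g c" "dst c \<inter> g c = e1 c \<inter> g c"
      using dis[of "n c"] n_in[OF c] ac by (auto simp: st_def dst_def)
    then have "P (st c) = P (e1 (n c))" "P (dst c) = P (e1 c)" using P(1) by metis+
    moreover have "st a \<inter> g c = e2 (n c) \<inter> g c" "dst a \<inter> g c = e2 c \<inter> g c"
      using dis[of a] a ac by (auto simp: st_def dst_def)
    then have "P (st a) = P (e2 (n c))" "P (dst a) = P (e2 c)" using P(1) by metis+
    ultimately have "(\<Sum>b\<in>B. cnt P {#st b, dst b#}) = (\<Sum>b\<in>B. cnt P {#e1 b, e2 b#})" by simp
    moreover have "cnt P F = cnt P (F0 + (\<Sum>b\<in>B. {#e1 b, e2 b#}))" by (rule arg_cong[OF Feq])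
    ultimately show ?thesis unfolding F'_def by (simp only: filter_union_mset size_union cnt_sum)
  qed
  have st_good: "good (insert B QQ) (st b)" "good (insert B QQ) (dst b)"
    and st_bd: "bd (st b) = insert (n b) (insert (n (n b)) ((bd (e1 (n b)) \<inter> g b) \<union> (bd (e2 (n (n b))) \<inter> g (n b))))"
    and dst_bd: "bd (dst b) = insert b (insert (n b) ((bd (e1 b) \<inter> g b) \<union> (bd (e2 (n b)) \<inter> g (n b))))"
    and st_s: "card (bd (e1 (n b)) \<inter> g b \<inter> s) = 1" "card (bd (e2 (n (n b))) \<inter> g (n b) \<inter> s) = 1"
    and dst_s: "card (bd (e1 b) \<inter> g b \<inter> s) = 1" "card (bd (e2 (n b)) \<inter> g (n b) \<inter> s) = 1"
    if b: "b \<in> B" for b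
  proof -
    have n: "n b \<in> B" "n (n b) \<in> B" using b n_in by auto
    show "good (insert B QQ) (st b)"
      using glue_good[OF b refl refl e(1)[OF n(1)] e(2)[OF n(2)] _ e(3)[OF n(1)] e(4)[OF n(2)] st_def] by blast
    show "good (insert B QQ) (dst b)"
      using glue_good[OF b refl refl e(1)[OF b] e(2)[OF n(1)] _ e(3)[OF b] e(4)[OF n(1)] dst_def] by blast
    show "bd (st b) = insert (n b) (insert (n (n b)) ((bd (e1 (n b)) \<inter> g b) \<union> (bd (e2 (n (n b))) \<inter> g (n b))))"
      using bd_glue[OF b refl refl e(1)[OF n(1)] e(2)[OF n(2)] _ e(3)[OF n(1)] e(4)[OF n(2)] st_def] by blast
    show "bd (dst b) = insert b (insert (n b) ((bd (e1 b) \<inter> g b) \<union> (bd (e2 (n b)) \<inter> g (n b))))"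
      using bd_glue[OF b refl refl e(1)[OF b] e(2)[OF n(1)] _ e(3)[OF b] e(4)[OF n(1)] dst_def] by blast
    show "card (bd (e1 (n b)) \<inter> g b \<inter> s) = 1" "card (bd (e2 (n (n b))) \<inter> g (n b) \<inter> s) = 1"
      using glue_odd_s[OF b refl refl e(1)[OF n(1)] e(2)[OF n(2)] _ e(3)[OF n(1)] e(4)[OF n(2)] st_def] by blast+
    show "card (bd (e1 b) \<inter> g b \<inter> s) = 1" "card (bd (e2 (n b)) \<inter> g (n b) \<inter> s) = 1"
      using glue_odd_s[OF b refl refl e(1)[OF b] e(2)[OF n(1)] _ e(3)[OF b] e(4)[OF n(1)] dst_def] by blast+
  qed
  have good': "good (insert B QQ) E" if "E \<in># F'" for E
  proof -
    have "E \<in># F0 \<or> (\<exists>b\<in>B. E = st b \<or> E = dst b)" using that unfolding F'_def by (auto simp: set_mset_sum[OF finite_B])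
    then show ?thesis
    proof
      assume "E \<in># F0"
      then have E: "good QQ E" "E \<inter> B = {}" using goodF by (auto simp: F0_def)
      have "bd E \<inter> B = {}" using goodD(2)[OF E(1)] B_disj by blast
      moreover have "irr (insert B QQ) D" if "irr QQ D" for D
        using that unfolding irr_def closed_def by auto
      ultimately show ?thesis using E unfolding good_def by auto
    qed (use st_good in auto)
  qed
  \<comment> \<open>On \<open>B\<close>, and on the parts of \<open>s\<close> in the gaps, the pairs
    of ends form the cycle of \<open>n\<close> with doubled edges. The index \<open>i\<close>
    records a shift: \<open>dst b\<close> joins \<open>b\<close> to \<open>n b\<close> in both
    cases, whereas \<open>st b\<close> joins \<open>n b\<close> to \<open>n (n b)\<close> on
    \<open>B\<close> (\<open>i = 1\<close>) but the gaps of \<open>b\<close> and \<open>n b\<close>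
    on \<open>s\<close> (\<open>i = 0\<close>).\<close>
  have sparse: "2 * 2 \<le> cnt (\<lambda>E. odd (card (bd E \<inter> X))) F'"
    if Y: "Y \<subseteq> B" "Y \<noteq> {}" "Y \<noteq> B" and i: "i = 0 \<or> i = (1::nat)"
      and dst: "\<And>b. b \<in> B \<Longrightarrow> (b \<in> Y) \<noteq> (n b \<in> Y) \<Longrightarrow> odd (card (bd (dst b) \<inter> X))"
      and st: "\<And>b. b \<in> B \<Longrightarrow> (i = 0 \<longrightarrow> (b \<in> Y) \<noteq> (n b \<in> Y)) \<Longrightarrow> (i = 1 \<longrightarrow> (n b \<in> Y) \<noteq> (n (n b) \<in> Y)) \<Longrightarrow>
          odd (card (bd (st b) \<inter> X))"
    for X Y i
  proof -
    let ?P = "\<lambda>E. odd (card (bd E \<inter> X))"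
    let ?f = "\<lambda>b. of_bool ((b \<in> Y) \<noteq> (n b \<in> Y)) :: nat"
    have "2 \<le> (\<Sum>b\<in>B. ?f b)" using two_sides[OF Y] .
    moreover have "(\<Sum>b\<in>B. ?f (n b)) = (\<Sum>b\<in>B. ?f b)" using sum.reindex_bij_betw[OF bij_n] .
    moreover have "(\<Sum>b\<in>B. ?f b + (if i = 0 then ?f b else ?f (n b))) \<le> (\<Sum>b\<in>B. cnt ?P {#st b, dst b#})"
      by (rule sum_mono) (use dst st i in auto)
    ultimately have "2 * 2 \<le> (\<Sum>b\<in>B. cnt ?P {#st b, dst b#})"
      using i by (auto simp: sum.distrib)
    also have "\<dots> \<le> cnt ?P F'" unfolding F'_def by (simp only: filter_union_mset size_union cnt_sum)
    finally show ?thesis .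
  qed
  have bd_local: "bd (E \<inter> g c) \<inter> X = bd E \<inter> X" if "c \<in> B" "X \<subseteq> g c" "X \<inter> B = {}" for E c X
  proof -
    have "v \<in> X \<Longrightarrow> v \<in> bd (E \<inter> g c) \<longleftrightarrow> v \<in> bd E" for v
      using bd_Int_g[OF that(1), of v E] that n_in by auto
    then show ?thesis by auto
  qed
  have cut_local: "cnt (\<lambda>E. odd (card (bd E \<inter> X))) F' = cnt (\<lambda>E. odd (card (bd E \<inter> X))) F"
    if "c \<in> B" "X \<subseteq> g c" "X \<inter> B = {}" for c X
    by (rule local[OF that(1)]) (use bd_local[OF that] in auto)
  have cutF: "4 \<le> cnt (\<lambda>E. odd (card (bd E \<inter> X))) F" if "q \<in> QQ" "X \<subseteq> q" "X \<noteq> {}" "X \<noteq> q" for q X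
    using F that unfolding fam_def by blast
  have sB: "s \<inter> B = {}" using B_disj s_in by auto
  have cut: "4 \<le> cnt (\<lambda>E. odd (card (bd E \<inter> X))) F'"
    if q: "q \<in> insert B QQ" and X: "X \<subseteq> q" "X \<noteq> {}" "X \<noteq> q" for q X
  proof -
    consider "q = B" | "q \<in> QQ" "q \<noteq> s" | "q = s" using q by auto
    then show ?thesis
    proof cases
      case 1
      have gB: "bd E \<inter> B = {}" if "good QQ E" for E using goodD(2)[OF that] B_disj by blast
      have d: "bd (dst b) \<inter> X = {b, n b} \<inter> X" "bd (st b) \<inter> X = {n b, n (n b)} \<inter> X" if b: "b \<in> B" for b
      proof -
        have n: "n b \<in> B" "n (n b) \<in> B" using b n_in by auto
        have off: "insert x (insert y ((bd E \<inter> G) \<union> (bd E' \<inter> G'))) \<inter> X = {x, y} \<inter> X"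
          if "good QQ E" "good QQ E'" for x y E E' G G'
          using gB[OF that(1)] gB[OF that(2)] X 1 by auto
        show "bd (dst b) \<inter> X = {b, n b} \<inter> X"
          unfolding dst_bd[OF b] by (rule off) (use e b n in auto)
        show "bd (st b) \<inter> X = {n b, n (n b)} \<inter> X"
          unfolding st_bd[OF b] by (rule off) (use e b n in auto)
      qed
      have "2 * 2 \<le> cnt (\<lambda>E. odd (card (bd E \<inter> X))) F'"
      proof (rule sparse[where i = 1])
        show "odd (card (bd (dst b) \<inter> X))" if "b \<in> B" "(b \<in> X) \<noteq> (n b \<in> X)" for b
          unfolding d(1)[OF that(1)] using odd_card_pair n_neq that by metis
        show "odd (card (bd (st b) \<inter> X))"
          if "b \<in> B" "1 = 1 \<longrightarrow> (n b \<in> X) \<noteq> (n (n b) \<in> X)" for b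
          unfolding d(2)[OF that(1)] using odd_card_pair n_neq n_in that by metis
      qed (use X 1 in auto)
      then show ?thesis by simp
    next
      case 2
      obtain x where x: "x \<in> X" using X by auto
      then have "x \<in> V" using X 2 QQ_V by auto
      then obtain c where c: "c \<in> B" "x \<in> g c" using g_cover by auto
      have "q \<subseteq> g c" using sep[OF 2 g_V[OF c(1)]] bd_g[OF c(1)] c n_in x X by auto
      moreover have "q \<inter> B = {}" using 2 B_disj by auto
      ultimately have "cnt (\<lambda>E. odd (card (bd E \<inter> X))) F' = cnt (\<lambda>E. odd (card (bd E \<inter> X))) F"
        using X by (intro cut_local[OF c(1)]) auto
      then show ?thesis using cutF[OF 2(1) X] by simp
    next
      case 3
      let ?f = "\<lambda>E. bd E \<inter> s" and ?R = "\<lambda>b. s \<inter> g b"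
      have fX: "bd E \<inter> s \<inter> Z = bd E \<inter> Z" if "Z \<subseteq> s" for E Z using that by auto
      have sU: "s = (\<Union>b\<in>B. ?R b)" using g_cover QQ_V s_in by blast
      have "4 \<le> cnt (\<lambda>E. odd (card (?f E \<inter> X))) F'"
      proof (rule cut_regions[where R = ?R and B = B])
        show "card (?f E) \<in> {0, 2}" "finite (?f E)" if "E \<in># F'" for E
          using good'[OF that] s_in finite_bd[of E] unfolding good_def by auto
        show "?R b \<inter> ?R c = {}" if "b \<in> B" "c \<in> B" "b \<noteq> c" for b c using g_disj[OF that] by auto
        show "?R b \<noteq> {}" if "b \<in> B" for b using meets[OF that] .
        \<comment> \<open>An odd number of ends in the region means that the member runs through
          exactly one end of the gap: two members do so at \<open>b\<close>, two others at
          \<open>n b\<close>.\<close>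
        show "cnt (\<lambda>E. odd (card (?f E \<inter> ?R b))) F' = 4" if b: "b \<in> B" for b
        proof -
          have "cnt (\<lambda>E. odd (card (bd E \<inter> ?R b))) F' = cnt (\<lambda>E. odd (card (bd E \<inter> ?R b))) F"
            using sB by (intro cut_local[OF b]) auto
          also have "\<dots> = cnt (\<lambda>E. b \<in> E) F + cnt (\<lambda>E. n b \<in> E) F"
          proof (rule cnt_xor)
            fix E assume E: "E \<in># F"
            have "bd E \<inter> ?R b = bd E \<inter> g b \<inter> s" by auto
            moreover have "odd (card (bd E \<inter> g b \<inter> s)) \<longleftrightarrow> odd (card ({b, n b} \<inter> E))"
              using odd_region(1)[OF goodD(1,2,4)[OF goodF[OF E]] g_V[OF b]] bd_g[OF b] b n_in by auto
            ultimately show "odd (card (bd E \<inter> ?R b)) \<longleftrightarrow> (b \<in> E) \<noteq> (n b \<in> E)"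
              using odd_card_pair[OF n_neq[OF b, symmetric]] by simp
            show "\<not> (b \<in> E \<and> n b \<in> E)" using good_one[OF goodF[OF E]] b n_in n_neq by metis
          qed
          also have "\<dots> = 4"
          proof -
            have "b \<in> V" "n b \<in> V" using b n_in B_V by auto
            then show ?thesis using F unfolding fam_def by simp
          qed
          finally show ?thesis by (simp add: fX)
        qed
        show "4 \<le> cnt (\<lambda>E. odd (card (?f E \<inter> Z))) F'" if b: "b \<in> B" and Z: "Z \<subseteq> ?R b" "Z \<noteq> {}" for b Z
        proof -
          obtain c where c: "c \<in> B" "c \<noteq> b" using ex_other[OF b] by auto
          have "Z \<noteq> s" using Z meets[OF c(1)] g_disj[OF c(1) b c(2)] by blast
          then have "4 \<le> cnt (\<lambda>E. odd (card (bd E \<inter> Z))) F" using Z by (intro cutF[OF s_in]) auto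
          moreover have "cnt (\<lambda>E. odd (card (bd E \<inter> Z))) F' = cnt (\<lambda>E. odd (card (bd E \<inter> Z))) F"
            using Z sB by (intro cut_local[OF b]) auto
          moreover have "Z \<subseteq> s" using Z by auto
          ultimately show ?thesis by (simp add: fX)
        qed
        show "4 \<le> cnt (\<lambda>E. odd (card (?f E \<inter> (\<Union>b\<in>Y. ?R b)))) F'" if Y: "Y \<subseteq> B" "Y \<noteq> {}" "Y \<noteq> B" for Y
        proof -
          let ?X = "\<Union>b\<in>Y. ?R b"
          have gX: "A \<inter> g c \<inter> ?X = (if c \<in> Y then A \<inter> g c \<inter> s else {})" if "c \<in> B" for A c
          proof -
            have "g c \<inter> g b = {}" if "b \<in> Y" "b \<noteq> c" for b
              using g_disj[OF \<open>c \<in> B\<close>, of b] that Y by auto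
            then have "v \<in> g c \<Longrightarrow> v \<in> ?X \<longleftrightarrow> c \<in> Y \<and> v \<in> s" for v by auto
            then show ?thesis by auto
          qed
          have pair: "odd (card (insert x (insert y ((A \<inter> g b) \<union> (A' \<inter> g (n b)))) \<inter> ?X))"
            if b: "b \<in> B" "(b \<in> Y) \<noteq> (n b \<in> Y)" "x \<in> B" "y \<in> B" "card (A \<inter> g b \<inter> s) = 1" "card (A' \<inter> g (n b) \<inter> s) = 1"
            for b x y A A'
          proof -
            have "insert x (insert y ((A \<inter> g b) \<union> (A' \<inter> g (n b)))) \<inter> ?X
                = (A \<inter> g b \<inter> ?X) \<union> (A' \<inter> g (n b) \<inter> ?X)" using that sB by auto
            also have "\<dots> = (if b \<in> Y then A \<inter> g b \<inter> s else A' \<inter> g (n b) \<inter> s)"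
              unfolding gX[OF b(1)] gX[OF n_in[OF b(1)]] using b(2) by auto
            finally show ?thesis using that by simp
          qed
          have "2 * 2 \<le> cnt (\<lambda>E. odd (card (bd E \<inter> ?X))) F'"
          proof (rule sparse[where i = 0])
            show "odd (card (bd (dst b) \<inter> ?X))" if "b \<in> B" "(b \<in> Y) \<noteq> (n b \<in> Y)" for b
              unfolding dst_bd[OF that(1)] by (rule pair) (use that n_in dst_s in auto)
            show "odd (card (bd (st b) \<inter> ?X))"
              if "b \<in> B" "(0::nat) = 0 \<longrightarrow> (b \<in> Y) \<noteq> (n b \<in> Y)" for b
              unfolding st_bd[OF that(1)] by (rule pair) (use that n_in st_s in auto)
          qed (use Y in auto)
          moreover have "?X \<subseteq> s" by auto
          ultimately show ?thesis by (simp add: fX)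
        qed
      qed (use finite_B B_two X 3 sU in auto)
      then show ?thesis using X 3 by (simp add: fX)
    qed
  qed
  have "cnt (\<lambda>E. v \<in> E) F' = 2" if v: "v \<in> V" for v
  proof -
    obtain c where c: "c \<in> B" "v \<in> g c" using g_cover[OF v] by auto
    have "cnt (\<lambda>E. v \<in> E) F' = cnt (\<lambda>E. v \<in> E) F" by (rule local[OF c(1)]) (use c in auto)
    then show ?thesis using F v unfolding fam_def by auto
  qed
  then have "fam (insert B QQ) F'" using good' cut unfolding fam_def by blast
  then show ?thesis ..
qed

end

section \<open>Overlap trees\<close>

context cyclic
begin

text \<open>For nonempty \<open>X \<subseteq> V\<close> the sets \<open>R\<close> are the unions of
  gaps of \<open>X\<close>, so for \<open>Y \<subseteq> V\<close> the condition says that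
  \<open>Y\<close> is not contained in a single gap.\<close>

definition cross :: "'a set \<Rightarrow> 'a set \<Rightarrow> bool" where
  "cross X Y \<longleftrightarrow> (\<exists>R\<subseteq>V. bd R \<subseteq> X \<and> Y \<inter> R \<noteq> {} \<and> Y - R \<noteq> {})"

inductive otree :: "'a set set \<Rightarrow> bool" where
  otree_single: "\<lbrakk>q \<subseteq> V; 2 \<le> card q\<rbrakk> \<Longrightarrow> otree {q}"
| otree_insert: "\<lbrakk>otree QQ; q \<subseteq> V; 2 \<le> card q; q \<inter> \<Union>QQ = {}; s \<in> QQ; cross q s;
     \<And>q'. q' \<in> QQ \<Longrightarrow> q' \<noteq> s \<Longrightarrow> \<not> cross q q'\<rbrakk> \<Longrightarrow> otree (insert q QQ)"

lemma otree_basic: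
  assumes "otree QQ"
  shows "\<Union>QQ \<subseteq> V" "pairwise disjnt QQ" "q \<in> QQ \<Longrightarrow> q \<noteq> {}"
proof -
  have "\<Union>QQ \<subseteq> V \<and> pairwise disjnt QQ \<and> (\<forall>q\<in>QQ. q \<noteq> {})"
    using assms
  proof induction
    case (otree_single q)
    then show ?case by auto
  next
    case (otree_insert QQ q s)
    then have "q \<noteq> {}" by auto
    moreover have "disjnt q p" "disjnt p q" if "p \<in> QQ" for p
      using that otree_insert.hyps by (auto simp: disjnt_def)
    ultimately show ?case using otree_insert by (auto simp: pairwise_insert)
  qed
  then show "\<Union>QQ \<subseteq> V" "pairwise disjnt QQ" "q \<in> QQ \<Longrightarrow> q \<noteq> {}" by auto
qed

text \<open>A region with ends in \<open>q\<close> has no end inside \<open>R\<close>; by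
  \<open>segment_atom\<close> it contains \<open>R\<close> or avoids it and cannot split
  \<open>s\<close>.\<close>

lemma not_cross_segment:
  assumes "R \<subseteq> V" "bd R \<subseteq> {a, c}" "q \<inter> R = {}" "s \<subseteq> R"
  shows "\<not> cross q s"
proof
  assume "cross q s"
  then obtain S where S: "S \<subseteq> V" "bd S \<subseteq> q" "s \<inter> S \<noteq> {}" "s - S \<noteq> {}" unfolding cross_def by auto
  have "bd (S \<inter> R) \<subseteq> bd R"
  proof
    fix v assume "v \<in> bd (S \<inter> R)"
    then show "v \<in> bd R" using S(2) assms(3) by (auto simp: bd_def)
  qed
  then have "S \<inter> R = {} \<or> S \<inter> R = R" using segment_atom[OF assms(1,2), of "S \<inter> R"] by auto
  then show False using S assms(4) by blast
qed

text \<open>Sets on different sides of a segment do not cross, while each new set crosses an earlier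
  one. So a gap that avoids \<open>s\<close> avoids all sets.\<close>

lemma otree_segment:
  assumes "otree QQ" "R \<subseteq> V" "bd R \<subseteq> {a, c}" "\<And>q. q \<in> QQ \<Longrightarrow> q \<subseteq> R \<or> q \<inter> R = {}"
  shows "\<Union>QQ \<subseteq> R \<or> \<Union>QQ \<inter> R = {}"
  using assms(1,4)
proof (induction rule: otree.induct)
  case (otree_insert QQ q s)
  have IH: "\<Union>QQ \<subseteq> R \<or> \<Union>QQ \<inter> R = {}" using otree_insert by auto
  have s: "s \<noteq> {}" "s \<subseteq> V" using otree_basic[OF otree_insert.hyps(1)] otree_insert.hyps(5) by auto
  have q: "q \<subseteq> R \<or> q \<inter> R = {}" using otree_insert.prems by auto
  have bC: "bd (V - R) \<subseteq> {a, c}" using bd_Compl[OF assms(2)] assms(3) by simp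
  have "\<not> (s \<subseteq> R \<and> q \<inter> R = {})" using not_cross_segment[OF assms(2,3)] otree_insert.hyps by blast
  moreover have "\<not> (q \<subseteq> R \<and> s \<inter> R = {})"
    using not_cross_segment[OF _ bC, of q s] otree_insert.hyps s by blast
  ultimately show ?case using IH q s otree_insert.hyps(5) by blast
qed auto

theorem otree_fam:
  assumes "otree QQ" shows "\<exists>F. fam QQ F"
  using assms
proof induction
  case (otree_single q)
  then show ?case
  proof (induction "card q" arbitrary: q rule: less_induct)
    case less
    show ?case
    proof (cases "card q = 2")
      case False
      obtain b' where b': "b' \<in> q" using less.prems by fastforce
      have "card (q - {b'}) \<noteq> 0" using less.prems b' by simp
      then obtain a where a: "a \<in> q" "a \<noteq> b'" by (metis card.empty Diff_iff all_not_in_conv insertCI)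
      define b where "b = nxt q b'"
      have b: "b \<in> q" "b \<noteq> b'" using nxt(1)[OF less.prems(1) b'] nxt_neq[OF less.prems(1) b' a] b_def by auto
      have K: "gap q b' \<subseteq> V" "bd (gap q b') = {b', b}" "b' \<in> gap q b'" "b \<notin> gap q b'"
        using gap_subset less.prems b' bd_gap[OF less.prems(1) b' a] b_def gap.start gap_Int[OF b'] b by auto
      have c: "card (q - {b}) < card q" "2 \<le> card (q - {b})"
        using b less.prems False finite_subset[OF less.prems(1) finV] by (auto intro: psubset_card_mono)
      then obtain F where "fam {q - {b}} F" using less.hyps[OF c(1)] less.prems by auto
      then have "fam {q} (image_mset (\<lambda>E. E - gap q b') F + {#gap q b', gap q b'#})"
        using K b b' less.prems gap_Int[OF b'] by (intro split_attachment[of _ b' b]) auto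
      then show ?thesis by blast
    qed (use less fam_pair in auto)
  qed
next
  case (otree_insert QQ q s)
  note QQ = otree_basic[OF otree_insert.hyps(1)]
  obtain F where F: "fam QQ F" using otree_insert.IH by auto
  have s: "s \<noteq> {}" "s \<in> QQ" using QQ otree_insert.hyps(5) by auto
  from otree_insert.hyps(2-4,6,7) show ?case
  proof (induction "card q" arbitrary: q rule: less_induct)
    case less
    note qV = less.prems(1)
    have fin: "finite q" using finite_subset[OF qV finV] .
    have "\<exists>a\<in>q. a \<noteq> b'" if "b' \<in> q" for b'
    proof -
      have "q \<noteq> {b'}" using less.prems(2) by auto
      then show ?thesis using that by auto
    qed
    note other = this
    show ?case
    proof (cases "\<forall>b\<in>q. s \<inter> gap q b \<noteq> {}")
      case True
      have "q \<noteq> {}" using less.prems(2) by auto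
      interpret cl: crossing_leaf V nx pv QQ s q
      proof
        show "q' \<subseteq> S \<or> q' \<inter> S = {}" if "q' \<in> QQ" "q' \<noteq> s" "S \<subseteq> V" "bd S \<subseteq> q" for q' S
          using less.prems(5)[OF that(1,2)] that(3,4) unfolding cross_def by blast
        show "\<exists>b\<in>q. \<exists>c\<in>q. b \<noteq> c" using \<open>q \<noteq> {}\<close> other by blast
      qed (use QQ s less.prems True in auto)
      show ?thesis using cl.extend_leaf[OF F] .
    next
      case False
      then obtain b' where b': "b' \<in> q" "s \<inter> gap q b' = {}" by auto
      obtain a where a: "a \<in> q" "a \<noteq> b'" using other[OF b'(1)] by auto
      define b where "b = nxt q b'"
      define K where "K = gap q b'"
      have b: "b \<in> q" "b \<noteq> b'" using nxt(1)[OF qV b'(1)] nxt_neq[OF qV b'(1) a] b_def by auto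
      have K: "K \<subseteq> V" "bd K = {b', b}" "b' \<in> K" "b \<notin> K" "K \<inter> q = {b'}" "s \<inter> K = {}"
        using gap_subset qV b' bd_gap[OF qV b'(1) a] b_def gap.start gap_Int[OF b'(1)] b
        by (auto simp: K_def)
      have "\<Union>QQ \<subseteq> K \<or> \<Union>QQ \<inter> K = {}"
      proof (rule otree_segment[OF otree_insert.hyps(1) K(1)])
        show "bd K \<subseteq> {b', b}" using K by simp
        show "q' \<subseteq> K \<or> q' \<inter> K = {}" if "q' \<in> QQ" for q'
        proof (cases "q' = s")
          case F: False
          have "bd K \<subseteq> q" using K b b' by simp
          then show ?thesis using less.prems(5)[OF that F] K(1) unfolding cross_def by blast
        qed (use K in auto)
      qed
      then have QK: "\<Union>QQ \<inter> K = {}" using s K by blast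
      obtain S where S: "S \<subseteq> V" "bd S \<subseteq> q" "s \<inter> S \<noteq> {}" "s - S \<noteq> {}"
        using less.prems(4) unfolding cross_def by auto
      \<comment> \<open>With two attachments there are only the gaps \<open>K\<close> and
        \<open>V - K\<close>, and \<open>s\<close> lies in the second, so \<open>q\<close> would not
        cross it.\<close>
      have "card q \<noteq> 2"
      proof
        assume "card q = 2"
        then have q: "q = {b', b}" using b b' by (auto simp: card_2_iff)
        have "bd (S \<inter> (V - K)) \<subseteq> bd (V - K)"
          using S(2) unfolding bd_Compl[OF K(1)] K(2) q[symmetric] using K(2) q by (auto simp: bd_def)
        moreover have "bd (V - K) \<subseteq> {b', b}" using bd_Compl[OF K(1)] K(2) by simp
        ultimately have "S \<inter> (V - K) = {} \<or> S \<inter> (V - K) = V - K"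
          using segment_atom[of "V - K" b' b "S \<inter> (V - K)"] by auto
        moreover have "s \<subseteq> V - K" using QQ s K by auto
        ultimately show False using S by blast
      qed
      then have c: "card (q - {b}) < card q" "2 \<le> card (q - {b})"
        using b less.prems(2) fin by (auto intro: psubset_card_mono)
      \<comment> \<open>Dropping \<open>b\<close> joins \<open>K\<close> to the gap that follows it,
        so \<open>K\<close> is moved to the side of \<open>S\<close> on which the edge after
        \<open>b\<close> lies. Since \<open>s\<close> avoids \<open>K\<close>, it is split as
        before.\<close>
      define S' where "S' = (if b \<in> S then S \<union> K else S - K)"
      have bS': "bd S' \<subseteq> q - {b}"
      proof
        fix v assume v: "v \<in> bd S'"
        have pb: "pv b \<in> K" using K in_bd[of b K] by auto
        have "v \<noteq> b" using v pb K(4) by (auto simp: in_bd S'_def split: if_splits)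
        moreover have "v \<in> q"
        proof (rule ccontr)
          assume "v \<notin> q"
          then have "v \<notin> bd K" "v \<notin> bd S" using K(2) b b' S(2) by auto
          then show False using v by (auto simp: in_bd S'_def split: if_splits)
        qed
        ultimately show "v \<in> q - {b}" by auto
      qed
      have S's: "s \<inter> S' = s \<inter> S" using K by (auto simp: S'_def)
      have cr: "cross (q - {b}) s" unfolding cross_def
      proof (intro exI[of _ S'] conjI)
        show "S' \<subseteq> V" using S K by (auto simp: S'_def)
        show "s \<inter> S' \<noteq> {}" "s - S' \<noteq> {}" using S S's by auto
      qed (rule bS')
      have ncr: "\<not> cross (q - {b}) q'" if "q' \<in> QQ" "q' \<noteq> s" for q'
        using less.prems(5)[OF that] unfolding cross_def by blast
      have "\<exists>F. fam (insert (q - {b}) QQ) F"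
        using less.hyps[OF c(1) _ c(2) _ cr ncr] less.prems by auto
      then obtain F' where F': "fam (insert (q - {b}) QQ) F'" by auto
      have "K \<inter> (q \<union> \<Union>QQ) = {b'}" using K QK by auto
      from split_attachment[OF K(1-4) b(1) b'(1) this less.prems(3) _ F']
      show ?thesis using qV QQ by blast
    qed
  qed
qed

end

section \<open>Even edge sets\<close>

definition edge_set :: "'v set set \<Rightarrow> bool" where
  "edge_set F \<longleftrightarrow> finite F \<and> (\<forall>e\<in>F. card e = 2)"

definition odds :: "'v set set \<Rightarrow> 'v set" where
  "odds F = {v. odd (card {e \<in> F. v \<in> e})}"

lemma edge_set_subset: "edge_set F \<Longrightarrow> G \<subseteq> F \<Longrightarrow> edge_set G"
  unfolding edge_set_def using finite_subset by blast

lemma edge_pair: "edge_set F \<Longrightarrow> e \<in> F \<Longrightarrow> \<exists>a b. e = {a, b} \<and> a \<noteq> b"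
  by (auto simp: edge_set_def card_2_iff)

lemma odds_empty [simp]: "odds {} = {}"
  by (simp add: odds_def)

lemma odds_subset: "odds F \<subseteq> \<Union>F"
proof
  fix v assume "v \<in> odds F"
  then have "{e \<in> F. v \<in> e} \<noteq> {}" unfolding odds_def by (metis (mono_tags) card.empty even_zero mem_Collect_eq)
  then show "v \<in> \<Union>F" by auto
qed

lemma odds_sym_diff:
  assumes "finite F" "finite G"
  shows "odds ((F - G) \<union> (G - F)) = (odds F - odds G) \<union> (odds G - odds F)"
proof -
  have "{e \<in> (F - G) \<union> (G - F). v \<in> e} =
      ({e \<in> F. v \<in> e} - {e \<in> G. v \<in> e}) \<union> ({e \<in> G. v \<in> e} - {e \<in> F. v \<in> e})" for v by auto
  then have "v \<in> odds ((F - G) \<union> (G - F)) \<longleftrightarrow> (v \<in> odds F) \<noteq> (v \<in> odds G)" for v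
    unfolding odds_def using assms by (auto simp: even_card_sym_diff)
  then show ?thesis by auto
qed

lemma odds_single: "odds {e} = e"
proof -
  have "{f \<in> {e}. v \<in> f} = (if v \<in> e then {e} else {})" for v by auto
  then show ?thesis by (auto simp: odds_def)
qed

lemma odds_insert:
  assumes "finite F" "e \<notin> F" shows "odds (insert e F) = (odds F - e) \<union> (e - odds F)"
proof -
  have "insert e F = (F - {e}) \<union> ({e} - F)" using assms(2) by auto
  then show ?thesis using odds_sym_diff[OF assms(1), of "{e}"] by (simp add: odds_single)
qed

text \<open>The handshake lemma restricted to \<open>X\<close>: an edge contributes its number of
  ends in \<open>X\<close>, and only a single end matters modulo 2.\<close>

lemma odds_cut:
  assumes "edge_set F"
  shows "even (card (odds F \<inter> X)) \<longleftrightarrow> even (card {e \<in> F. odd (card (e \<inter> X))})"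
proof -
  have "finite F" "\<forall>e\<in>F. card e = 2" using assms by (auto simp: edge_set_def)
  then show ?thesis
  proof (induction F)
    case (insert e F)
    have fin: "finite (odds F)"
      using insert odds_subset[of F] by (metis card.infinite finite_Union finite_subset insertCI zero_neq_numeral)
    have fe: "finite e" using insert by (metis card.infinite insertI1 zero_neq_numeral)
    have "odds (insert e F) \<inter> X = ((odds F \<inter> X) - (e \<inter> X)) \<union> ((e \<inter> X) - (odds F \<inter> X))"
      using odds_insert[OF insert.hyps] by auto
    then have "even (card (odds (insert e F) \<inter> X)) \<longleftrightarrow> (even (card (odds F \<inter> X)) \<longleftrightarrow> even (card (e \<inter> X)))"
      using even_card_sym_diff[of "odds F \<inter> X" "e \<inter> X"] fin fe by simp
    moreover have "{f \<in> insert e F. odd (card (f \<inter> X))} =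
        (if odd (card (e \<inter> X)) then insert e {f \<in> F. odd (card (f \<inter> X))} else {f \<in> F. odd (card (f \<inter> X))})"
      by auto
    moreover have "e \<notin> {f \<in> F. odd (card (f \<inter> X))}" "finite {f \<in> F. odd (card (f \<inter> X))}" using insert.hyps by auto
    ultimately show ?case using insert by auto
  qed simp
qed

lemma even_odds:
  assumes "edge_set F" shows "even (card (odds F))"
proof -
  have none: "{e \<in> F. odd (card (e \<inter> UNIV))} = {}" using assms by (auto simp: edge_set_def)
  have "even (card (odds F \<inter> UNIV))" unfolding odds_cut[OF assms] none by simp
  then show ?thesis by simp
qed

text \<open>The last vertex \<open>r\<close> of the path stays fixed while its other end is extended.\<close>

lemma ex_cycle:
  assumes F: "edge_set F" "F \<noteq> {}" and deg: "\<And>v. v \<noteq> r \<Longrightarrow> card {e \<in> F. v \<in> e} \<noteq> 1"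
  shows "\<exists>C. cycle_graph C \<and> edges C \<subseteq> F \<and> verts C \<subseteq> \<Union>F"
proof -
  have finU: "finite (\<Union>F)" using F unfolding edge_set_def
    by (metis card.infinite finite_Union zero_neq_numeral)
  have "\<exists>r\<in>\<Union>F. \<forall>v. v \<noteq> r \<longrightarrow> card {e \<in> F. v \<in> e} \<noteq> 1"
  \<comment> \<open>If \<open>r\<close> is on no edge, then no vertex at all has degree one, and any
    vertex can serve as the fixed end.\<close>
  proof (cases "r \<in> \<Union>F")
    case False
    then have "{e \<in> F. r \<in> e} = {}" by auto
    then have "card {e \<in> F. v \<in> e} \<noteq> 1" for v using deg[of v] by (metis card.empty zero_neq_one)
    moreover obtain e where e: "e \<in> F" "card e = 2" using F by (auto simp: edge_set_def)
    moreover from e have "e \<noteq> {}" by auto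
    ultimately show ?thesis by blast
  qed (use deg in auto)
  then obtain r where r: "r \<in> \<Union>F" "\<And>v. v \<noteq> r \<Longrightarrow> card {e \<in> F. v \<in> e} \<noteq> 1" by auto
  define path where "path xs \<longleftrightarrow> xs \<noteq> [] \<and> distinct xs \<and> last xs = r \<and> set xs \<subseteq> \<Union>F \<and>
      (\<forall>i. Suc i < length xs \<longrightarrow> {xs ! i, xs ! Suc i} \<in> F)" for xs
  have ext: "path (w # xs)" if "path xs" "{w, hd xs} \<in> F" "w \<notin> set xs" for w xs
  proof -
    have "{(w # xs) ! i, (w # xs) ! Suc i} \<in> F" if "Suc i < length (w # xs)" for i
      using that \<open>path xs\<close> \<open>{w, hd xs} \<in> F\<close> by (cases i) (auto simp: path_def hd_conv_nth)
    then show ?thesis using that unfolding path_def by auto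
  qed
  have len: "length xs \<le> card (\<Union>F)" if "path xs" for xs
    using that finU card_mono distinct_card unfolding path_def by metis
  have "path [r]" using r by (auto simp: path_def)
  then obtain xs where xs: "path xs" and max: "\<And>ys. path ys \<Longrightarrow> length ys \<le> length xs"
    using ex_has_greatest_nat[of path "[r]" length "Suc (card (\<Union>F))"] len by (metis le_imp_less_Suc)
  have "\<exists>w. {w, r} \<in> F \<and> w \<noteq> r"
  proof -
    obtain e where "e \<in> F" "r \<in> e" using r by auto
    moreover then obtain a b where "e = {a, b}" "a \<noteq> b" using edge_pair[OF F(1)] by blast
    ultimately show ?thesis by (metis insert_commute insertE singletonD)
  qed
  then obtain w where "{w, r} \<in> F" "w \<noteq> r" by auto
  then have "path [w, r]" using ext[OF \<open>path [r]\<close>] by auto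
  then have l2: "2 \<le> length xs" using max by fastforce
  define h where "h = xs ! 0"
  have hd: "hd xs = h" using l2 by (simp add: h_def hd_conv_nth length_greater_0_conv[symmetric] del: length_greater_0_conv)
  have "h \<noteq> r"
  proof -
    have "xs ! 0 \<noteq> xs ! (length xs - 1)" using xs l2 by (simp add: path_def nth_eq_iff_index_eq)
    moreover have "xs \<noteq> []" "last xs = r" using xs by (auto simp: path_def)
    ultimately show ?thesis using last_conv_nth[of xs] by (simp add: h_def)
  qed
  have e1: "{h, xs ! 1} \<in> {e \<in> F. h \<in> e}" using xs l2 unfolding path_def h_def by auto
  have "{e \<in> F. h \<in> e} \<noteq> {{h, xs ! 1}}" using r(2)[OF \<open>h \<noteq> r\<close>] by (metis is_singletonI is_singleton_altdef)
  then obtain e where e: "e \<in> F" "h \<in> e" "e \<noteq> {h, xs ! 1}" using e1 by auto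
  obtain a b where "e = {a, b}" "a \<noteq> b" using edge_pair[OF F(1) e(1)] by blast
  then obtain w where w: "e = {w, h}" "w \<noteq> h" using e(2) by (metis insert_commute insertE singletonD)
  \<comment> \<open>As the path is longest, the second edge at its free end \<open>h\<close> leads
    back to it, to an index of at least 2 because the edge is not the first edge of the
    path.\<close>
  have "w \<in> set xs" using max[OF ext[OF xs, of w]] e w hd by fastforce
  then obtain j where j: "j < length xs" "xs ! j = w" by (auto simp: in_set_conv_nth)
  have j2: "2 \<le> j"
  proof -
    have "j \<noteq> 0" "j \<noteq> 1" using j w e(3) by (auto simp: h_def insert_commute)
    then show ?thesis by simp
  qed
  let ?ys = "take (Suc j) xs"
  have ly: "length ?ys = Suc j" using j by simp
  let ?E = "{{?ys ! i, ?ys ! (Suc i mod length ?ys)} | i. i < length ?ys}"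
  have "cycle_graph (Graph (set ?ys) ?E)" unfolding cycle_graph_def
    by (intro exI[of _ ?ys]) (use j2 ly xs path_def in auto)
  moreover have "?E \<subseteq> F"
  proof
    fix f assume "f \<in> ?E"
    then obtain i where i: "i < Suc j" "f = {?ys ! i, ?ys ! (Suc i mod Suc j)}" using ly by auto
    show "f \<in> F"
    proof (cases "i = j")
      case True
      then show ?thesis using i j e w by (simp add: h_def)
    next
      case False
      then have "Suc i mod Suc j = Suc i" using i by simp
      then have "f = {xs ! i, xs ! Suc i}" using i False by simp
      then show ?thesis using xs i j False unfolding path_def by auto
    qed
  qed
  moreover have "set ?ys \<subseteq> \<Union>F" using xs set_take_subset[of "Suc j" xs] unfolding path_def by auto
  ultimately show ?thesis by (intro exI[of _ "Graph (set ?ys) ?E"]) simp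
qed

section \<open>Trees\<close>

lemma simple_edge_set: "simple_graph T \<Longrightarrow> edge_set (edges T)"
  unfolding simple_graph_def edge_set_def by (meson Pow_iff finite_Pow_iff finite_subset subsetI)

lemma tree_edge_set: "tree_graph T \<Longrightarrow> edge_set (edges T)"
  using simple_edge_set tree_graph_def by blast

text \<open>One vertex \<open>r\<close> may be excluded, since \<open>ex_cycle\<close> tolerates one
  vertex of degree one. This yields a second leaf and, in a part hanging at one vertex, a leaf other
  than that vertex.\<close>

lemma tree_no_cycle:
  assumes T: "tree_graph T" and F: "F \<subseteq> edges T" "F \<noteq> {}"
  shows "\<exists>v. v \<noteq> r \<and> card {e \<in> F. v \<in> e} = 1"
proof (rule ccontr)
  assume "\<not> ?thesis"
  then obtain C where C: "cycle_graph C" "edges C \<subseteq> F" "verts C \<subseteq> \<Union>F"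
    using ex_cycle[of F r] edge_set_subset[OF tree_edge_set[OF T] F(1)] F(2) by metis
  have s: "simple_graph T" using T by (simp add: tree_graph_def)
  obtain xs where xs: "length xs \<ge> 3" "distinct xs" "verts C = set xs"
     "edges C = {{xs ! i, xs ! (Suc i mod length xs)} | i. i < length xs}"
    using C(1) unfolding cycle_graph_def by auto
  have "e \<subseteq> verts C" if e: "e \<in> edges C" for e
  proof -
    obtain i where i: "i < length xs" "e = {xs ! i, xs ! (Suc i mod length xs)}" using e xs by auto
    have "Suc i mod length xs < length xs" using i by (intro mod_less_divisor) linarith
    then show ?thesis using i xs by auto
  qed
  note eC = this
  have CT: "edges C \<subseteq> edges T" using C(2) F(1) by (rule subset_trans)
  have "\<Union>F \<subseteq> verts T" using F s by (auto simp: simple_graph_def)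
  then have vC: "verts C \<subseteq> verts T" using C(3) by simp
  then have "finite (verts C)" using s finite_subset by (auto simp: simple_graph_def)
  moreover have "\<forall>e\<in>edges C. card e = 2" using CT s by (auto simp: simple_graph_def)
  ultimately have "subgraph C T" using eC CT vC by (auto simp: subgraph_def simple_graph_def)
  then show False using T C unfolding tree_graph_def by auto
qed

lemma tree_even_empty:
  assumes "tree_graph T" "F \<subseteq> edges T" "odds F = {}" shows "F = {}"
proof (rule ccontr)
  assume "F \<noteq> {}"
  then obtain v where "card {e \<in> F. v \<in> e} = 1" using tree_no_cycle[OF assms(1,2)] by blast
  then have "v \<in> odds F" by (simp add: odds_def)
  then show False using assms by simp
qed

text \<open>The edges of a walk are added modulo 2, so no path has to be extracted; the odd vertices
  telescope to the two ends.\<close>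

lemma rtrancl_join:
  assumes "(x, y) \<in> {(x, y). {x, y} \<in> F}\<^sup>*" "finite F"
  shows "\<exists>J\<subseteq>F. odds J = ({x} - {y}) \<union> ({y} - {x})"
  using assms(1)
proof (induction rule: rtrancl_induct)
  case base
  then show ?case by (intro exI[of _ "{}"]) auto
next
  case (step y z)
  then obtain J where J: "J \<subseteq> F" "odds J = ({x} - {y}) \<union> ({y} - {x})" by auto
  show ?case
  proof (cases "y = z")
    case False
    let ?K = "(J - {{y, z}}) \<union> ({{y, z}} - J)"
    have "finite J" using J assms(2) finite_subset by auto
    then have "odds ?K = (odds J - {y, z}) \<union> ({y, z} - odds J)"
      using odds_sym_diff[of J "{{y, z}}"] by (simp add: odds_single)
    then have "odds ?K = ({x} - {z}) \<union> ({z} - {x})" using J(2) False by auto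
    moreover have "?K \<subseteq> F" using J step.hyps(2) by auto
    ultimately show ?thesis by blast
  qed (use J in auto)
qed

lemma tree_join:
  assumes "tree_graph T" "x \<in> verts T" "y \<in> verts T"
  shows "\<exists>J\<subseteq>edges T. odds J = ({x} - {y}) \<union> ({y} - {x})"
  using assms rtrancl_join[of x y "edges T"] tree_edge_set[OF assms(1)]
  unfolding tree_graph_def connected_graph_def edge_set_def by blast

lemma tree_join_pair:
  assumes "tree_graph T" "P \<subseteq> verts T" "card P \<in> {0, 2}" "finite P"
  shows "\<exists>J\<subseteq>edges T. odds J = P"
proof (cases "card P = 0")
  case False
  then obtain x y where P: "P = {x, y}" "x \<noteq> y" using assms by (auto simp: card_2_iff)
  then have "({x} - {y}) \<union> ({y} - {x}) = P" by auto
  then show ?thesis using tree_join[OF assms(1), of x y] P assms(2) by auto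
qed (use assms in \<open>auto intro!: exI[of _ "{}"]\<close>)

lemma tree_leaves:
  assumes T: "tree_graph T" and "edges T \<noteq> {}" shows "2 \<le> card (leaves T)"
proof (rule ccontr)
  assume less: "\<not> ?thesis"
  have "finite (leaves T)" using T unfolding tree_graph_def simple_graph_def leaves_def by auto
  then obtain r where r: "leaves T \<subseteq> {r}"
    using less by (metis card_le_Suc0_iff_eq One_nat_def Suc_1 Suc_leI not_less_eq_eq subsetI singletonI empty_subsetI all_not_in_conv)
  obtain v where v: "v \<noteq> r" "card {e \<in> edges T. v \<in> e} = 1"
    using tree_no_cycle[OF T order.refl assms(2), of r] by auto
  then have "{e \<in> edges T. v \<in> e} \<noteq> {}" by (metis card.empty zero_neq_one)
  then have "v \<in> verts T" using T unfolding tree_graph_def simple_graph_def by auto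
  then show False using v r by (auto simp: leaves_def)
qed

text \<open>Here \<open>X\<close> is one side of \<open>f\<close>, and \<open>J\<close> is typically the path between the two
  vertices in \<open>odds J\<close>.\<close>

lemma tree_side:
  assumes T: "tree_graph T" and f: "f \<in> edges T"
  shows "\<exists>X. X \<inter> leaves T \<noteq> {} \<and> leaves T - X \<noteq> {} \<and>
     (\<forall>J\<subseteq>edges T. f \<in> J \<longleftrightarrow> odd (card (odds J \<inter> X)))"
proof -
  note es = tree_edge_set[OF T]
  have sub: "e \<subseteq> verts T" if "e \<in> edges T" for e using T that unfolding tree_graph_def simple_graph_def by auto
  obtain x y where xy: "f = {x, y}" "x \<noteq> y" using f es by (auto simp: edge_set_def card_2_iff)
  let ?F = "edges T - {f}"
  define X where "X = {v. (x, v) \<in> {(u, v). {u, v} \<in> ?F}\<^sup>*}"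
  have "x \<in> X" by (simp add: X_def)
  have y: "y \<notin> X"
  proof
    assume "y \<in> X"
    then obtain J where J: "J \<subseteq> ?F" "odds J = ({x} - {y}) \<union> ({y} - {x})"
      using rtrancl_join[of x y ?F] es by (auto simp: X_def edge_set_def)
    have "finite J" using J es by (auto simp: edge_set_def intro: finite_subset)
    moreover have "f \<notin> J" using J by auto
    ultimately have "odds (insert f J) = {}" using odds_insert[of J f] J(2) xy by auto
    then show False using tree_even_empty[OF T, of "insert f J"] J f by auto
  qed
  have closed: "v \<in> X" if "u \<in> X" "{u, v} \<in> ?F" for u v
    using that unfolding X_def by (auto intro: rtrancl_into_rtrancl)
  have crossing: "odd (card (e \<inter> X)) \<longleftrightarrow> e = f" if e: "e \<in> edges T" for e
  proof (cases "e = f")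
    case True
    then have "e \<inter> X = {x}" using \<open>x \<in> X\<close> y xy by auto
    then show ?thesis using True by simp
  next
    case False
    obtain u v where uv: "e = {u, v}" "u \<noteq> v" using e es by (auto simp: edge_set_def card_2_iff)
    then have "u \<in> X \<longleftrightarrow> v \<in> X" using closed[of u v] closed[of v u] e False by (auto simp: insert_commute)
    then have "e \<inter> X = {} \<or> e \<inter> X = {u, v}" using uv by auto
    then have "card (e \<inter> X) = 0 \<or> card (e \<inter> X) = 2" using uv(2) by (elim disjE) simp_all
    then show ?thesis using False by auto
  qed
  \<comment> \<open>On the side \<open>A\<close> of \<open>f\<close>, a vertex of degree one other
    than the end \<open>z\<close> of \<open>f\<close> is a leaf of the whole tree; if there is no
    edge on this side, \<open>z\<close> itself is a leaf.\<close>
  have leaf: "\<exists>l\<in>leaves T. l \<in> A" if A: "A \<inter> f = {z}" and cl: "\<And>e. e \<in> ?F \<Longrightarrow> e \<subseteq> A \<or> e \<inter> A = {}" for A z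
  proof (cases "{e \<in> ?F. e \<subseteq> A} = {}")
    case True
    have "e = f" if "e \<in> edges T" "z \<in> e" for e
    proof (rule ccontr)
      assume "e \<noteq> f"
      then have "e \<subseteq> A" using cl[of e] that A by auto
      then show False using True that \<open>e \<noteq> f\<close> by auto
    qed
    then have "{e \<in> edges T. z \<in> e} = {f}" using f A by auto
    then show ?thesis using A sub[OF f] by (intro bexI[of _ z]) (auto simp: leaves_def)
  next
    case False
    have "{e \<in> ?F. e \<subseteq> A} \<subseteq> edges T" by auto
    from tree_no_cycle[OF T this False, of z]
    obtain v where v: "v \<noteq> z" "card {e \<in> {e \<in> ?F. e \<subseteq> A}. v \<in> e} = 1" by auto
    then have "{e \<in> {e \<in> ?F. e \<subseteq> A}. v \<in> e} \<noteq> {}" by (metis card.empty zero_neq_one)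
    then have vA: "v \<in> A" "v \<in> verts T" using sub by auto
    then have "v \<notin> f" using A v by auto
    then have "{e \<in> edges T. v \<in> e} = {e \<in> {e \<in> ?F. e \<subseteq> A}. v \<in> e}" using vA cl by fastforce
    then show ?thesis using v vA by (intro bexI[of _ v]) (auto simp: leaves_def)
  qed
  have cl: "e \<subseteq> X \<or> e \<inter> X = {}" if "e \<in> ?F" for e
  proof -
    obtain u v where uv: "e = {u, v}" "u \<noteq> v" using edge_pair[OF es, of e] \<open>e \<in> ?F\<close> by blast
    then show ?thesis using closed[of u v] closed[of v u] that by (auto simp: insert_commute)
  qed
  have "X \<inter> leaves T \<noteq> {}" using leaf[of X x] cl xy \<open>x \<in> X\<close> y by auto
  moreover have "leaves T - X \<noteq> {}" using leaf[of "- X" y] cl xy \<open>x \<in> X\<close> y by blast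
  moreover have "f \<in> J \<longleftrightarrow> odd (card (odds J \<inter> X))" if J: "J \<subseteq> edges T" for J
  proof -
    have "{e \<in> J. odd (card (e \<inter> X))} = (if f \<in> J then {f} else {})" using crossing J by auto
    then show ?thesis using odds_cut[OF edge_set_subset[OF es J], of X] by (auto split: if_splits)
  qed
  ultimately show ?thesis by blast
qed

text \<open>Induction by adding leaves: a maximal connected part with property \<open>P\<close>
  could be extended by a neighbouring vertex, which has only one neighbour in the part because two
  would close an even edge set.\<close>

lemma tree_grow:
  assumes T: "tree_graph H" and single: "\<And>v. v \<in> verts H \<Longrightarrow> P {v}"
    and step: "\<And>S u s. \<lbrakk>S \<subseteq> verts H; P S; u \<in> verts H; u \<notin> S; s \<in> S; {u, s} \<in> edges H;
        \<And>s'. s' \<in> S \<Longrightarrow> s' \<noteq> s \<Longrightarrow> {u, s'} \<notin> edges H\<rbrakk> \<Longrightarrow> P (insert u S)"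
  shows "P (verts H)"
proof -
  note es = tree_edge_set[OF T]
  have fin: "finite (verts H)" and ne: "verts H \<noteq> {}"
    using T unfolding tree_graph_def simple_graph_def connected_graph_def by auto
  let ?E = "\<lambda>S. {e \<in> edges H. e \<subseteq> S}"
  have finE: "finite (?E S)" for S using es by (auto simp: edge_set_def)
  define ok where "ok S \<longleftrightarrow> S \<subseteq> verts H \<and> S \<noteq> {} \<and> P S \<and>
      (\<forall>x\<in>S. \<forall>y\<in>S. (x, y) \<in> {(x, y). {x, y} \<in> ?E S}\<^sup>*)" for S
  obtain v where "v \<in> verts H" using ne by auto
  then have "ok {v}" using single by (auto simp: ok_def)
  moreover have "finite {S. ok S}" using fin by (rule rev_finite_subset[OF finite_Pow_iff[THEN iffD2]]) (auto simp: ok_def)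
  ultimately obtain S where S: "ok S" and max: "\<And>S'. ok S' \<Longrightarrow> S \<subseteq> S' \<Longrightarrow> S' = S"
    using finite_has_maximal[of "{S. ok S}"] by (metis (mono_tags, lifting) empty_iff mem_Collect_eq)
  have "S = verts H"
  proof (rule ccontr)
    assume "S \<noteq> verts H"
    then obtain y where y: "y \<in> verts H" "y \<notin> S" using S by (auto simp: ok_def)
    obtain x where x: "x \<in> S" "x \<in> verts H" using S by (auto simp: ok_def)
    have "(x, y) \<in> {(x, y). {x, y} \<in> edges H}\<^sup>*"
      using T x y unfolding tree_graph_def connected_graph_def by auto
    then have "\<exists>s u. s \<in> S \<and> u \<notin> S \<and> {s, u} \<in> edges H"
      using y(2)
    proof (induction rule: rtrancl_induct)
      case base then show ?case using x by simp
    next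
      case (step a b) then show ?case by (cases "a \<in> S") auto
    qed
    then obtain s u where su: "s \<in> S" "u \<notin> S" "{s, u} \<in> edges H" by auto
    have uH: "u \<in> verts H" using su T unfolding tree_graph_def simple_graph_def by auto
    have uniq: "{u, s'} \<notin> edges H" if s': "s' \<in> S" "s' \<noteq> s" for s'
    proof
      assume e: "{u, s'} \<in> edges H"
      obtain J where J: "J \<subseteq> ?E S" "odds J = ({s} - {s'}) \<union> ({s'} - {s})"
        using rtrancl_join[OF _ finE, of s s' S] S s' su by (auto simp: ok_def)
      have finJ: "finite J" using J finE finite_subset by blast
      have nJ: "{u, s} \<notin> J" "{u, s'} \<notin> insert {u, s} J" using J su s' by (auto simp: doubleton_eq_iff)
      have "odds (insert {u, s} J) = {u, s'}"
        using odds_insert[OF finJ nJ(1)] J(2) s' su by auto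
      then have "odds (insert {u, s'} (insert {u, s} J)) = {}"
        using odds_insert[OF _ nJ(2)] finJ by auto
      moreover have "insert {u, s'} (insert {u, s} J) \<subseteq> edges H"
        using J e su by (auto simp: insert_commute)
      ultimately show False using tree_even_empty[OF T] by blast
    qed
    have "P (insert u S)"
      using S su uH uniq by (intro step) (auto simp: ok_def insert_commute)
    moreover have "(a, b) \<in> {(x, y). {x, y} \<in> ?E (insert u S)}\<^sup>*" if "a \<in> insert u S" "b \<in> insert u S" for a b
    proof -
      let ?R = "{(x, y). {x, y} \<in> ?E (insert u S)}"
      have mono: "(a, b) \<in> ?R\<^sup>*" if "a \<in> S" "b \<in> S" for a b
      proof -
        have "(a, b) \<in> {(x, y). {x, y} \<in> ?E S}\<^sup>*" using S that by (auto simp: ok_def)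
        then show ?thesis by (rule rtrancl_mono[THEN subsetD, rotated]) auto
      qed
      have us: "(u, s) \<in> ?R" "(s, u) \<in> ?R" using su by (auto simp: insert_commute)
      have "(a, s) \<in> ?R\<^sup>*" "(s, b) \<in> ?R\<^sup>*" using that mono su us by (auto intro: r_into_rtrancl)
      then show ?thesis by (rule rtrancl_trans)
    qed
    ultimately have "ok (insert u S)" using S uH by (auto simp: ok_def)
    then show False using max su by blast
  qed
  then show ?thesis using S by (auto simp: ok_def)
qed

section \<open>Overlap on a cycle graph\<close>

locale long_cyclic = cyclic +
  assumes three: "3 \<le> card V"
begin

definition ed :: "'a \<Rightarrow> 'a set" where "ed v = {v, nx v}"

lemma nx_neq: "v \<in> V \<Longrightarrow> nx v \<noteq> v"
proof
  assume v: "v \<in> V" "nx v = v"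
  then have "{v} = V" by (intro one_orbit) auto
  then have "card V = 1" by (metis card_1_singleton_iff One_nat_def)
  then show False using three by simp
qed

lemma nx_nx_neq: "v \<in> V \<Longrightarrow> nx (nx v) \<noteq> v"
proof
  assume v: "v \<in> V" "nx (nx v) = v"
  then have "{v, nx v} = V" by (intro one_orbit) auto
  then have "card V \<le> 2" by (metis card_2_iff nx_neq order.refl v(1))
  then show False using three by simp
qed

lemma in_ed: "w \<in> ed v \<longleftrightarrow> w = v \<or> pv w = v"
  unfolding ed_def by (metis insert_iff nx_pv pv_nx singletonD)

lemma ed_inj: "u \<in> V \<Longrightarrow> v \<in> V \<Longrightarrow> ed u = ed v \<longleftrightarrow> u = v"
  unfolding ed_def using nx_nx_neq by (auto simp: doubleton_eq_iff)

lemma ed_image: "E \<subseteq> V \<Longrightarrow> v \<in> V \<Longrightarrow> ed v \<in> ed ` E \<longleftrightarrow> v \<in> E"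
  using ed_inj by blast

lemma edge_set_ed: "E \<subseteq> V \<Longrightarrow> edge_set (ed ` E)"
  using finV nx_neq unfolding edge_set_def ed_def by (auto intro: finite_subset simp: card_2_iff)

lemma odds_ed:
  assumes "E \<subseteq> V" shows "odds (ed ` E) = bd E"
proof -
  have "odd (card {e \<in> ed ` E. w \<in> e}) \<longleftrightarrow> w \<in> bd E" for w
  proof -
    have "{e \<in> ed ` E. w \<in> e} = ed ` (E \<inter> {w, pv w})" by (auto simp: in_ed)
    moreover have "inj_on ed (E \<inter> {w, pv w})" using ed_inj assms by (auto simp: inj_on_def)
    ultimately have c: "card {e \<in> ed ` E. w \<in> e} = card (E \<inter> {w, pv w})" by (simp add: card_image)
    show ?thesis
    proof (cases "w \<in> V")
      case True
      then have "w \<noteq> pv w" using nx_neq by (metis nx_pv)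
      then have "odd (card ({w, pv w} \<inter> E)) \<longleftrightarrow> (w \<in> E) \<noteq> (pv w \<in> E)" by (rule odd_card_pair)
      then show ?thesis unfolding c by (simp add: in_bd Int_commute)
    next
      case False
      then have "w \<notin> E" "pv w \<notin> E" using assms by auto
      then show ?thesis unfolding c by (simp add: in_bd)
    qed
  qed
  then show ?thesis by (auto simp: odds_def)
qed

text \<open>\<open>R\<close> lists the tails of the edges, so the path has one more vertex, the
  final head \<open>c\<close>.\<close>

lemma segment_path:
  assumes "R \<subseteq> V" "bd R = {a, c}" "a \<in> R" "c \<notin> R"
  shows "path_graph (Graph (insert c R) (ed ` R))"
proof -
  have "\<exists>xs. xs \<noteq> [] \<and> distinct xs \<and> set xs = insert c R \<and> hd xs = a \<and>
      {{xs ! i, xs ! Suc i} | i. Suc i < length xs} = ed ` R"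
    using assms
  proof (induction "card R" arbitrary: R a)
    case 0
    then show ?case using finite_subset[OF _ finV] by auto
  next
    case (Suc m)
    have pva: "pv a \<notin> R" using Suc.prems(2,3) in_bd[of a R] by auto
    have pvc: "pv c \<in> R" using Suc.prems(2,4) in_bd[of c R] by auto
    have step: "nx v \<in> R" if "v \<in> R" "nx v \<noteq> c" for v
    proof -
      have "nx v \<noteq> a" using that pva by auto
      then have "nx v \<notin> bd R" using that Suc.prems(2) by auto
      then show ?thesis using that by (simp add: in_bd)
    qed
    have tl: "\<exists>ys. ys \<noteq> [] \<and> distinct ys \<and> set ys = insert c (R - {a}) \<and> hd ys = nx a \<and>
      {{ys ! i, ys ! Suc i} | i. Suc i < length ys} = ed ` (R - {a})"
    proof (cases "nx a = c")
      case True
      have "{v \<in> R. v \<noteq> a} = {}"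
      proof (rule ccontr)
        assume ne: "{v \<in> R. v \<noteq> a} \<noteq> {}"
        have "{v \<in> R. v \<noteq> a} = V"
        proof (rule one_orbit[OF _ ne])
          show "nx v \<in> {v \<in> R. v \<noteq> a}" if "v \<in> {v \<in> R. v \<noteq> a}" for v
            using that step[of v] True pva by auto
        qed (use Suc.prems in auto)
        then show False using Suc.prems by auto
      qed
      then have "R - {a} = {}" by auto
      then show ?thesis using True by (intro exI[of _ "[c]"]) auto
    next
      case False
      have na: "nx a \<in> R" "nx a \<noteq> a" using step False Suc.prems nx_neq by auto
      have "bd (R - {a}) = {nx a, c}"
      proof -
        have "v \<in> bd (R - {a}) \<longleftrightarrow> v \<in> {nx a, c}" for v
        proof -
          consider "v = a" | "v = nx a" | "v = c" "v \<noteq> nx a" "v \<noteq> a" | "v \<noteq> a" "v \<noteq> nx a" "v \<noteq> c" by blast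
          then show ?thesis
          proof cases
            case 1
            then show ?thesis using pva na Suc.prems(3,4) by (auto simp: in_bd)
          next
            case 2
            then show ?thesis using na by (auto simp: in_bd)
          next
            case 3
            then have "pv c \<noteq> a" by (metis nx_pv)
            then show ?thesis using 3 pvc Suc.prems(4) by (auto simp: in_bd)
          next
            case 4
            then have "pv v \<noteq> a" by (metis nx_pv)
            moreover have "v \<notin> bd R" using 4 Suc.prems(2) by simp
            ultimately show ?thesis using 4 by (auto simp: in_bd)
          qed
        qed
        then show ?thesis by auto
      qed
      moreover have "m = card (R - {a})" using Suc.hyps(2) Suc.prems(3) by simp
      ultimately show ?thesis using Suc.hyps(1)[of "R - {a}" "nx a"] Suc.prems na by auto
    qed
    then obtain ys where ys: "ys \<noteq> []" "distinct ys" "set ys = insert c (R - {a})" "hd ys = nx a"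
      "{{ys ! i, ys ! Suc i} | i. Suc i < length ys} = ed ` (R - {a})" by blast
    have "{{(a # ys) ! i, (a # ys) ! Suc i} | i. Suc i < length (a # ys)} =
        insert {a, ys ! 0} {{ys ! i, ys ! Suc i} | i. Suc i < length ys}" (is "?A = ?B")
    proof
      show "?A \<subseteq> ?B"
      proof
        fix e assume "e \<in> ?A"
        then obtain i where "i < length ys" "e = {(a # ys) ! i, ys ! i}" by auto
        then show "e \<in> ?B" by (cases i) auto
      qed
      show "?B \<subseteq> ?A"
      proof
        fix e assume "e \<in> ?B"
        then consider "e = {a, ys ! 0}" | i where "Suc i < length ys" "e = {ys ! i, ys ! Suc i}" by auto
        then show "e \<in> ?A"
        proof cases
          case 1
          then show ?thesis using ys(1) by (auto intro!: exI[of _ 0])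
        next
          case 2
          then show ?thesis by (auto intro!: exI[of _ "Suc i"])
        qed
      qed
    qed
    moreover have "insert {a, ys ! 0} (ed ` (R - {a})) = ed ` R"
      using Suc.prems(3) ys(1,4) by (auto simp: ed_def hd_conv_nth)
    moreover have "a \<notin> set ys" using ys(3) Suc.prems by auto
    ultimately show ?case using ys Suc.prems(3) by (intro exI[of _ "a # ys"]) auto
  qed
  then obtain xs where "xs \<noteq> []" "distinct xs" "set xs = insert c R"
    "{{xs ! i, xs ! Suc i} | i. Suc i < length xs} = ed ` R" by blast
  then show ?thesis unfolding path_graph_def by (intro exI[of _ xs]) simp
qed

section \<open>Overlap of bridges as crossing of attachment sets\<close>

context
  fixes L :: "'a graph" and X Y :: "'a set"
  assumes L: "verts L = V" "edges L = ed ` V"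
    and X: "X \<subseteq> V" "2 \<le> card X" and Y: "Y \<subseteq> V" "2 \<le> card Y" and XY: "X \<inter> Y = {}"
begin

text \<open>The gap of \<open>X\<close> that contains one vertex of \<open>Y\<close> contains them
  all; this gap and the complementary arc are the two paths.\<close>

lemma split_if_not_cross:
  assumes "\<not> cross X Y"
  shows "\<exists>L1 L2. path_graph L1 \<and> path_graph L2 \<and> verts L1 \<union> verts L2 = verts L \<and>
     edges L1 \<union> edges L2 = edges L \<and> edges L1 \<inter> edges L2 = {} \<and> X \<subseteq> verts L1 \<and> Y \<subseteq> verts L2"
proof -
  obtain y where y: "y \<in> Y" using Y(2) by fastforce
  have "X \<noteq> {}" using X(2) by auto
  obtain b where b: "b \<in> X" "y \<in> gap X b" using gap_cover[OF X(1) \<open>X \<noteq> {}\<close>, of y] y Y by auto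
  have "X \<noteq> {b}" using X(2) by auto
  then obtain a where a: "a \<in> X" "a \<noteq> b" using b by auto
  define R c where "R = gap X b" and "c = nxt X b"
  have R: "R \<subseteq> V" "bd R = {b, c}" "b \<in> R" "R \<inter> X = {b}" "c \<noteq> b" "c \<in> X"
    using gap_subset X(1) b bd_gap[OF X(1) b(1) a] gap.start gap_Int[OF b(1)] nxt[OF X(1) b(1)] nxt_neq[OF X(1) b(1) a]
    unfolding R_def c_def by auto
  then have c: "c \<notin> R" "c \<in> V" using X by auto
  let ?L1 = "Graph (insert b (V - R)) (ed ` (V - R))" and ?L2 = "Graph (insert c R) (ed ` R)"
  have "path_graph ?L2" by (rule segment_path[OF R(1-3) c(1)])
  moreover have "Y \<subseteq> R" using assms R b y X unfolding cross_def R_def by blast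
  moreover have "path_graph ?L1"
    using R c bd_Compl[OF R(1)] by (intro segment_path[of _ c b]) auto
  moreover have "ed ` (V - R) \<inter> ed ` R = {}" "ed ` (V - R) \<union> ed ` R = ed ` V"
    using ed_inj R(1) by blast+
  moreover have "insert b (V - R) \<union> insert c R = V" "X \<subseteq> insert b (V - R)" using R c X by auto
  ultimately have "path_graph ?L1 \<and> path_graph ?L2 \<and> verts ?L1 \<union> verts ?L2 = verts L \<and>
     edges ?L1 \<union> edges ?L2 = edges L \<and> edges ?L1 \<inter> edges ?L2 = {} \<and> X \<subseteq> verts ?L1 \<and> Y \<subseteq> verts ?L2"
    unfolding L graph.sel by blast
  then show ?thesis by blast
qed

lemma path_vertex_edge:
  assumes "distinct ys" "2 \<le> length ys" "i < length ys"
  shows "\<exists>j. Suc j < length ys \<and> ys ! i \<in> {ys ! j, ys ! Suc j}"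
  using assms by (cases i) (auto intro: exI[of _ 0])

text \<open>An inner vertex of \<open>L2\<close> has both its cycle edges on \<open>L2\<close>,
  whereas a vertex of \<open>X\<close> has an edge on \<open>L1\<close>. So \<open>L2\<close> passes
  no end of a region bounded by \<open>X\<close>, and all its edges, hence all of \<open>Y\<close>,
  are on one side.\<close>

lemma not_cross_if_split:
  assumes "path_graph L1" "path_graph L2" "edges L1 \<union> edges L2 = edges L" "edges L1 \<inter> edges L2 = {}"
    and XL: "X \<subseteq> verts L1" and YL: "Y \<subseteq> verts L2"
  shows "\<not> cross X Y"
proof
  assume "cross X Y"
  then obtain R where R: "R \<subseteq> V" "bd R \<subseteq> X" "Y \<inter> R \<noteq> {}" "Y - R \<noteq> {}" unfolding cross_def by auto
  obtain xs where xs: "distinct xs" "verts L1 = set xs" "edges L1 = {{xs ! i, xs ! Suc i} | i. Suc i < length xs}"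
    using assms(1) unfolding path_graph_def by auto
  obtain ys where ys: "distinct ys" "verts L2 = set ys" "edges L2 = {{ys ! i, ys ! Suc i} | i. Suc i < length ys}"
    using assms(2) unfolding path_graph_def by auto
  have "card X \<le> length xs" "card Y \<le> length ys"
    using card_mono[OF _ XL] card_mono[OF _ YL] xs ys card_length le_trans by (metis List.finite_set)+
  then have l2: "2 \<le> length xs" "2 \<le> length ys" using X Y by auto
  have tail: "\<exists>v\<in>V. {ys ! i, ys ! Suc i} = ed v" if "Suc i < length ys" for i
  proof -
    have "{ys ! i, ys ! Suc i} \<in> edges L" using that ys assms(3) by blast
    then show ?thesis using L by auto
  qed
  \<comment> \<open>\<open>t i\<close> is the tail of an edge of \<open>L2\<close> with respect to
    \<open>nx\<close>; the path may run in either direction, which explains the two alternatives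
    below.\<close>
  then obtain t where t: "\<And>i. Suc i < length ys \<Longrightarrow> t i \<in> V" "\<And>i. Suc i < length ys \<Longrightarrow> {ys ! i, ys ! Suc i} = ed (t i)"
    by metis
  have tw: "t i = w \<or> t i = pv w" if "Suc i < length ys" "w \<in> {ys ! i, ys ! Suc i}" for i w
    using that t(2)[OF that(1)] in_ed[of w "t i"] by auto
  have same: "t (Suc i) \<in> R \<longleftrightarrow> t i \<in> R" if i: "Suc (Suc i) < length ys" for i
  proof -
    let ?w = "ys ! Suc i"
    have ne: "t i \<noteq> t (Suc i)"
    proof
      assume "t i = t (Suc i)"
      then have "{ys ! i, ?w} = {?w, ys ! Suc (Suc i)}" using t(2)[of i] t(2)[of "Suc i"] i by simp
      then have "ys ! i = ys ! Suc (Suc i)" by (auto simp: doubleton_eq_iff)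
      then show False using nth_eq_iff_index_eq[OF ys(1), of i "Suc (Suc i)"] i by simp
    qed
    have tws: "t i = ?w \<or> t i = pv ?w" "t (Suc i) = ?w \<or> t (Suc i) = pv ?w"
      using tw[of i ?w] tw[of "Suc i" ?w] i by auto
    have both: "ed ?w \<in> edges L2" "ed (pv ?w) \<in> edges L2"
    proof -
      have "ed (t i) \<in> edges L2" using ys(3) t(2)[of i, symmetric] i by auto
      moreover have "ed (t (Suc i)) \<in> edges L2" using ys(3) t(2)[of "Suc i", symmetric] i by blast
      ultimately show "ed ?w \<in> edges L2" "ed (pv ?w) \<in> edges L2" using tws ne by auto
    qed
    have "?w \<notin> X"
    proof
      assume "?w \<in> X"
      then obtain k where "k < length xs" "xs ! k = ?w"
        using XL xs(2) by (metis in_set_conv_nth subsetD)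
      then obtain j where j: "Suc j < length xs" "?w \<in> {xs ! j, xs ! Suc j}"
        using path_vertex_edge[OF xs(1) l2(1)] by metis
      have e1: "{xs ! j, xs ! Suc j} \<in> edges L1" using xs(3) j by auto
      then obtain v where "v \<in> V" "{xs ! j, xs ! Suc j} = ed v" using assms(3) L by blast
      then have "{xs ! j, xs ! Suc j} \<in> {ed ?w, ed (pv ?w)}" using j(2) in_ed[of ?w v] by auto
      then show False using e1 both assms(4) by auto
    qed
    then have "?w \<in> R \<longleftrightarrow> pv ?w \<in> R" using R(2) in_bd[of ?w R] by auto
    then show ?thesis using tws by auto
  qed
  have all: "t i \<in> R \<longleftrightarrow> t 0 \<in> R" if "Suc i < length ys" for i
    using that same by (induction i) auto
  have "y \<in> R \<longleftrightarrow> t 0 \<in> R" if y: "y \<in> Y" for y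
  proof -
    obtain k where "k < length ys" "ys ! k = y" using YL ys(2) y by (metis in_set_conv_nth subsetD)
    then obtain j where j: "Suc j < length ys" "y \<in> {ys ! j, ys ! Suc j}"
      using path_vertex_edge[OF ys(1) l2(2)] by metis
    have "y \<notin> bd R" using R(2) XY y by auto
    then have "y \<in> R \<longleftrightarrow> t j \<in> R" using tw[OF j] by (auto simp: in_bd)
    then show ?thesis using all[OF j(1)] by simp
  qed
  then show False using R(3,4) by blast
qed

end

end

lemma cycle_graph_long_cyclic:
  assumes "cycle_graph L"
  shows "\<exists>nx pv. long_cyclic (verts L) nx pv \<and> edges L = (\<lambda>v. {v, nx v}) ` verts L"
proof -
  obtain xs where xs: "3 \<le> length xs" "distinct xs" "verts L = set xs"
    "edges L = {{xs ! i, xs ! (Suc i mod length xs)} | i. i < length xs}"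
    using assms unfolding cycle_graph_def by auto
  let ?n = "length xs"
  have n0: "0 < ?n" using xs(1) by linarith
  define idx where "idx v = (THE i. i < ?n \<and> xs ! i = v)" for v
  have idx: "idx (xs ! i) = i" if "i < ?n" for i
    unfolding idx_def using that xs(2) by (intro the_equality) (auto simp: nth_eq_iff_index_eq)
  \<comment> \<open>Off the cycle both maps are the identity, because the locale asks for inverse
    maps on the whole type. Adding \<open>?n - 1\<close> modulo \<open>?n\<close> steps back without
    a special case at index 0.\<close>
  define nx where "nx v = (if v \<in> set xs then xs ! (Suc (idx v) mod ?n) else v)" for v
  define pv where "pv v = (if v \<in> set xs then xs ! ((idx v + (?n - 1)) mod ?n) else v)" for v
  have nxi: "nx (xs ! i) = xs ! (Suc i mod ?n)" if "i < ?n" for i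
    using that by (simp add: nx_def idx)
  have pvi: "pv (xs ! i) = xs ! ((i + (?n - 1)) mod ?n)" if "i < ?n" for i
    using that by (simp add: pv_def idx)
  have lt: "m mod ?n < ?n" for m using n0 by simp
  have "long_cyclic (verts L) nx pv"
  proof
    show "finite (verts L)" using xs by simp
    show "3 \<le> card (verts L)" using xs by (simp add: distinct_card)
    show "nx v \<in> verts L \<longleftrightarrow> v \<in> verts L" for v using xs(3) lt by (auto simp: nx_def)
    show "nx (pv v) = v" for v
    proof (cases "v \<in> set xs")
      case True
      then obtain i where i: "i < ?n" "v = xs ! i" by (auto simp: in_set_conv_nth)
      have "Suc ((i + (?n - 1)) mod ?n) mod ?n = Suc (i + (?n - 1)) mod ?n" by (rule mod_Suc_eq)
      also have "Suc (i + (?n - 1)) = i + ?n" using n0 by simp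
      finally have "Suc ((i + (?n - 1)) mod ?n) mod ?n = i" using i by simp
      then show ?thesis using i nxi[OF lt] pvi[OF i(1)] by simp
    qed (simp add: nx_def pv_def)
    show "pv (nx v) = v" for v
    proof (cases "v \<in> set xs")
      case True
      then obtain i where i: "i < ?n" "v = xs ! i" by (auto simp: in_set_conv_nth)
      have "(Suc i mod ?n + (?n - 1)) mod ?n = (Suc i + (?n - 1)) mod ?n" by (rule mod_add_left_eq)
      also have "Suc i + (?n - 1) = i + ?n" using n0 by simp
      finally have "(Suc i mod ?n + (?n - 1)) mod ?n = i" using i by simp
      then show ?thesis using i pvi[OF lt] nxi[OF i(1)] by simp
    qed (simp add: nx_def pv_def)
    show "Z = verts L" if Z: "Z \<subseteq> verts L" "Z \<noteq> {}" and cl: "\<And>v. v \<in> Z \<Longrightarrow> nx v \<in> Z" for Z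
    proof -
      obtain i where i: "i < ?n" "xs ! i \<in> Z" using Z xs(3) by (metis all_not_in_conv in_set_conv_nth subsetD)
      have shift: "xs ! ((i + k) mod ?n) \<in> Z" for k
      proof (induction k)
        case (Suc k)
        have "nx (xs ! ((i + k) mod ?n)) = xs ! (Suc (i + k) mod ?n)"
          using nxi[OF lt, of "i + k"] by (simp add: mod_Suc_eq)
        then show ?case using cl[OF Suc] by simp
      qed (use i in simp)
      have "xs ! j \<in> Z" if "j < ?n" for j
      proof -
        have "i + (j + (?n - i)) = j + ?n" using i by simp
        then show ?thesis using shift[of "j + (?n - i)"] that by simp
      qed
      then show ?thesis using Z(1) xs(3) by (auto simp: in_set_conv_nth)
    qed
  qed
  moreover have "edges L = (\<lambda>v. {v, nx v}) ` verts L"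
  proof -
    have m1: "e \<in> edges L \<longleftrightarrow> (\<exists>i<?n. e = {xs ! i, nx (xs ! i)})" for e unfolding xs(4) using nxi by auto
    have m2: "e \<in> (\<lambda>v. {v, nx v}) ` set xs \<longleftrightarrow> (\<exists>i<?n. e = {xs ! i, nx (xs ! i)})" for e
      unfolding set_conv_nth by blast
    show ?thesis unfolding xs(3) by (rule set_eqI) (simp only: m1 m2)
  qed
  ultimately show ?thesis by blast
qed

section \<open>Cycles through attached trees\<close>

lemma cycle_graph_edges:
  assumes "cycle_graph C"
  shows "odds (edges C) = {}" "verts C = \<Union>(edges C)" "edges C \<noteq> {}" "edge_set (edges C)"
proof -
  obtain nx pv where c: "long_cyclic (verts C) nx pv" "edges C = (\<lambda>v. {v, nx v}) ` verts C"
    using cycle_graph_long_cyclic[OF assms] by auto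
  interpret c: long_cyclic "verts C" nx pv by (rule c(1))
  have e: "edges C = c.ed ` verts C" using c(2) by (simp add: c.ed_def)
  have "c.bd (verts C) = {}" by (simp add: c.bd_def)
  then show "odds (edges C) = {}" unfolding e using c.odds_ed[of "verts C"] by simp
  show "edge_set (edges C)" unfolding e by (rule c.edge_set_ed) simp
  have "verts C \<noteq> {}" using c.three by auto
  then show "edges C \<noteq> {}" unfolding e by simp
  show "verts C = \<Union>(edges C)" unfolding e c.ed_def by auto
qed

text \<open>Without vertices of degree one there is a cycle in \<open>F\<close>, which is itself a
  nonempty even subset.\<close>

lemma minimal_even_cycle:
  assumes F: "edge_set F" "F \<noteq> {}" "odds F = {}"
    and min: "\<And>W. W \<subseteq> F \<Longrightarrow> W \<noteq> {} \<Longrightarrow> odds W = {} \<Longrightarrow> W = F"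
  shows "cycle_graph (Graph (\<Union>F) F)"
proof -
  have "card {e \<in> F. v \<in> e} \<noteq> 1" for v
  proof
    assume "card {e \<in> F. v \<in> e} = 1"
    then have "v \<in> odds F" by (simp add: odds_def)
    then show False using F by simp
  qed
  then obtain C where C: "cycle_graph C" "edges C \<subseteq> F" using ex_cycle[OF F(1,2)] by metis
  then have "edges C = F" using min cycle_graph_edges by metis
  then have "C = Graph (\<Union>F) F" using cycle_graph_edges(2)[OF C(1)] by (metis graph.collapse)
  then show ?thesis using C by simp
qed

locale attached_trees = long_cyclic +
  fixes I :: "'i set" and T :: "'i \<Rightarrow> 'a graph"
  assumes finI: "finite I" and tree: "i \<in> I \<Longrightarrow> tree_graph (T i)"
    and T_disj: "\<lbrakk>i \<in> I; j \<in> I; i \<noteq> j\<rbrakk> \<Longrightarrow> verts (T i) \<inter> verts (T j) = {}"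
    and T_ed: "i \<in> I \<Longrightarrow> edges (T i) \<inter> ed ` V = {}"
    and T_leaves: "i \<in> I \<Longrightarrow> leaves (T i) = V \<inter> verts (T i)"
begin

definition Q :: "'i \<Rightarrow> 'a set" where "Q i = V \<inter> verts (T i)"

text \<open>Where such a set exists it is unique, the tree being acyclic: the path between two
  vertices of \<open>P\<close>, and the empty set for \<open>P = {}\<close>.\<close>

definition J :: "'i \<Rightarrow> 'a set \<Rightarrow> 'a set set" where
  "J i P = (SOME J. J \<subseteq> edges (T i) \<and> odds J = P)"

definition cyc :: "'a set \<Rightarrow> 'a set set" where
  "cyc E = ed ` E \<union> (\<Union>i\<in>I. J i (bd E \<inter> Q i))"

definition admissible :: "'a set \<Rightarrow> bool" where
  "admissible E \<longleftrightarrow> E \<subseteq> V \<and> bd E \<subseteq> \<Union>(Q ` I) \<and> (\<forall>i\<in>I. card (bd E \<inter> Q i) \<in> {0, 2})"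

lemma T_sub: "i \<in> I \<Longrightarrow> e \<in> edges (T i) \<Longrightarrow> e \<subseteq> verts (T i) \<and> e \<noteq> {}"
  using tree[of i] unfolding tree_graph_def simple_graph_def by auto

lemma T_edges_disj: "\<lbrakk>i \<in> I; j \<in> I; i \<noteq> j\<rbrakk> \<Longrightarrow> edges (T i) \<inter> edges (T j) = {}"
  using T_sub T_disj by blast

lemma J:
  assumes "admissible E" "i \<in> I"
  shows "J i (bd E \<inter> Q i) \<subseteq> edges (T i)" "odds (J i (bd E \<inter> Q i)) = bd E \<inter> Q i"
proof -
  have "finite (bd E)" using assms finite_bd by (auto simp: admissible_def)
  then have "\<exists>J\<subseteq>edges (T i). odds J = bd E \<inter> Q i"
    using assms by (intro tree_join_pair tree) (auto simp: admissible_def Q_def)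
  then show "J i (bd E \<inter> Q i) \<subseteq> edges (T i)" "odds (J i (bd E \<inter> Q i)) = bd E \<inter> Q i"
    unfolding J_def by (metis (mono_tags, lifting) someI_ex)+
qed

lemma cyc_ed: "admissible E \<Longrightarrow> v \<in> V \<Longrightarrow> ed v \<in> cyc E \<longleftrightarrow> v \<in> E"
  using J(1) T_ed ed_image[of E v] unfolding cyc_def admissible_def by blast

lemma cyc_tree: "admissible E \<Longrightarrow> i \<in> I \<Longrightarrow> cyc E \<inter> edges (T i) = J i (bd E \<inter> Q i)"
proof -
  assume a: "admissible E" "i \<in> I"
  have "J j (bd E \<inter> Q j) \<inter> edges (T i) = {}" if "j \<in> I" "j \<noteq> i" for j
    using J(1)[OF a(1) that(1)] T_edges_disj[OF that(1) a(2) that(2)] by blast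
  moreover have "ed ` E \<inter> edges (T i) = {}" using T_ed[OF a(2)] a(1) unfolding admissible_def by blast
  ultimately show "cyc E \<inter> edges (T i) = J i (bd E \<inter> Q i)"
    using J(1)[OF a] a(2) unfolding cyc_def by blast
qed

lemma cyc_subset: "admissible E \<Longrightarrow> cyc E \<subseteq> ed ` V \<union> (\<Union>i\<in>I. edges (T i))"
  using J(1) unfolding cyc_def admissible_def by blast

lemma edge_set_cyc:
  assumes "admissible E" shows "edge_set (cyc E)"
proof -
  have "edge_set (ed ` V \<union> (\<Union>i\<in>I. edges (T i)))"
    using edge_set_ed[of V] tree_edge_set[OF tree] finI unfolding edge_set_def by auto
  then show ?thesis using cyc_subset[OF assms] edge_set_subset by blast
qed

text \<open>The degree of \<open>v\<close> is the sum of its degree on the cycle, whose parity is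
  given by \<open>bd Z\<close>, and its degree in the only tree through \<open>v\<close>, if there
  is one.\<close>

lemma odds_trace:
  assumes W: "W \<subseteq> ed ` V \<union> (\<Union>i\<in>I. edges (T i))"
  defines "Z \<equiv> {v \<in> V. ed v \<in> W}"
  shows "i \<in> I \<Longrightarrow> v \<in> verts (T i) \<Longrightarrow> v \<in> odds W \<longleftrightarrow> (v \<in> bd Z) \<noteq> (v \<in> odds (W \<inter> edges (T i)))"
    and "v \<notin> (\<Union>i\<in>I. verts (T i)) \<Longrightarrow> v \<in> odds W \<longleftrightarrow> v \<in> bd Z"
proof -
  have ZV: "Z \<subseteq> V" by (auto simp: Z_def)
  have Zed: "e \<in> ed ` Z \<longleftrightarrow> e \<in> W \<and> e \<in> ed ` V" for e by (auto simp: Z_def)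
  have bdZ: "v \<in> bd Z \<longleftrightarrow> odd (card {e \<in> ed ` Z. v \<in> e})" using odds_ed[OF ZV] by (auto simp: odds_def)
  have fin: "finite (ed ` Z)" using ZV finV finite_subset by blast
  show "v \<in> odds W \<longleftrightarrow> (v \<in> bd Z) \<noteq> (v \<in> odds (W \<inter> edges (T i)))" if i: "i \<in> I" "v \<in> verts (T i)"
  proof -
    let ?A = "{e \<in> ed ` Z. v \<in> e}" and ?B = "{e \<in> W \<inter> edges (T i). v \<in> e}"
    have tr: "e \<in> edges (T i)" if "e \<in> edges (T j)" "j \<in> I" "v \<in> e" for e j
    proof -
      have "v \<in> verts (T j)" using T_sub that by blast
      then have "j = i" using T_disj i that by blast
      then show ?thesis using that by simp
    qed
    have "e \<in> {e \<in> W. v \<in> e} \<longleftrightarrow> e \<in> ?A \<union> ?B" for e using Zed[of e] W tr[of e] by blast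
    then have "{e \<in> W. v \<in> e} = ?A \<union> ?B" by blast
    moreover have "?A \<inter> ?B = {}"
    proof -
      have "?A \<subseteq> ed ` V" "?B \<subseteq> edges (T i)" using ZV by auto
      then show ?thesis using T_ed[OF i(1)] by blast
    qed
    moreover have "finite ?B" using tree_edge_set[OF tree[OF i(1)]] by (auto simp: edge_set_def)
    moreover have "finite ?A" using fin by simp
    ultimately show ?thesis using even_card_disjoint_Un[of ?A ?B] bdZ by (simp add: odds_def)
  qed
  show "v \<in> odds W \<longleftrightarrow> v \<in> bd Z" if v: "v \<notin> (\<Union>i\<in>I. verts (T i))"
  proof -
    have "v \<notin> e" if "e \<in> edges (T i)" "i \<in> I" for e i using T_sub that v by blast
    then have "e \<in> ed ` V" if "e \<in> W" "v \<in> e" for e using W that by blast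
    then have "{e \<in> W. v \<in> e} = {e \<in> ed ` Z. v \<in> e}" using Zed by auto
    then show ?thesis using bdZ by (simp add: odds_def)
  qed
qed

lemma even_trace:
  assumes W: "W \<subseteq> ed ` V \<union> (\<Union>i\<in>I. edges (T i))" "odds W = {}"
  defines "Z \<equiv> {v \<in> V. ed v \<in> W}"
  shows "i \<in> I \<Longrightarrow> odds (W \<inter> edges (T i)) = bd Z \<inter> Q i" "bd Z \<subseteq> \<Union>(Q ` I)"
proof -
  note o = odds_trace[OF W(1), folded Z_def]
  have ZV: "bd Z \<subseteq> V" by (intro bd_subset) (auto simp: Z_def)
  show "odds (W \<inter> edges (T i)) = bd Z \<inter> Q i" if i: "i \<in> I"
  proof -
    have "odds (W \<inter> edges (T i)) \<subseteq> verts (T i)"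
      using odds_subset[of "W \<inter> edges (T i)"] T_sub[OF i] by blast
    moreover have "v \<in> odds (W \<inter> edges (T i)) \<longleftrightarrow> v \<in> bd Z" if "v \<in> verts (T i)" for v
      using o(1)[OF i that] W(2) by simp
    ultimately show ?thesis using ZV by (auto simp: Q_def)
  qed
  show "bd Z \<subseteq> \<Union>(Q ` I)"
  proof
    fix v assume v: "v \<in> bd Z"
    then have "v \<in> (\<Union>i\<in>I. verts (T i))" using o(2)[of v] W(2) by blast
    then show "v \<in> \<Union>(Q ` I)" using v ZV by (auto simp: Q_def)
  qed
qed

lemma odds_cyc:
  assumes "admissible E" shows "odds (cyc E) = {}"
proof -
  have "{v \<in> V. ed v \<in> cyc E} = E" using cyc_ed[OF assms] assms by (auto simp: admissible_def)
  note o = odds_trace[OF cyc_subset[OF assms], unfolded this]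
  have "v \<notin> odds (cyc E)" for v
  proof (cases "v \<in> (\<Union>i\<in>I. verts (T i))")
    case True
    then obtain i where i: "i \<in> I" "v \<in> verts (T i)" by auto
    have "v \<in> bd E \<longleftrightarrow> v \<in> bd E \<inter> Q i" using i assms bd_subset[of E] by (auto simp: admissible_def Q_def)
    then show ?thesis using o(1)[OF i] unfolding cyc_tree[OF assms i(1)] J(2)[OF assms i(1)] by simp
  next
    case False
    then have "v \<notin> bd E" using assms by (auto simp: admissible_def Q_def)
    then show ?thesis using o(2)[OF False] by simp
  qed
  then show ?thesis by auto
qed

text \<open>The trace \<open>Z\<close> of an even subgraph \<open>W\<close> is closed because
  attachments are leaves: if \<open>W\<close> uses the only tree edge at an attachment, so does the
  path of \<open>E\<close>, which must then end there. The trace determines \<open>W\<close>, since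
  edge sets of a tree with equal odd vertices coincide.\<close>

lemma cyc_cycle:
  assumes E: "admissible E" "E \<noteq> {}" "irr (Q ` I) E"
  shows "cycle_graph (Graph (\<Union>(cyc E)) (cyc E))"
proof (rule minimal_even_cycle)
  show "edge_set (cyc E)" "odds (cyc E) = {}" using edge_set_cyc odds_cyc E by auto
  show "cyc E \<noteq> {}" using E by (auto simp: cyc_def)
  fix W assume W: "W \<subseteq> cyc E" "W \<noteq> {}" "odds W = {}"
  define Z where "Z = {v \<in> V. ed v \<in> W}"
  have WV: "W \<subseteq> ed ` V \<union> (\<Union>i\<in>I. edges (T i))" using W(1) cyc_subset[OF E(1)] by blast
  note tr = even_trace[OF WV W(3), folded Z_def]
  have EV: "E \<subseteq> V" using E by (auto simp: admissible_def)
  have WJ: "W \<inter> edges (T i) \<subseteq> J i (bd E \<inter> Q i)" if "i \<in> I" for i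
    using W(1) cyc_tree[OF E(1) that] by blast
  have "Z \<subseteq> E" using W(1) cyc_ed[OF E(1)] by (auto simp: Z_def)
  moreover have "bd Z \<subseteq> bd E"
  proof
    fix v assume v: "v \<in> bd Z"
    then obtain i where i: "i \<in> I" "v \<in> Q i" using tr(2) by auto
    then have "card {e \<in> edges (T i). v \<in> e} = 1" using T_leaves by (auto simp: Q_def leaves_def)
    then obtain f where f: "{e \<in> edges (T i). v \<in> e} = {f}" by (auto simp: card_1_singleton_iff)
    have "v \<in> odds (W \<inter> edges (T i))" using v i tr(1) by auto
    then obtain e where e: "e \<in> W \<inter> edges (T i)" "v \<in> e"
      using odds_subset[of "W \<inter> edges (T i)"] by auto
    then have "e = f" using f by auto
    then have "{e \<in> J i (bd E \<inter> Q i). v \<in> e} = {f}" using f e WJ[OF i(1)] J(1)[OF E(1) i(1)] by blast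
    then have "v \<in> odds (J i (bd E \<inter> Q i))" by (simp add: odds_def)
    then show "v \<in> bd E" using J(2)[OF E(1) i(1)] by auto
  qed
  moreover have "even (card (bd Z \<inter> q))" if "q \<in> Q ` I" for q
  proof -
    obtain i where i: "i \<in> I" "q = Q i" using \<open>q \<in> Q ` I\<close> by auto
    have "edge_set (W \<inter> edges (T i))" using edge_set_subset[OF tree_edge_set[OF tree[OF i(1)]]] by auto
    then show ?thesis using even_odds tr(1)[OF i(1)] i(2) by metis
  qed
  ultimately have "closed (Q ` I) E Z" unfolding closed_def by simp
  then have "Z = {} \<or> Z = E" using E(3) unfolding irr_def by simp
  then show "W = cyc E"
  proof
    assume "Z = {}"
    then have "W \<inter> edges (T i) = {}" if "i \<in> I" for i
      using tree_even_empty[OF tree[OF that], of "W \<inter> edges (T i)"] tr(1)[OF that] by auto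
    moreover have "W \<inter> ed ` V = {}" using \<open>Z = {}\<close> by (auto simp: Z_def)
    moreover have "e \<in> ed ` V \<or> (\<exists>i\<in>I. e \<in> edges (T i))" if "e \<in> W" for e using WV that by auto
    ultimately have "W = {}" by (metis IntI empty_iff equals0I)
    then show ?thesis using W by simp
  next
    assume ZE: "Z = E"
    have "W \<inter> edges (T i) = J i (bd E \<inter> Q i)" if i: "i \<in> I" for i
    proof -
      let ?A = "W \<inter> edges (T i)" and ?B = "J i (bd E \<inter> Q i)"
      have sub: "?A \<subseteq> edges (T i)" "?B \<subseteq> edges (T i)" using J(1)[OF E(1) i] by auto
      moreover have "finite (edges (T i))" using tree_edge_set[OF tree[OF i]] by (simp add: edge_set_def)
      ultimately have "finite ?A" "finite ?B" by (auto intro: finite_subset)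
      then have "odds ((?A - ?B) \<union> (?B - ?A)) = {}"
        using odds_sym_diff[of ?A ?B] tr(1)[OF i] J(2)[OF E(1) i] ZE by simp
      moreover have "(?A - ?B) \<union> (?B - ?A) \<subseteq> edges (T i)" using sub(2) by auto
      ultimately have "(?A - ?B) \<union> (?B - ?A) = {}" by (intro tree_even_empty[OF tree[OF i]])
      then show ?thesis by auto
    qed
    then have "J i (bd E \<inter> Q i) \<subseteq> W" if "i \<in> I" for i using that by (metis Int_lower1)
    moreover have "ed ` E \<subseteq> W" using ZE by (auto simp: Z_def)
    ultimately have "cyc E \<subseteq> W" unfolding cyc_def by (intro Un_least UN_least)
    then show ?thesis using W(1) by simp
  qed
qed

lemma good_admissible:
  assumes "good (Q ` I) E" shows "admissible E" "admissible (V - E)"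
  using assms bd_Compl[of E] unfolding good_def admissible_def by auto

lemma sym_diff_cyc:
  assumes "good (Q ` I) E"
  shows "(ed ` V - cyc E) \<union> (cyc E - ed ` V) = cyc (V - E)"
proof -
  note a = good_admissible[OF assms]
  have EV: "E \<subseteq> V" using a by (simp add: admissible_def)
  have "J i (bd E \<inter> Q i) \<inter> ed ` V = {}" if "i \<in> I" for i using J(1)[OF a(1) that] T_ed[OF that] by blast
  then have "cyc E - ed ` V = (\<Union>i\<in>I. J i (bd E \<inter> Q i))" using EV unfolding cyc_def by blast
  moreover have "ed ` V - cyc E = ed ` (V - E)" using cyc_ed[OF a(1)] by blast
  ultimately show ?thesis using bd_Compl[OF EV] by (simp add: cyc_def)
qed

text \<open>The path of a member uses \<open>f\<close> exactly when \<open>f\<close> separates its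
  ends. Both sides of \<open>f\<close> contain leaves, so they define a proper cut of
  \<open>Q i\<close>.\<close>

lemma tree_edge_count:
  assumes F: "fam (Q ` I) F" and i: "i \<in> I" and f: "f \<in> edges (T i)"
  shows "4 \<le> cnt (\<lambda>E. f \<in> cyc E) F"
proof -
  obtain X where X: "X \<inter> leaves (T i) \<noteq> {}" "leaves (T i) - X \<noteq> {}"
    "\<And>J. J \<subseteq> edges (T i) \<Longrightarrow> f \<in> J \<longleftrightarrow> odd (card (odds J \<inter> X))"
    using tree_side[OF tree[OF i] f] by blast
  have l: "leaves (T i) = Q i" using T_leaves[OF i] by (simp add: Q_def)
  have "f \<in> cyc E \<longleftrightarrow> odd (card (bd E \<inter> (Q i \<inter> X)))" if "E \<in># F" for E
  proof -
    have a: "admissible E" using F that good_admissible unfolding fam_def by auto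
    have "f \<in> cyc E \<longleftrightarrow> f \<in> J i (bd E \<inter> Q i)" using cyc_tree[OF a i] f by blast
    also have "\<dots> \<longleftrightarrow> odd (card (odds (J i (bd E \<inter> Q i)) \<inter> X))" using X(3) J(1)[OF a i] by simp
    finally show ?thesis unfolding J(2)[OF a i] by (simp add: Int_assoc)
  qed
  then have "cnt (\<lambda>E. f \<in> cyc E) F = cnt (\<lambda>E. odd (card (bd E \<inter> (Q i \<inter> X)))) F" by (rule cnt_cong)
  moreover have "Q i \<inter> X \<subseteq> Q i \<and> Q i \<inter> X \<noteq> {} \<and> Q i \<inter> X \<noteq> Q i" using X(1,2) l by auto
  then have "4 \<le> cnt (\<lambda>E. odd (card (bd E \<inter> (Q i \<inter> X)))) F"
    using F i unfolding fam_def by blast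
  ultimately show ?thesis by simp
qed

end

section \<open>Bridges\<close>

lemma delete_verts_simps:
  "verts (delete_verts G X) = verts G - X"
  "edges (delete_verts G X) = {e \<in> edges G. e \<subseteq> verts G - X}"
  by (auto simp: delete_verts_def induced_subgraph_def)

lemma bridgesE:
  assumes "B \<in> bridges G L"
  obtains (chord) e where "B = Graph e {e}" "e \<in> edges G - edges L" "e \<subseteq> verts L"
  | (comp) D F where "component D (delete_verts G (verts L))"
      "F = {e \<in> edges G. e \<inter> verts D \<noteq> {} \<and> e \<inter> verts L \<noteq> {}}"
      "B = Graph (verts D \<union> \<Union>F) (edges D \<union> F)"
proof -
  from assms consider (1) e where "B = Graph e {e}" "e \<in> edges G - edges L" "e \<subseteq> verts L"
    | (2) D where "component D (delete_verts G (verts L))" "B = bridge_of_component G L D"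
    unfolding bridges_def by blast
  then show thesis
  proof cases
    case 1
    then show ?thesis by (rule chord)
  next
    case 2
    then show ?thesis unfolding bridge_of_component_def Let_def by (intro comp[OF 2(1) refl])
  qed
qed

lemma bridge_edges:
  assumes G: "simple_graph G" and L: "subgraph L G" and B: "B \<in> bridges G L"
  shows "edges B \<inter> edges L = {}" "edges B \<subseteq> edges G" "verts B \<subseteq> verts G"
proof -
  have eL: "e \<subseteq> verts L" if "e \<in> edges L" for e using L that unfolding subgraph_def simple_graph_def by auto
  have ne: "e \<noteq> {}" "e \<subseteq> verts G" if "e \<in> edges G" for e using G that unfolding simple_graph_def by auto
  from B have "edges B \<inter> edges L = {} \<and> edges B \<subseteq> edges G \<and> verts B \<subseteq> verts G"
  proof (cases rule: bridgesE)
    case (chord e)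
    then show ?thesis using ne by auto
  next
    case (comp D F)
    then have D: "verts D \<subseteq> verts G - verts L" "edges D \<subseteq> {e \<in> edges G. e \<subseteq> verts G - verts L}"
      unfolding component_def subgraph_def delete_verts_simps by auto
    have "edges D \<inter> edges L = {}"
    proof (rule equals0I)
      fix e assume e: "e \<in> edges D \<inter> edges L"
      then have "e \<subseteq> verts G - verts L" "e \<subseteq> verts L" "e \<in> edges G" using D eL by auto
      then show False using ne by blast
    qed
    moreover have "F \<inter> edges L = {}"
    proof (rule equals0I)
      fix e assume e: "e \<in> F \<inter> edges L"
      then have "e \<inter> verts D \<noteq> {}" "e \<subseteq> verts L" using comp eL by auto
      then show False using D by blast
    qed
    moreover have "\<Union>F \<subseteq> verts G" "F \<subseteq> edges G" using comp ne by auto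
    moreover have "edges B = edges D \<union> F" "verts B = verts D \<union> \<Union>F" using comp by auto
    moreover have "edges D \<subseteq> edges G" "verts D \<subseteq> verts G" using D by auto
    ultimately show ?thesis by (simp add: Int_Un_distrib2)
  qed
  then show "edges B \<inter> edges L = {}" "edges B \<subseteq> edges G" "verts B \<subseteq> verts G" by auto
qed

text \<open>A bridge without edges would be an isolated vertex of the connected graph
  \<open>G\<close>. Together with \<open>tree_leaves\<close> this gives every attachment set at
  least two elements.\<close>

lemma bridge_tree_edges:
  assumes G: "simple_graph G" "connected_graph G" and L: "subgraph L G" "verts L \<noteq> {}"
    and B: "B \<in> bridges G L" "tree_graph B"
  shows "edges B \<noteq> {}"
proof
  assume empty: "edges B = {}"
  from B(1) show False
  proof (cases rule: bridgesE)
    case (chord e)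
    then show ?thesis using empty by auto
  next
    case (comp D F)
    let ?H = "delete_verts G (verts L)"
    have DF: "edges D = {}" "F = {}" using comp empty by auto
    have D: "subgraph D ?H" "connected_graph D" "\<And>D'. subgraph D' ?H \<Longrightarrow> connected_graph D' \<Longrightarrow> subgraph D D' \<Longrightarrow> D' = D"
      using comp unfolding component_def by auto
    obtain v where v: "v \<in> verts D" using D by (auto simp: connected_graph_def)
    have single: "verts D = {v}"
    proof -
      have "w = v" if "w \<in> verts D" for w
      proof -
        have "(v, w) \<in> {(x, y). {x, y} \<in> edges D}\<^sup>*" using D(2) v that unfolding connected_graph_def by auto
        then show ?thesis using DF by simp
      qed
      then show ?thesis using v by blast
    qed
    have vG: "v \<in> verts G" "v \<notin> verts L" using D(1) v unfolding subgraph_def delete_verts_simps by auto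
    obtain u where u: "u \<in> verts L" "u \<in> verts G" using L unfolding subgraph_def by auto
    have "(v, u) \<in> {(x, y). {x, y} \<in> edges G}\<^sup>*" using G(2) vG u unfolding connected_graph_def by auto
    moreover have "v \<noteq> u" using u vG by auto
    ultimately obtain w where w: "{v, w} \<in> edges G" by (cases rule: converse_rtranclE) auto
    then have wG: "w \<in> verts G" "w \<noteq> v" using G(1) unfolding simple_graph_def by auto
    show False
    proof (cases "w \<in> verts L")
      case True
      then have "{v, w} \<in> F" using comp(2) w single by auto
      then show ?thesis using DF by simp
    next
      case False
      let ?D = "Graph {v, w} {{v, w}}"
      have "simple_graph ?D" using wG by (auto simp: simple_graph_def)
      moreover have "subgraph ?D ?H" using wG vG w False calculation by (auto simp: subgraph_def delete_verts_simps)
      moreover have "connected_graph ?D"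
        unfolding connected_graph_def by (auto simp: insert_commute intro!: r_into_rtrancl)
      moreover have "subgraph D ?D" using D(1) single DF unfolding subgraph_def by auto
      ultimately have "?D = D" using D(3) by blast
      then show ?thesis using DF by auto
    qed
  qed
qed

text \<open>The vertices reachable from \<open>v\<close> with all edges of \<open>H\<close> among
  them; maximality of a component concerns its edges as well.\<close>

lemma ex_component:
  assumes H: "simple_graph H" and v: "v \<in> verts H"
  shows "\<exists>D. component D H \<and> v \<in> verts D \<and> {e \<in> edges H. v \<in> e} \<subseteq> edges D"
proof -
  define r where "r = {(x, y). {x, y} \<in> edges H}"
  define U where "U = {w. (v, w) \<in> r\<^sup>*}"
  have symr: "sym (r\<^sup>*)" by (intro sym_rtrancl) (auto simp: sym_def r_def insert_commute)
  have eH: "e \<subseteq> verts H" if "e \<in> edges H" for e using H that by (auto simp: simple_graph_def)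
  have "U \<subseteq> verts H"
  proof
    fix w assume "w \<in> U"
    then have "(v, w) \<in> r\<^sup>*" by (simp add: U_def)
    then show "w \<in> verts H" by (induction rule: rtrancl_induct) (use v eH in \<open>auto simp: r_def\<close>)
  qed
  define D where "D = Graph U {e \<in> edges H. e \<subseteq> U}"
  have vU: "v \<in> U" by (simp add: U_def)
  have UD: "(v, w) \<in> {(x, y). {x, y} \<in> edges D}\<^sup>*" if "(v, w) \<in> r\<^sup>*" for w
    using that
  proof (induction rule: rtrancl_induct)
    case (step y z)
    then have "y \<in> U" "z \<in> U" by (auto simp: U_def)
    then have "{y, z} \<in> edges D" using step by (auto simp: D_def r_def)
    then show ?case using step.IH by (simp add: rtrancl.rtrancl_into_rtrancl)
  qed simp
  have sD: "sym ({(x, y). {x, y} \<in> edges D}\<^sup>*)" by (intro sym_rtrancl) (auto simp: sym_def insert_commute)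
  have conn: "connected_graph D" unfolding connected_graph_def
  proof (intro conjI ballI)
    show "verts D \<noteq> {}" using vU by (auto simp: D_def)
    fix a b assume "a \<in> verts D" "b \<in> verts D"
    then have "(v, a) \<in> {(x, y). {x, y} \<in> edges D}\<^sup>*" "(v, b) \<in> {(x, y). {x, y} \<in> edges D}\<^sup>*"
      using UD by (auto simp: D_def U_def)
    then show "(a, b) \<in> {(x, y). {x, y} \<in> edges D}\<^sup>*" using sD by (meson rtrancl_trans symD)
  qed
  have sub: "subgraph D H" using H \<open>U \<subseteq> verts H\<close> unfolding subgraph_def simple_graph_def D_def
    by (auto intro: finite_subset)
  have "D' = D" if D': "subgraph D' H" "connected_graph D'" "subgraph D D'" for D'
  proof -
    have sub': "edges D' \<subseteq> edges H" "U \<subseteq> verts D'" "edges D \<subseteq> edges D'" using D' by (auto simp: subgraph_def D_def)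
    have eD': "e \<subseteq> verts D'" if "e \<in> edges D'" for e using D'(1) that by (auto simp: subgraph_def simple_graph_def)
    have "w \<in> U" if "w \<in> verts D'" for w
    proof -
      have "(v, w) \<in> {(x, y). {x, y} \<in> edges D'}\<^sup>*"
        using D'(2) that sub'(2) vU unfolding connected_graph_def by auto
      moreover have "{(x, y). {x, y} \<in> edges D'} \<subseteq> r" using sub'(1) by (auto simp: r_def)
      ultimately show ?thesis using rtrancl_mono by (auto simp: U_def)
    qed
    then have vD': "verts D' = U" using sub'(2) by auto
    have "edges D' = edges D" using sub' eD' vD' by (auto simp: D_def)
    then show ?thesis using vD' by (cases D') (auto simp: D_def)
  qed
  then have "component D H" using sub conn by (auto simp: component_def)
  moreover have "{e \<in> edges H. v \<in> e} \<subseteq> edges D"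
  proof
    fix e assume "e \<in> {e \<in> edges H. v \<in> e}"
    then have e: "e \<in> edges H" "v \<in> e" by auto
    then obtain a b where "e = {a, b}" "a \<noteq> b" using H by (auto simp: simple_graph_def card_2_iff)
    then obtain w where w: "e = {v, w}" using e(2) by (metis insert_commute insertE singletonD)
    then have "(v, w) \<in> r" using e by (simp add: r_def)
    then have "w \<in> U" by (auto simp: U_def)
    then show "e \<in> edges D" using e w vU by (auto simp: D_def)
  qed
  ultimately show ?thesis using vU by (intro exI[of _ D]) (auto simp: D_def)
qed

lemma edge_in_bridge:
  assumes G: "simple_graph G" and e: "e \<in> edges G - edges L"
  shows "\<exists>B\<in>bridges G L. e \<in> edges B"
proof (cases "e \<subseteq> verts L")
  case True
  then show ?thesis using e unfolding bridges_def by (intro bexI[of _ "Graph e {e}"]) auto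
next
  case False
  let ?H = "delete_verts G (verts L)"
  obtain v where v: "v \<in> e" "v \<notin> verts L" using False by auto
  have eG: "e \<subseteq> verts G" "e \<in> edges G" using e G by (auto simp: simple_graph_def)
  have H: "simple_graph ?H" using G by (auto simp: simple_graph_def delete_verts_simps)
  have vH: "v \<in> verts ?H" using v eG by (auto simp: delete_verts_simps)
  obtain D where D: "component D ?H" "v \<in> verts D" "{e \<in> edges ?H. v \<in> e} \<subseteq> edges D"
    using ex_component[OF H vH] by auto
  have "e \<in> edges (bridge_of_component G L D)"
  proof (cases "e \<inter> verts L = {}")
    case True
    then have "e \<in> edges ?H" using eG by (auto simp: delete_verts_simps)
    then show ?thesis using D(3) v by (auto simp: bridge_of_component_def Let_def)
  next
    case False
    then show ?thesis using D(2) v eG by (auto simp: bridge_of_component_def Let_def)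
  qed
  then show ?thesis using D(1) unfolding bridges_def by blast
qed

lemma overlap_sym: "overlap L A B \<Longrightarrow> overlap L B A"
  unfolding overlap_def by (metis Un_commute Int_commute)

theorem theorem4:
  fixes G L :: "'a graph" and T :: "nat \<Rightarrow> 'a graph" and k :: nat
  assumes "simple_graph G"
    and "two_connected G"
    and "subgraph L G"
    and "cycle_graph L"
    and "\<forall>i \<in> {1..k}. T i \<in> bridges G L"
    and "\<forall>i \<in> {1..k}. \<forall>j \<in> {1..k}. i \<noteq> j \<longrightarrow> verts (T i) \<inter> verts (T j) = {}"
    and "tree_graph (induced_subgraph (overlap_graph G L) (T ` {1..k}))"
    and "\<forall>i \<in> {1..k}. tree_graph (T i) \<and> leaves (T i) = attachments L (T i)"
  shows "\<exists>\<C> :: 'a graph multiset.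
      (\<forall>C \<in># \<C>. subgraph C G \<and> cycle_graph C) \<and>
      (\<forall>e \<in> edges L. cover_count \<C> e = 2) \<and>
      (\<forall>i \<in> {1..k}. \<forall>e \<in> edges (T i). cover_count \<C> e \<ge> 4) \<and>
      (bridges G L = T ` {1..k} \<longrightarrow> (\<forall>e \<in> edges G - edges L. cover_count \<C> e \<ge> 4)) \<and>
      (\<forall>C \<in># \<C>. cycle_graph (sym_diff_graph L C))"
proof -
  let ?I = "{1..k}" and ?H = "induced_subgraph (overlap_graph G L) (T ` {1..k})"
  obtain nx pv where nx: "long_cyclic (verts L) nx pv" "edges L = (\<lambda>v. {v, nx v}) ` verts L"
    using cycle_graph_long_cyclic[OF assms(4)] by auto
  interpret c: long_cyclic "verts L" nx pv by (rule nx(1))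
  have eL: "edges L = c.ed ` verts L" using nx(2) by (simp add: c.ed_def)
  have br: "T i \<in> bridges G L" "tree_graph (T i)" "leaves (T i) = verts L \<inter> verts (T i)" if "i \<in> ?I" for i
    using assms(5,8) that unfolding attachments_def by auto
  interpret a: attached_trees "verts L" nx pv ?I T
  proof
    show "verts (T i) \<inter> verts (T j) = {}" if "i \<in> ?I" "j \<in> ?I" "i \<noteq> j" for i j using assms(6) that by blast
    show "edges (T i) \<inter> c.ed ` verts L = {}" if "i \<in> ?I" for i
      using bridge_edges(1)[OF assms(1,3) br(1)[OF that]] eL by simp
  qed (use br in auto)
  have VL: "verts L \<noteq> {}" "verts L \<subseteq> verts G" "edges L \<subseteq> edges G"
    using c.three assms(3) by (auto simp: subgraph_def)
  have att: "attachments L (T i) = a.Q i" for i by (simp add: attachments_def a.Q_def)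
  have Q2: "a.Q i \<subseteq> verts L" "2 \<le> card (a.Q i)" if "i \<in> ?I" for i
  proof -
    have "edges (T i) \<noteq> {}"
      using bridge_tree_edges[OF assms(1) _ assms(3) VL(1) br(1,2)[OF that]] assms(2) by (simp add: two_connected_def)
    then show "2 \<le> card (a.Q i)" using tree_leaves[OF br(2)[OF that]] br(3)[OF that] by (simp add: a.Q_def)
    show "a.Q i \<subseteq> verts L" by (auto simp: a.Q_def)
  qed
  have Qd: "a.Q i \<inter> a.Q j = {}" if "i \<in> ?I" "j \<in> ?I" "T i \<noteq> T j" for i j
  proof -
    have "i \<noteq> j" using that by auto
    then show ?thesis using a.T_disj[OF that(1,2)] by (auto simp: a.Q_def)
  qed
  have cross: "c.cross (a.Q i) (a.Q j) \<longleftrightarrow> {T i, T j} \<in> edges ?H"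
    if ij: "i \<in> ?I" "j \<in> ?I" "T i \<noteq> T j" for i j
  proof -
    note s = Q2[OF ij(1)] Q2[OF ij(2)] Qd[OF ij]
    have "overlap L (T i) (T j) \<longleftrightarrow> c.cross (a.Q i) (a.Q j)"
    proof
      assume "overlap L (T i) (T j)"
      then show "c.cross (a.Q i) (a.Q j)"
        using c.split_if_not_cross[OF refl eL s] unfolding overlap_def att by blast
    next
      assume "c.cross (a.Q i) (a.Q j)"
      then show "overlap L (T i) (T j)"
        using c.not_cross_if_split[OF refl eL s] unfolding overlap_def att by blast
    qed
    moreover have "{T i, T j} \<in> edges ?H \<longleftrightarrow> overlap L (T i) (T j)"
      using ij br(1) overlap_sym unfolding induced_subgraph_def overlap_graph_def
      by (auto simp: doubleton_eq_iff)
    ultimately show ?thesis by simp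
  qed
  have vH: "verts ?H = T ` ?I" using br(1) by (auto simp: induced_subgraph_def overlap_graph_def)
  have "c.otree (attachments L ` verts ?H)"
  proof (rule tree_grow[OF assms(7)])
    fix v assume "v \<in> verts ?H"
    then obtain i where "i \<in> ?I" "v = T i" using vH by auto
    then show "c.otree (attachments L ` {v})" using Q2[of i] c.otree_single by (simp add: att)
  next
    fix S u s
    assume S: "S \<subseteq> verts ?H" "c.otree (attachments L ` S)" and u: "u \<in> verts ?H" "u \<notin> S" and s: "s \<in> S"
      and us: "{u, s} \<in> edges ?H" and uniq: "\<And>s'. s' \<in> S \<Longrightarrow> s' \<noteq> s \<Longrightarrow> {u, s'} \<notin> edges ?H"
    obtain i where i: "i \<in> ?I" "u = T i" using u vH by auto
    have idx: "\<exists>j\<in>?I. x = T j \<and> T i \<noteq> T j" if "x \<in> S" for x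
    proof -
      have "x \<in> T ` ?I" using \<open>x \<in> S\<close> S(1) unfolding vH by (rule rev_subsetD)
      then obtain j where j: "j \<in> ?I" "x = T j" by (elim imageE)
      have "T i \<noteq> x" using \<open>x \<in> S\<close> u(2) i(2) by auto
      then show ?thesis using j by (intro bexI[of _ j]) simp_all
    qed
    have "c.otree (insert (attachments L u) (attachments L ` S))"
    proof (rule c.otree_insert[OF S(2), of _ "attachments L s"])
      show "attachments L u \<subseteq> verts L" "2 \<le> card (attachments L u)" using Q2[OF i(1)] i(2) att by auto
      show "attachments L s \<in> attachments L ` S" using s by simp
      show "attachments L u \<inter> \<Union>(attachments L ` S) = {}"
      proof -
        have "attachments L u \<inter> attachments L x = {}" if x: "x \<in> S" for x
        proof -
          obtain j where "j \<in> ?I" "x = T j" "T i \<noteq> T j" using idx[OF x] by auto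
          then show ?thesis using Qd[OF i(1)] i(2) att by simp
        qed
        then show ?thesis by blast
      qed
      obtain j where j: "j \<in> ?I" "s = T j" "T i \<noteq> T j" using idx[OF s] by auto
      show "c.cross (attachments L u) (attachments L s)"
        using cross[OF i(1) j(1,3)] us i(2) j(2) att by simp
      show "\<not> c.cross (attachments L u) q'" if q': "q' \<in> attachments L ` S" "q' \<noteq> attachments L s" for q'
      proof -
        obtain x where x: "x \<in> S" "q' = attachments L x" using q' by auto
        then have "x \<noteq> s" using q' by auto
        obtain m where m: "m \<in> ?I" "x = T m" "T i \<noteq> T m" using idx[OF x(1)] by auto
        show ?thesis using cross[OF i(1) m(1,3)] uniq[OF x(1) \<open>x \<noteq> s\<close>] i(2) m(2) x(2) att by simp
      qed
    qed
    then show "c.otree (attachments L ` insert u S)" by simp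
  qed
  moreover have "attachments L ` verts ?H = a.Q ` ?I" unfolding vH image_image att ..
  ultimately obtain F where F: "c.fam (a.Q ` ?I) F" using c.otree_fam by metis
  have good: "c.good (a.Q ` ?I) E" if "E \<in># F" for E using F that unfolding c.fam_def by auto
  define gr :: "'a set set \<Rightarrow> 'a graph" where "gr K = Graph (\<Union>K) K" for K
  define \<C> where "\<C> = image_mset (\<lambda>E. gr (a.cyc E)) F"
  have cover: "cover_count \<C> e = cnt (\<lambda>E. e \<in> a.cyc E) F" for e
    unfolding cover_count_def \<C>_def cnt_image by (simp add: gr_def)
  have adm: "a.admissible E" "a.admissible (verts L - E)" if "E \<in># F" for E
    using a.good_admissible[OF good[OF that]] .
  \<comment> \<open>A single attachment \<open>v\<close> shows that no good set is all of
    \<open>verts L\<close>, as it cannot contain both edges at \<open>v\<close>; so the complement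
    is nonempty and also yields a cycle.\<close>
  obtain i v where v: "i \<in> ?I" "v \<in> a.Q i"
  proof -
    have "verts ?H \<noteq> {}" using assms(7) by (simp add: tree_graph_def connected_graph_def)
    then obtain i where "i \<in> ?I" using vH by auto
    moreover have "a.Q i \<noteq> {}" using Q2(2)[OF calculation] by auto
    ultimately show thesis using that by auto
  qed
  have cycle: "cycle_graph (gr (a.cyc E))" "cycle_graph (gr (a.cyc (verts L - E)))" if E: "E \<in># F" for E
  proof -
    have g: "E \<noteq> {}" "c.irr (a.Q ` ?I) E" "c.irr (a.Q ` ?I) (verts L - E)" "v \<in> E \<longrightarrow> pv v \<notin> E"
      using good[OF E] v unfolding c.good_def by auto
    have "v \<in> verts L" "pv v \<in> verts L" using v by (simp_all add: a.Q_def)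
    then have "verts L - E \<noteq> {}" using g(4) by blast
    then show "cycle_graph (gr (a.cyc E))" "cycle_graph (gr (a.cyc (verts L - E)))"
      using a.cyc_cycle adm[OF E] g unfolding gr_def by auto
  qed
  have sub: "subgraph (gr (a.cyc E)) G" if E: "E \<in># F" for E
  proof -
    have "a.cyc E \<subseteq> c.ed ` verts L \<union> (\<Union>i\<in>?I. edges (T i))"
      by (rule a.cyc_subset[OF adm(1)[OF E]])
    also have "\<dots> \<subseteq> edges G"
      using VL(3) eL bridge_edges(2)[OF assms(1,3) br(1)] by (intro Un_least UN_least) simp_all
    finally have "a.cyc E \<subseteq> edges G" .
    moreover have "\<forall>e\<in>edges G. e \<subseteq> verts G \<and> card e = 2" "finite (verts G)"
      using assms(1) by (auto simp: simple_graph_def)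
    moreover from calculation have "\<Union>(a.cyc E) \<subseteq> verts G" by blast
    moreover from calculation have "finite (\<Union>(a.cyc E))" using finite_subset by blast
    ultimately show ?thesis unfolding subgraph_def simple_graph_def gr_def by auto
  qed
  have trees: "4 \<le> cover_count \<C> e" if "i \<in> ?I" "e \<in> edges (T i)" for i e
    unfolding cover using a.tree_edge_count[OF F that] .
  show ?thesis
  proof (intro exI[of _ \<C>] conjI impI ballI)
    show "subgraph C G" "cycle_graph C" if "C \<in># \<C>" for C
      using that sub cycle(1) by (auto simp: \<C>_def)
    show "cycle_graph (sym_diff_graph L C)" if C: "C \<in># \<C>" for C
    proof -
      obtain E where E: "E \<in># F" "C = gr (a.cyc E)" using C by (auto simp: \<C>_def)
      have "sym_diff_graph L C = gr (a.cyc (verts L - E))"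
        unfolding sym_diff_graph_def Let_def E(2) a.sym_diff_cyc[OF good[OF E(1)], symmetric] eL gr_def by simp
      then show ?thesis using cycle(2)[OF E(1)] by simp
    qed
    show "cover_count \<C> e = 2" if "e \<in> edges L" for e
    proof -
      obtain w where w: "w \<in> verts L" "e = c.ed w" using \<open>e \<in> edges L\<close> eL by auto
      have "cnt (\<lambda>E. e \<in> a.cyc E) F = cnt (\<lambda>E. w \<in> E) F"
        using a.cyc_ed[OF adm(1) w(1)] w(2) by (intro cnt_cong) simp
      then show ?thesis unfolding cover using F w(1) unfolding c.fam_def by simp
    qed
    show "4 \<le> cover_count \<C> e" if "i \<in> ?I" "e \<in> edges (T i)" for i e using trees[OF that] .
    show "4 \<le> cover_count \<C> e" if b: "bridges G L = T ` ?I" and e: "e \<in> edges G - edges L" for e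
    proof -
      obtain B where "B \<in> bridges G L" "e \<in> edges B" using edge_in_bridge[OF assms(1) e] by auto
      then show ?thesis using b trees by auto
    qed
  qed
qed

end
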